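(* Let $0<m<n$ be relatively prime integers and let $T_{m,n}$ be the associated embedded minimal Legendrian torus in $S^5$ (defined in the context). For $\lambda>0$, denote by $N_{m,n}(\lambda)$ the number of eigenvalues (counted with multiplicity) of the Laplacian $\Delta$ on $T_{m,n}$ in the range $[0,\lambda(\lambda+1)]$. Then $$N_{m,n}(1)\ge\begin{cases}4n+5\ \ge 13 & \text{if } mn \text{ is even},\\ 2n+5\ \ge 11 & \text{if } mn \text{ is odd};\end{cases}$$ $$\operatorname{s-ind}(T_{m,n})\ge\begin{cases}8n+4m-8\ \ge 12 & \text{if } mn \text{ is even},\\ 4n+2m-8\ \ge 6 & \text{if } mn \text{ is odd};\end{cases}$$ $$\operatorname{l-ind}(T_{m,n})\ge\begin{cases}8n+4m-2\ \ge 18 & \text{if } mn \text{ is even},\\ 4n+2m-2\ \ge 12 & \text{if } mn \text{ is odd}.\end{cases}$$ Further, we also have the upper bounds $$N_{m,n}(2)<\begin{cases}36\,\dfrac{\pi}{\sqrt3}\,n-1 & \text{if } mn \text{ is even},\\[2mm] 18\,\dfrac{\pi}{\sqrt3}\,n-1 & \text{if } mn \text{ is odd}.\end{cases}$$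
   Context: **The tori $T_{m,n}$.** Let $\operatorname{sn},\operatorname{cn},\operatorname{dn}$ be the Jacobi elliptic functions with modulus $k$ and $K(k)=\int_0^{\pi/2}(1-k^2\sin^2x)^{-1/2}dx$. For relatively prime integers $0<m<n$ put $$r^2=\frac{n+2m}{n},\qquad k^2=\frac{n^2-m^2}{n(n+2m)},\qquad c_1=\sqrt{\tfrac{n+m}{2n+m}},\quad c_2=\sqrt{\tfrac{n+m}{n+2m}},\quad c_3=\sqrt{\tfrac{n}{2n+m}},$$ with $r,k>0$, and $$u(s,t)=\Big(c_1e^{is}\operatorname{cn}(rt,k),\ i\,c_2e^{i\frac mn s}\operatorname{sn}(rt,k),\ c_3e^{-i(1+\frac mn)s}\operatorname{dn}(rt,k)\Big).$$ Then $u:\mathbb{R}^2\to S^5\subset\mathbb{C}^3$ is a conformal minimal Legendrian immersion. Its period lattice $\Lambda$ has basis $(2n\pi,0),\,(0,4K(k)/r)$ if $mn$ is even, and $(2n\pi,0),\,(n\pi,2K(k)/r)$ if $mn$ is odd. $T_{m,n}$ is the embedded minimal Legendrian torus given by $\mathbb{R}^2/\Lambda$, with the metric induced from $S^5$. **Indices.** $\Delta$ is the nonnegative Laplacian on functions; eigenvalues are counted with multiplicity. For a minimal Legendrian torus $\Sigma$ in $S^5$: $\operatorname{l-ind}(\Sigma)$ is the number of eigenvalues of $\Delta$ in the open interval $(0,6)$; and $$\operatorname{s-ind}(\Sigma)=N_\Sigma(2)-b^0(\Sigma)-6-(\dim SU(3)-\dim G),$$ where $N_\Sigma(2)$ is the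 number of eigenvalues in $[0,6]$, $b^0(\Sigma)=1$, $\dim SU(3)=8$, and $G$ is the subgroup of $SU(3)$ leaving the cone over $\Sigma$ invariant. *)

theory Defs
  imports
    "HOL-Analysis.Analysis"
    "HOL-Library.Function_Algebras"
    "HOL-Library.Extended_Nat"
    "HOL-Library.Extended_Real"
begin

section \<open>Jacobi elliptic functions\<close>

text \<open>All functions take the modulus \<open>k\<close> (not the parameter \<open>k^2\<close>) and are meant for
  \<open>0 \<le> k < 1\<close>. In that range \<open>\<lambda>\<phi>. ell_F \<phi> k\<close> is an increasing bijection of the reals, so the
  description in \<open>jacobi_am\<close> is proper; the interval integral is signed, so this covers negative
  arguments.\<close>

definition ell_F :: "real \<Rightarrow> real \<Rightarrow> real" where
  "ell_F \<phi> k = (LBINT x=ereal 0..ereal \<phi>. 1 / sqrt (1 - k\<^sup>2 * (sin x)\<^sup>2))"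

definition ell_K :: "real \<Rightarrow> real" where
  "ell_K k = (LBINT x=ereal 0..ereal (pi / 2). 1 / sqrt (1 - k\<^sup>2 * (sin x)\<^sup>2))"

definition jacobi_am :: "real \<Rightarrow> real \<Rightarrow> real" where
  "jacobi_am x k = (THE \<phi>. ell_F \<phi> k = x)"

definition jacobi_sn :: "real \<Rightarrow> real \<Rightarrow> real" where
  "jacobi_sn x k = sin (jacobi_am x k)"

definition jacobi_cn :: "real \<Rightarrow> real \<Rightarrow> real" where
  "jacobi_cn x k = cos (jacobi_am x k)"

definition jacobi_dn :: "real \<Rightarrow> real \<Rightarrow> real" where
  "jacobi_dn x k = sqrt (1 - k\<^sup>2 * (jacobi_sn x k)\<^sup>2)"


section \<open>The Laplacian of an immersed torus\<close>

text \<open>A torus in the unit sphere of \<open>complex^3\<close> is given by an immersion \<open>u :: real^2 \<Rightarrow> complex^3\<close>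
  together with a lattice \<open>L\<close> of periods of \<open>u\<close>; functions on the torus are the \<open>L\<close>-periodic
  functions on \<open>real^2\<close>.\<close>

definition partial_deriv :: "2 \<Rightarrow> (real^2 \<Rightarrow> 'a::real_normed_vector) \<Rightarrow> real^2 \<Rightarrow> 'a" where
  "partial_deriv i f z = vector_derivative (\<lambda>h. f (z + h *\<^sub>R axis i 1)) (at 0)"

definition smooth :: "(real^2 \<Rightarrow> real) \<Rightarrow> bool" where
  "smooth f \<longleftrightarrow> (\<forall>is. foldr partial_deriv is f differentiable_on UNIV)"

definition periodic_wrt :: "(real^2) set \<Rightarrow> (real^2 \<Rightarrow> real) \<Rightarrow> bool" where
  "periodic_wrt L f \<longleftrightarrow> (\<forall>p\<in>L. \<forall>z. f (z + p) = f z)"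

text \<open>The inner product of \<open>complex^3\<close> as a real inner product space is the Euclidean one of
  \<open>\<real>\<^sup>6\<close>, so the metric induced from the sphere is the following.\<close>

definition induced_metric :: "(real^2 \<Rightarrow> complex^3) \<Rightarrow> real^2 \<Rightarrow> real^2^2" where
  "induced_metric u z = (\<chi> i j. partial_deriv i u z \<bullet> partial_deriv j u z)"

definition laplacian :: "(real^2 \<Rightarrow> complex^3) \<Rightarrow> (real^2 \<Rightarrow> real) \<Rightarrow> real^2 \<Rightarrow> real" where
  "laplacian u f z =
     - (1 / sqrt (det (induced_metric u z))) *
       (\<Sum>i\<in>UNIV. partial_deriv i
          (\<lambda>w. \<Sum>j\<in>UNIV. sqrt (det (induced_metric u w)) *
                 matrix_inv (induced_metric u w) $ i $ j * partial_deriv j f w) z)"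

definition eigenspace :: "(real^2 \<Rightarrow> complex^3) \<Rightarrow> (real^2) set \<Rightarrow> real \<Rightarrow> (real^2 \<Rightarrow> real) set" where
  "eigenspace u L \<mu> =
     {f. smooth f \<and> periodic_wrt L f \<and> (\<forall>z. laplacian u f z = \<mu> * f z)}"


section \<open>Counting eigenvalues\<close>

interpretation realfun: vector_space "\<lambda>(c::real) (f::'a \<Rightarrow> real) x. c * f x"
  by unfold_locales (auto simp: fun_eq_iff algebra_simps)

text \<open>The library dimension is \<open>0\<close> for spaces without a finite basis, hence the case split.\<close>

definition multiplicity_of :: "(real^2 \<Rightarrow> complex^3) \<Rightarrow> (real^2) set \<Rightarrow> real \<Rightarrow> enat" where
  "multiplicity_of u L \<mu> =
     (if \<exists>B. finite B \<and> eigenspace u L \<mu> \<subseteq> realfun.span B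
      then enat (realfun.dim (eigenspace u L \<mu>)) else \<infinity>)"

text \<open>The sum of the multiplicities of all \<open>\<mu> \<in> I\<close>, with value \<open>\<infinity>\<close> if it diverges; a number \<open>\<mu>\<close>
  which is not an eigenvalue has multiplicity \<open>0\<close>.\<close>

definition eigenvalue_count ::
    "(real^2 \<Rightarrow> complex^3) \<Rightarrow> (real^2) set \<Rightarrow> real set \<Rightarrow> ereal" where
  "eigenvalue_count u L I =
     ereal_of_enat (SUP F\<in>{F. finite F \<and> F \<subseteq> I}. \<Sum>\<mu>\<in>F. multiplicity_of u L \<mu>)"

definition spectral_N :: "(real^2 \<Rightarrow> complex^3) \<Rightarrow> (real^2) set \<Rightarrow> real \<Rightarrow> ereal" where
  "spectral_N u L l = eigenvalue_count u L {0..l * (l + 1)}"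

definition l_ind :: "(real^2 \<Rightarrow> complex^3) \<Rightarrow> (real^2) set \<Rightarrow> ereal" where
  "l_ind u L = eigenvalue_count u L {0<..<6}"


section \<open>Symmetries of the cone and the s-index\<close>

definition conj_transpose :: "complex^3^3 \<Rightarrow> complex^3^3" where
  "conj_transpose A = (\<chi> i j. cnj (A $ j $ i))"

definition SU3 :: "(complex^3^3) set" where
  "SU3 = {A. A ** conj_transpose A = mat 1 \<and> det A = 1}"

definition cone_symmetries :: "(real^2 \<Rightarrow> complex^3) \<Rightarrow> (complex^3^3) set" where
  "cone_symmetries u = {A \<in> SU3. (\<lambda>x. A *v x) ` (cone hull range u) = cone hull range u}"

text \<open>For a closed group \<open>G\<close> of matrices, the dimension of \<open>G\<close> as a Lie group is the real dimension
  of its Lie algebra, which consists of the initial velocities of the one-parameter subgroups of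
  \<open>G\<close>.\<close>

definition lie_algebra :: "(complex^3^3) set \<Rightarrow> (complex^3^3) set" where
  "lie_algebra G =
     {X. \<exists>\<gamma> :: real \<Rightarrow> complex^3^3. range \<gamma> \<subseteq> G \<and> (\<forall>s t. \<gamma> (s + t) = \<gamma> s ** \<gamma> t) \<and>
          (\<gamma> has_vector_derivative X) (at 0)}"

definition lie_dim :: "(complex^3^3) set \<Rightarrow> nat" where
  "lie_dim G = dim (lie_algebra G)"

text \<open>The constants are \<open>b\<^sup>0 = 1\<close> and \<open>dim SU(3) = 8\<close>.\<close>

definition s_ind :: "(real^2 \<Rightarrow> complex^3) \<Rightarrow> (real^2) set \<Rightarrow> ereal" where
  "s_ind u L = spectral_N u L 2 - 1 - 6 - (8 - ereal (real (lie_dim (cone_symmetries u))))"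


section \<open>The tori \<open>T\<^bsub>m,n\<^esub>\<close>\<close>

definition T_r :: "nat \<Rightarrow> nat \<Rightarrow> real" where
  "T_r m n = sqrt ((real n + 2 * real m) / real n)"

definition T_k :: "nat \<Rightarrow> nat \<Rightarrow> real" where
  "T_k m n = sqrt (((real n)\<^sup>2 - (real m)\<^sup>2) / (real n * (real n + 2 * real m)))"

definition T_c1 :: "nat \<Rightarrow> nat \<Rightarrow> real" where
  "T_c1 m n = sqrt ((real n + real m) / (2 * real n + real m))"

definition T_c2 :: "nat \<Rightarrow> nat \<Rightarrow> real" where
  "T_c2 m n = sqrt ((real n + real m) / (real n + 2 * real m))"

definition T_c3 :: "nat \<Rightarrow> nat \<Rightarrow> real" where
  "T_c3 m n = sqrt (real n / (2 * real n + real m))"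

definition T_map :: "nat \<Rightarrow> nat \<Rightarrow> real^2 \<Rightarrow> complex^3" where
  "T_map m n z =
     (let s = z $ 1; t = z $ 2; r = T_r m n; k = T_k m n; q = real m / real n in
      vector
        [complex_of_real (T_c1 m n) * cis s * complex_of_real (jacobi_cn (r * t) k),
         \<i> * complex_of_real (T_c2 m n) * cis (q * s) * complex_of_real (jacobi_sn (r * t) k),
         complex_of_real (T_c3 m n) * cis (- (1 + q) * s) * complex_of_real (jacobi_dn (r * t) k)])"

definition T_basis1 :: "nat \<Rightarrow> nat \<Rightarrow> real^2" where
  "T_basis1 m n = vector [2 * real n * pi, 0]"

definition T_basis2 :: "nat \<Rightarrow> nat \<Rightarrow> real^2" where
  "T_basis2 m n =
     (if even (m * n) then vector [0, 4 * ell_K (T_k m n) / T_r m n]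
      else vector [real n * pi, 2 * ell_K (T_k m n) / T_r m n])"

definition T_lattice :: "nat \<Rightarrow> nat \<Rightarrow> (real^2) set" where
  "T_lattice m n =
     {of_int a *\<^sub>R T_basis1 m n + of_int b *\<^sub>R T_basis2 m n | a b. True}"

definition N_T :: "nat \<Rightarrow> nat \<Rightarrow> real \<Rightarrow> ereal" where
  "N_T m n l = spectral_N (T_map m n) (T_lattice m n) l"

definition s_ind_T :: "nat \<Rightarrow> nat \<Rightarrow> ereal" where
  "s_ind_T m n = s_ind (T_map m n) (T_lattice m n)"

definition l_ind_T :: "nat \<Rightarrow> nat \<Rightarrow> ereal" where
  "l_ind_T m n = l_ind (T_map m n) (T_lattice m n)"

end

theory Submission
  imports Defs
begin

text \<open>The metric induced by \<open>u\<close> is \<open>\<rho>(t) (ds\<^sup>2 + dt\<^sup>2)\<close> with \<open>\<rho>(t) = 1 + q - (1 - q\<^sup>2) sn\<^sup>2(r t)\<close> and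
  \<open>q = m/n\<close>, so a function \<open>cos (p s) y(t)\<close> or \<open>sin (p s) y(t)\<close> with \<open>p = j/n\<close> is an eigenfunction for
  \<open>\<mu>\<close> iff \<open>y'' = (p\<^sup>2 - \<mu> \<rho>) y\<close>. For \<open>\<mu> = 2\<close> and \<open>\<mu> = 6\<close> this is Lame's equation, whose solutions
  \<open>dn, cn, sn\<close> and \<open>cn dn, sn dn, sn cn\<close> occur at explicit frequencies \<open>p\<^sub>0\<close>.

  Lower bounds: each of these solutions is the positive ground state of a Neumann or Dirichlet
  problem on a quarter period, and by shooting every smaller frequency \<open>p\<close> has a ground state with a
  smaller eigenvalue. Counting the integers \<open>j\<close> with \<open>j/n \<le> p\<^sub>0\<close> gives the bounds.

  Upper bound: sums of eigenfunctions with eigenvalues at most \<open>6\<close> are determined by the values of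
  their Fourier modes with \<open>2 |j| \<le> 7 n\<close> at eight (for odd \<open>m n\<close>: four) points per period, namely the
  multiples of the quarter period and the zeros of the even Lame function \<open>sn\<^sup>2 - c\<close> for \<open>\<mu> = 6\<close>,
  \<open>p = 0\<close>: between these points Picone's identity makes the energy positive.\<close>


section \<open>Jacobi elliptic functions\<close>

text \<open>No spectral theory of the torus enters: neither discreteness of the spectrum nor
  completeness of eigenfunctions. A lower bound only needs eigenfunctions that are jointly
  independent and have eigenvalues in the given interval. The eigenvalues found by shooting are not
  known and may coincide, so independence is drawn from the Fourier index in s and from the two
  parities in t, never from distinctness of eigenvalues. An upper bound only needs a bound for
  finite independent families, and it makes the multiplicities finite as a by-product. The price of
  the upper bound is crude counting: at most 7 n + 1 Fourier indices times 8 (or 4) points. This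
  fits because pi / sqrt 3 > 17/10, so that 56 n + 8 stays below 36 (pi / sqrt 3) n - 1 for n \<ge>
  2. The s-index needs one further fact: translations in s extend to a one-parameter group in SU(3)
  that preserves the cone, so dim G \<ge> 1 and at most 1 + 6 + 8 - 1 = 14 is subtracted from
  N(2).\<close>

lemma has_derivative_const_eq:
  fixes f g :: "real \<Rightarrow> real"
  assumes "\<And>x. (f has_real_derivative d x) (at x)" "\<And>x. (g has_real_derivative d x) (at x)"
    and "f a = g a"
  shows "f x = g x"
proof -
  have "\<forall>x. ((\<lambda>x. f x - g x) has_real_derivative 0) (at x)"
    using DERIV_diff[OF assms(1) assms(2)] by simp
  then have "f x - g x = f a - g a"
    by (rule DERIV_isconst_all)
  with assms(3) show ?thesis by simp
qed

lemma interval_integral_deriv: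
  fixes f :: "real \<Rightarrow> real"
  assumes "continuous_on UNIV f"
  shows "((\<lambda>u. LBINT y=ereal 0..ereal u. f y) has_real_derivative f x) (at x)"
proof -
  let ?a = "- (\<bar>x\<bar> + 1)" and ?b = "\<bar>x\<bar> + 1"
  have "((\<lambda>u. LBINT y=ereal 0..ereal u. f y) has_vector_derivative f x) (at x within {?a..?b})"
    by (intro interval_integral_FTC2 continuous_on_subset[OF assms]) auto
  moreover have "at x within {?a..?b} = at x"
    by (rule at_within_interior) auto
  ultimately show ?thesis
    unfolding has_real_derivative_iff_has_vector_derivative by simp
qed

locale modulus =
  fixes k :: real
  assumes k0: "0 < k" and k1: "k < 1"
begin

lemma k2_less: "k\<^sup>2 < 1"
  using k0 k1 by (simp add: power_less_one_iff abs_square_less_1)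

lemma sin_factor_pos: "0 < 1 - k\<^sup>2 * (sin x)\<^sup>2"
proof -
  have "k\<^sup>2 * (sin x)\<^sup>2 \<le> k\<^sup>2 * 1"
    by (intro mult_left_mono) (auto simp: abs_square_le_1)
  then show ?thesis using k2_less by simp
qed

lemma ell_F_deriv: "((\<lambda>\<phi>. ell_F \<phi> k) has_real_derivative 1 / sqrt (1 - k\<^sup>2 * (sin x)\<^sup>2)) (at x)"
  unfolding ell_F_def
proof (rule interval_integral_deriv)
  show "continuous_on UNIV (\<lambda>x. 1 / sqrt (1 - k\<^sup>2 * (sin x)\<^sup>2))"
    using sin_factor_pos by (intro continuous_intros) (smt (verit) real_sqrt_gt_zero)
qed

lemma ell_F_0 [simp]: "ell_F 0 k = 0"
  unfolding ell_F_def by simp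

lemma ell_F_pi_half: "ell_F (pi / 2) k = ell_K k"
  unfolding ell_F_def ell_K_def by simp

text \<open>The integrand is at least 1. This one inequality gives injectivity and surjectivity of
  \<open>ell_F\<close>, and makes its inverse \<open>am\<close> 1-Lipschitz, hence continuous, which
  the derivative rule for inverse functions requires.\<close>

lemma ell_F_expanding:
  assumes "a \<le> b" shows "b - a \<le> ell_F b k - ell_F a k"
proof -
  have "ell_F a k - a \<le> ell_F b k - b"
  proof (rule DERIV_nonneg_imp_nondecreasing[OF assms])
    fix x assume "a \<le> x" "x \<le> b"
    have "sqrt (1 - k\<^sup>2 * (sin x)\<^sup>2) \<le> 1" by simp
    then have "0 \<le> 1 / sqrt (1 - k\<^sup>2 * (sin x)\<^sup>2) - 1"
      using sin_factor_pos[of x] by (simp add: field_simps)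
    moreover have "((\<lambda>x. ell_F x k - x) has_real_derivative 1 / sqrt (1 - k\<^sup>2 * (sin x)\<^sup>2) - 1) (at x)"
      by (intro DERIV_diff ell_F_deriv DERIV_ident)
    ultimately show "\<exists>y. ((\<lambda>x. ell_F x k - x) has_real_derivative y) (at x) \<and> 0 \<le> y" by blast
  qed
  then show ?thesis by simp
qed

lemma ell_F_inj: "ell_F a k = ell_F b k \<Longrightarrow> a = b"
  using ell_F_expanding[of a b] ell_F_expanding[of b a] by linarith

lemma ell_F_surj: "\<exists>\<phi>. ell_F \<phi> k = x"
proof -
  have "continuous_on {-\<bar>x\<bar>..\<bar>x\<bar>} (\<lambda>\<phi>. ell_F \<phi> k)"
    using ell_F_deriv DERIV_isCont by (blast intro: continuous_at_imp_continuous_on)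
  moreover have "ell_F (-\<bar>x\<bar>) k \<le> x" "x \<le> ell_F \<bar>x\<bar> k"
    using ell_F_expanding[of "-\<bar>x\<bar>" 0] ell_F_expanding[of 0 "\<bar>x\<bar>"] by auto
  ultimately show ?thesis
    using IVT'[of "\<lambda>\<phi>. ell_F \<phi> k" "-\<bar>x\<bar>" x "\<bar>x\<bar>"] by auto
qed

abbreviation "am x \<equiv> jacobi_am x k"
abbreviation "sn x \<equiv> jacobi_sn x k"
abbreviation "cn x \<equiv> jacobi_cn x k"
abbreviation "dn x \<equiv> jacobi_dn x k"
abbreviation "K \<equiv> ell_K k"

lemma ell_F_am [simp]: "ell_F (am x) k = x"
  unfolding jacobi_am_def
  by (rule theI') (use ell_F_surj ell_F_inj in metis)

lemma am_ell_F [simp]: "am (ell_F x k) = x"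
  by (rule ell_F_inj) simp

lemma am_eqI: "ell_F \<phi> k = x \<Longrightarrow> am x = \<phi>"
  by auto

lemma am_contracting: "\<bar>am x - am y\<bar> \<le> \<bar>x - y\<bar>"
  using ell_F_expanding[of "am x" "am y"] ell_F_expanding[of "am y" "am x"]
  by (cases "am x \<le> am y") auto

lemma isCont_am: "isCont (\<lambda>x. am x) x"
  unfolding continuous_at_eps_delta dist_real_def
  using am_contracting by (metis abs_minus_commute order_le_less_trans)

lemma am_less_iff: "am x < am y \<longleftrightarrow> x < y"
proof
  show "x < y" if "am x < am y"
    using ell_F_expanding[of "am x" "am y"] that by simp
  show "am x < am y" if "x < y"
    using ell_F_expanding[of "am y" "am x"] that by (auto simp: not_less[symmetric])
qed

lemma sn_cn_sq: "(sn x)\<^sup>2 + (cn x)\<^sup>2 = 1"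
  by (simp add: jacobi_sn_def jacobi_cn_def)

lemma cn_sq: "(cn x)\<^sup>2 = 1 - (sn x)\<^sup>2"
  using sn_cn_sq[of x] by simp

lemma dn_sq: "(dn x)\<^sup>2 = 1 - k\<^sup>2 * (sn x)\<^sup>2"
  unfolding jacobi_dn_def using sin_factor_pos[of "am x"] by (simp add: jacobi_sn_def)

lemma dn_pos: "0 < dn x"
  unfolding jacobi_dn_def using sin_factor_pos[of "am x"] by (simp add: jacobi_sn_def)

lemma am_deriv: "((\<lambda>x. am x) has_real_derivative dn x) (at x)"
proof -
  have "((\<lambda>x. am x) has_real_derivative inverse (1 / dn x)) (at x)"
  proof (rule DERIV_inverse_function[where f = "\<lambda>\<phi>. ell_F \<phi> k" and a = "x - 1" and b = "x + 1"])
    show "((\<lambda>\<phi>. ell_F \<phi> k) has_real_derivative 1 / dn x) (at (am x))"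
      using ell_F_deriv[of "am x"] by (simp add: jacobi_dn_def jacobi_sn_def)
  qed (use dn_pos[of x] isCont_am in auto)
  then show ?thesis by simp
qed

lemma sn_deriv: "((\<lambda>x. sn x) has_real_derivative cn x * dn x) (at x)"
  unfolding jacobi_sn_def[abs_def] jacobi_cn_def
  by (auto intro!: derivative_eq_intros am_deriv)

lemma cn_deriv: "((\<lambda>x. cn x) has_real_derivative - (sn x * dn x)) (at x)"
  unfolding jacobi_cn_def[abs_def] jacobi_sn_def
  by (auto intro!: derivative_eq_intros am_deriv)

lemma dn_deriv: "((\<lambda>x. dn x) has_real_derivative - (k\<^sup>2 * sn x * cn x)) (at x)"
proof -
  have pos: "0 < 1 - k\<^sup>2 * (sn x)\<^sup>2" using sin_factor_pos[of "am x"] by (simp add: jacobi_sn_def)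
  have "((\<lambda>x. sqrt (1 - k\<^sup>2 * (sn x)\<^sup>2)) has_real_derivative
      (- (k\<^sup>2 * (2 * sn x * (cn x * dn x)))) * (inverse (dn x) / 2)) (at x)"
    using pos by (auto intro!: derivative_eq_intros sn_deriv simp: jacobi_dn_def)
  moreover have "(- (k\<^sup>2 * (2 * sn x * (cn x * dn x)))) * (inverse (dn x) / 2) = - (k\<^sup>2 * sn x * cn x)"
    using dn_pos[of x] by (simp add: field_simps)
  moreover have "(\<lambda>x. sqrt (1 - k\<^sup>2 * (sn x)\<^sup>2)) = (\<lambda>x. dn x)"
    by (simp add: jacobi_dn_def)
  ultimately show ?thesis by metis
qed

section \<open>Symmetries and special values of the Jacobi functions\<close>

lemma ell_F_minus: "ell_F (- \<phi>) k = - ell_F \<phi> k"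
proof (rule has_derivative_const_eq[where f = "\<lambda>\<phi>. ell_F (- \<phi>) k" and g = "\<lambda>\<phi>. - ell_F \<phi> k" and a = 0 and d = "\<lambda>x. - (1 / sqrt (1 - k\<^sup>2 * (sin x)\<^sup>2))"])
  fix x
  have "((\<lambda>\<phi>. ell_F (- \<phi>) k) has_real_derivative 1 / sqrt (1 - k\<^sup>2 * (sin (- x))\<^sup>2) * (-1)) (at x)"
    by (rule DERIV_chain'[OF _ ell_F_deriv]) (auto intro!: derivative_eq_intros)
  then show "((\<lambda>\<phi>. ell_F (- \<phi>) k) has_real_derivative - (1 / sqrt (1 - k\<^sup>2 * (sin x)\<^sup>2))) (at x)"
    by simp
  show "((\<lambda>\<phi>. - ell_F \<phi> k) has_real_derivative - (1 / sqrt (1 - k\<^sup>2 * (sin x)\<^sup>2))) (at x)"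
    by (intro DERIV_minus ell_F_deriv)
qed simp

text \<open>Since sin (pi - x) = sin x, both sides have the same derivative, and at pi/2 both equal
  \<open>K\<close>. All later symmetries about the quarter period come from here.\<close>

lemma ell_F_reflect: "ell_F (pi - \<phi>) k = 2 * K - ell_F \<phi> k"
proof (rule has_derivative_const_eq[where f = "\<lambda>\<phi>. ell_F (pi - \<phi>) k" and g = "\<lambda>\<phi>. 2 * K - ell_F \<phi> k" and a = "pi / 2" and d = "\<lambda>x. - (1 / sqrt (1 - k\<^sup>2 * (sin x)\<^sup>2))"])
  fix x
  have "((\<lambda>\<phi>. ell_F (pi - \<phi>) k) has_real_derivative 1 / sqrt (1 - k\<^sup>2 * (sin (pi - x))\<^sup>2) * (-1)) (at x)"
    by (rule DERIV_chain'[OF _ ell_F_deriv]) (auto intro!: derivative_eq_intros)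
  then show "((\<lambda>\<phi>. ell_F (pi - \<phi>) k) has_real_derivative - (1 / sqrt (1 - k\<^sup>2 * (sin x)\<^sup>2))) (at x)"
    by simp
  have "((\<lambda>\<phi>. 2 * K - ell_F \<phi> k) has_real_derivative 0 - 1 / sqrt (1 - k\<^sup>2 * (sin x)\<^sup>2)) (at x)"
    by (intro DERIV_diff DERIV_const ell_F_deriv)
  then show "((\<lambda>\<phi>. 2 * K - ell_F \<phi> k) has_real_derivative - (1 / sqrt (1 - k\<^sup>2 * (sin x)\<^sup>2))) (at x)"
    by simp
qed (simp add: ell_F_pi_half)

lemma K_pos: "0 < K"
  using ell_F_expanding[of 0 "pi / 2"] ell_F_pi_half by (simp add: pi_gt_zero less_le_trans[OF pi_half_gt_zero])

lemma am_0 [simp]: "am 0 = 0"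
  using am_ell_F[of 0] by simp

lemma am_K [simp]: "am K = pi / 2"
  by (rule am_eqI) (rule ell_F_pi_half)

lemma am_minus: "am (- x) = - am x"
  by (rule am_eqI) (simp add: ell_F_minus)

lemma am_reflect: "am (2 * K - x) = pi - am x"
  by (rule am_eqI) (simp add: ell_F_reflect)

lemma jacobi_minus [simp]: "sn (- x) = - sn x" "cn (- x) = cn x" "dn (- x) = dn x"
  by (simp_all add: jacobi_sn_def jacobi_cn_def jacobi_dn_def am_minus)

lemma jacobi_reflect: "sn (2 * K - x) = sn x" "cn (2 * K - x) = - cn x" "dn (2 * K - x) = dn x"
  by (simp_all add: jacobi_sn_def jacobi_cn_def jacobi_dn_def am_reflect)

lemma jacobi_0 [simp]: "sn 0 = 0" "cn 0 = 1" "dn 0 = 1"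
  by (simp_all add: jacobi_sn_def jacobi_cn_def jacobi_dn_def)

lemma jacobi_K [simp]: "sn K = 1" "cn K = 0"
  by (simp_all add: jacobi_sn_def jacobi_cn_def)

lemma sn_cn_pos:
  assumes "0 < x" "x < K" shows "0 < sn x" "0 < cn x" "sn x < 1"
proof -
  have "0 < am x" "am x < pi / 2"
    using am_less_iff[of 0 x] am_less_iff[of x K] assms by auto
  then show "0 < sn x" "0 < cn x"
    by (auto simp: jacobi_sn_def jacobi_cn_def intro!: sin_gt_zero cos_gt_zero)
  then show "sn x < 1" using sn_cn_sq[of x]
    by (smt (verit) power_one power_mono zero_less_power)
qed

end

section \<open>Linear second order equations depending on a parameter\<close>

text \<open>The primitive in the first variable that vanishes at 0. Rescaling to [0, 1] makes it a
  parameter integral over a fixed interval, so that it is jointly continuous in both variables and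
  negative arguments need no separate treatment.\<close>

definition prim :: "(real \<times> real \<Rightarrow> real) \<Rightarrow> real \<times> real \<Rightarrow> real" where
  "prim f x = fst x * integral {0..1} (\<lambda>\<sigma>. f (\<sigma> * fst x, snd x))"

lemma continuous_antiderivative:
  fixes f :: "real \<Rightarrow> real"
  assumes "continuous_on UNIV f"
  obtains G where "\<And>x. (G has_real_derivative f x) (at x)"
  using interval_integral_deriv[OF assms] by blast

lemma continuous_on_slice:
  assumes "continuous_on (UNIV \<times> U) f" "m \<in> U" "continuous_on A g"
  shows "continuous_on A (\<lambda>t::real. f (g t, m))"
  by (rule continuous_on_compose2[OF assms(1)]) (use assms in \<open>auto intro!: continuous_intros\<close>)

lemma prim_deriv:
  assumes "continuous_on (UNIV \<times> U) f" "m \<in> U"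
  shows "((\<lambda>t. prim f (t, m)) has_real_derivative f (t, m)) (at t)"
proof -
  have "continuous_on UNIV (\<lambda>t. f (t, m))"
    by (rule continuous_on_slice[OF assms]) auto
  then obtain G where G: "\<And>x. (G has_real_derivative f (x, m)) (at x)"
    using continuous_antiderivative by blast
  have "prim f (t, m) = G t - G 0" for t
  proof -
    have "((\<lambda>\<sigma>. f (\<sigma> * t, m) * t) has_integral (G (1 * t) - G (0 * t))) {0..1}"
    proof (rule fundamental_theorem_of_calculus)
      fix \<sigma> :: real
      have "((\<lambda>\<sigma>. \<sigma> * t) has_real_derivative t) (at \<sigma> within {0..1})"
        by (auto intro!: derivative_eq_intros)
      from DERIV_chain2[OF G this]
      show "((\<lambda>\<sigma>. G (\<sigma> * t)) has_vector_derivative f (\<sigma> * t, m) * t) (at \<sigma> within {0..1})"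
        by (simp add: has_real_derivative_iff_has_vector_derivative)
    qed simp
    from integral_unique[OF this] show ?thesis
      by (simp add: prim_def mult.commute)
  qed
  then have "(\<lambda>t. prim f (t, m)) = (\<lambda>t. G t - G 0)" by auto
  then show ?thesis
    using DERIV_diff[OF G[of t] DERIV_const[of "G 0"]] by simp
qed

lemma prim_continuous:
  assumes "continuous_on (UNIV \<times> U) f"
  shows "continuous_on (UNIV \<times> U) (prim f)"
proof -
  have "continuous_on ((UNIV \<times> U) \<times> cbox 0 1) (\<lambda>(x, \<sigma>). f (\<sigma> * fst x, snd x))"
    unfolding split_beta
    by (rule continuous_on_compose2[OF assms]) (auto intro!: continuous_intros)
  from integral_continuous_on_param[OF this]
  have "continuous_on (UNIV \<times> U) (\<lambda>x. integral {0..1} (\<lambda>\<sigma>. f (\<sigma> * fst x, snd x)))"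
    by (simp add: cbox_interval)
  then show ?thesis
    unfolding prim_def[abs_def] by (intro continuous_intros)
qed

text \<open>Integrating a power raises the exponent and divides by it; iteration produces the
  factorials in the bounds for the Volterra terms.\<close>

lemma prim_bound:
  assumes f: "continuous_on (UNIV \<times> U) f" and m: "m \<in> U"
    and le: "\<And>t. \<bar>f (t, m)\<bar> \<le> C * \<bar>t\<bar> ^ k"
  shows "\<bar>prim f (t, m)\<bar> \<le> C * \<bar>t\<bar> ^ Suc k / real (Suc k)"
proof -
  have h: "((\<lambda>\<sigma>::real. C * \<bar>t\<bar> ^ k * \<sigma> ^ k) has_integral C * \<bar>t\<bar> ^ k * (1 / real (Suc k))) {0..1}"
  proof -
    have "((\<lambda>\<sigma>::real. \<sigma> ^ k) has_integral (1 ^ Suc k / real (Suc k) - 0 ^ Suc k / real (Suc k))) {0..1}"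
    proof (rule fundamental_theorem_of_calculus)
      fix \<sigma> :: real
      show "((\<lambda>\<sigma>. \<sigma> ^ Suc k / real (Suc k)) has_vector_derivative \<sigma> ^ k) (at \<sigma> within {0..1})"
        unfolding has_real_derivative_iff_has_vector_derivative[symmetric]
        using DERIV_cdivide[OF DERIV_pow[of "Suc k" \<sigma>], of "real (Suc k)"] by simp
    qed simp
    from has_integral_mult_right[OF this, of "C * \<bar>t\<bar> ^ k"] show ?thesis by simp
  qed
  have "norm (integral {0..1} (\<lambda>\<sigma>. f (\<sigma> * t, m))) \<le> integral {0..1} (\<lambda>\<sigma>. C * \<bar>t\<bar> ^ k * \<sigma> ^ k)"
  proof (rule integral_norm_bound_integral)
    show "(\<lambda>\<sigma>. f (\<sigma> * t, m)) integrable_on {0..1}"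
      by (intro integrable_continuous_real continuous_on_slice[OF f m] continuous_intros)
    show "(\<lambda>\<sigma>. C * \<bar>t\<bar> ^ k * \<sigma> ^ k) integrable_on {0..1}"
      using h by blast
    show "norm (f (\<sigma> * t, m)) \<le> C * \<bar>t\<bar> ^ k * \<sigma> ^ k" if "\<sigma> \<in> {0..1}" for \<sigma>
      using le[of "\<sigma> * t"] that by (simp add: abs_mult power_mult_distrib mult_ac)
  qed
  then have "\<bar>integral {0..1} (\<lambda>\<sigma>. f (\<sigma> * t, m))\<bar> \<le> C * \<bar>t\<bar> ^ k * (1 / real (Suc k))"
    unfolding integral_unique[OF h] by simp
  then have "\<bar>t\<bar> * \<bar>integral {0..1} (\<lambda>\<sigma>. f (\<sigma> * t, m))\<bar> \<le> \<bar>t\<bar> * (C * \<bar>t\<bar> ^ k * (1 / real (Suc k)))"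
    by (rule mult_left_mono) simp
  then show ?thesis
    by (simp add: prim_def abs_mult mult_ac)
qed

text \<open>The terms of the Volterra series for \<open>y' = v\<close>, \<open>v' = a y\<close>, \<open>y(0) = c\<close>, \<open>v(0) = d\<close>.\<close>

fun volterra :: "(real \<times> real \<Rightarrow> real) \<Rightarrow> real \<Rightarrow> real \<Rightarrow> nat \<Rightarrow> (real \<times> real \<Rightarrow> real) \<times> (real \<times> real \<Rightarrow> real)"
  where
    "volterra a c d 0 = (\<lambda>_. c, \<lambda>_. d)"
  | "volterra a c d (Suc i) = (prim (snd (volterra a c d i)), prim (\<lambda>x. a x * fst (volterra a c d i) x))"

text \<open>The series below converge uniformly only for bounded t; continuity is local, so this is
  enough.\<close>

lemma continuous_on_strips:
  fixes f :: "real \<times> real \<Rightarrow> real"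
  assumes "\<And>T. continuous_on ({-T..T} \<times> U) f"
  shows "continuous_on (UNIV \<times> U) f"
  unfolding continuous_on_eq_continuous_within
proof
  fix x :: "real \<times> real" assume x: "x \<in> UNIV \<times> U"
  define T where "T = \<bar>fst x\<bar> + 1"
  have "at x within (UNIV \<times> U) = at x within ({-T..T} \<times> U)"
  proof (rule at_within_nhd)
    show "x \<in> {-T<..<T} \<times> UNIV" using T_def by (cases x) auto
    show "open ({-T<..<T} \<times> (UNIV::real set))" by (intro open_Times) auto
  qed auto
  moreover have "x \<in> {-T..T} \<times> U"
    using x T_def by (cases x) auto
  then have "continuous (at x within ({-T..T} \<times> U)) f"
    using assms[of T] unfolding continuous_on_eq_continuous_within by blast
  ultimately show "continuous (at x within UNIV \<times> U) f" by simp
qed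

text \<open>The Volterra series is majorised by C (B T)^i / i! for |t| \<le> T, uniformly in the
  parameter. The gain is continuity in time and parameter jointly: the shooting argument lets both
  vary.\<close>

lemma linear_ode_exists:
  fixes a :: "real \<times> real \<Rightarrow> real"
  assumes cont: "continuous_on (UNIV \<times> U) a"
    and bound: "\<And>t m. m \<in> U \<Longrightarrow> \<bar>a (t, m)\<bar> \<le> A"
  obtains y v where "continuous_on (UNIV \<times> U) y" "continuous_on (UNIV \<times> U) v"
    "\<And>m. y (0, m) = c" "\<And>m. v (0, m) = d"
    "\<And>m t. m \<in> U \<Longrightarrow> ((\<lambda>t. y (t, m)) has_real_derivative v (t, m)) (at t)"
    "\<And>m t. m \<in> U \<Longrightarrow> ((\<lambda>t. v (t, m)) has_real_derivative a (t, m) * y (t, m)) (at t)"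
proof -
  define Y where "Y i = fst (volterra a c d i)" for i
  define V where "V i = snd (volterra a c d i)" for i
  have Y_simps: "Y 0 = (\<lambda>_. c)" "\<And>i. Y (Suc i) = prim (V i)"
    and V_simps: "V 0 = (\<lambda>_. d)" "\<And>i. V (Suc i) = prim (\<lambda>x. a x * Y i x)"
    by (auto simp: Y_def V_def)
  have contYV: "continuous_on (UNIV \<times> U) (Y i) \<and> continuous_on (UNIV \<times> U) (V i)" for i
    by (induction i) (auto simp: Y_simps V_simps intro!: prim_continuous continuous_intros cont)
  \<comment> \<open>One of the two recursions multiplies by 1 and the other by \<open>a\<close>; the
    maximum serves both.\<close>
  define B where "B = max 1 A"
  define C where "C = max \<bar>c\<bar> \<bar>d\<bar>"
  have BC: "B \<ge> 1" "A \<le> B" "C \<ge> 0" "\<bar>c\<bar> \<le> C" "\<bar>d\<bar> \<le> C" by (auto simp: B_def C_def)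
  have bnd: "(\<forall>t. \<bar>Y i (t, m)\<bar> \<le> C * B ^ i / fact i * \<bar>t\<bar> ^ i) \<and>
      (\<forall>t. \<bar>V i (t, m)\<bar> \<le> C * B ^ i / fact i * \<bar>t\<bar> ^ i)" if m: "m \<in> U" for i m
  proof (induction i)
    case 0
    then show ?case using BC by (simp add: Y_simps V_simps)
  next
    case (Suc i)
    let ?D = "C * B ^ Suc i / fact i"
    have D: "0 \<le> C * B ^ i / fact i" using BC by simp
    have "C * B ^ i / fact i * 1 \<le> C * B ^ i / fact i * B"
      using BC D by (intro mult_left_mono) auto
    then have D1: "C * B ^ i / fact i \<le> ?D" by (simp add: mult_ac)
    have "\<bar>V i (t, m)\<bar> \<le> ?D * \<bar>t\<bar> ^ i" for t
      by (rule order_trans[OF _ mult_right_mono[OF D1]]) (use Suc in auto)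
    from prim_bound[OF _ m this] contYV
    have 1: "\<bar>Y (Suc i) (t, m)\<bar> \<le> ?D * \<bar>t\<bar> ^ Suc i / real (Suc i)" for t
      by (auto simp: Y_simps)
    have "\<bar>a (t, m) * Y i (t, m)\<bar> \<le> ?D * \<bar>t\<bar> ^ i" for t
    proof -
      have "\<bar>a (t, m)\<bar> * \<bar>Y i (t, m)\<bar> \<le> B * (C * B ^ i / fact i * \<bar>t\<bar> ^ i)"
        using bound[OF m, of t] BC Suc by (intro mult_mono) auto
      then show ?thesis by (simp add: abs_mult mult_ac)
    qed
    from prim_bound[OF _ m this] contYV
    have 2: "\<bar>V (Suc i) (t, m)\<bar> \<le> ?D * \<bar>t\<bar> ^ Suc i / real (Suc i)" for t
      by (auto simp: V_simps intro!: continuous_intros cont)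
    have "?D * x / real (Suc i) = C * B ^ Suc i / fact (Suc i) * x" for x
      by (simp add: field_simps)
    then show ?case using 1 2 by metis
  qed
  define M where "M T i = C * ((B * T) ^ i /\<^sub>R fact i)" for T i
  have sumM: "summable (M T)" for T
    unfolding M_def using summable_mult[OF summable_exp_generic[of "B * T"], of C] by simp
  have bndM: "norm (Y i x) \<le> M T i" "norm (V i x) \<le> M T i" if "x \<in> {-T..T} \<times> U" for i x T
  proof -
    obtain t m where x: "x = (t, m)" "m \<in> U" "\<bar>t\<bar> \<le> T" using \<open>x \<in> _\<close> by auto
    have "C * B ^ i / fact i * \<bar>t\<bar> ^ i \<le> C * B ^ i / fact i * T ^ i"
      using BC x by (intro mult_left_mono power_mono) auto
    also have "\<dots> = M T i" by (simp add: M_def field_simps power_mult_distrib)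
    finally show "norm (Y i x) \<le> M T i" "norm (V i x) \<le> M T i"
      using bnd[OF x(2), of i] x(1) by (auto intro: order_trans)
  qed
  define y where "y x = (\<Sum>i. Y i x)" for x
  define v where "v x = (\<Sum>i. V i x)" for x
  have ulim: "uniform_limit ({-T..T} \<times> U) (\<lambda>n x. \<Sum>i<n. Y i x) y sequentially"
    "uniform_limit ({-T..T} \<times> U) (\<lambda>n x. \<Sum>i<n. V i x) v sequentially" for T
    unfolding y_def v_def by (intro Weierstrass_m_test[OF _ sumM[of T]] bndM; assumption)+
  have cy: "continuous_on (UNIV \<times> U) y" and cv: "continuous_on (UNIV \<times> U) v"
    using contYV
    by (auto intro!: continuous_on_strips uniform_limit_theorem[OF _ ulim(1)]
        uniform_limit_theorem[OF _ ulim(2)] always_eventually continuous_on_sum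
        intro: continuous_on_subset)
  have init: "y (0, m) = c" "v (0, m) = d" for m
  proof -
    have "Y i (0, m) = (if i = 0 then c else 0)" "V i (0, m) = (if i = 0 then d else 0)" for i
      by (cases i; simp add: Y_simps V_simps prim_def)+
    then show "y (0, m) = c" "v (0, m) = d"
      unfolding y_def v_def using sums_single[of 0 "\<lambda>_. c"] sums_single[of 0 "\<lambda>_. d"]
      by (simp_all add: sums_iff)
  qed
  have der: "((\<lambda>t. \<Sum>i. F i (t, m)) has_real_derivative (\<Sum>i. G i (t, m))) (at t)"
    if m: "m \<in> U" and F: "F 0 = (\<lambda>_. e)" "\<And>i. F (Suc i) = prim (G i)"
      and cG: "\<And>i. continuous_on (UNIV \<times> U) (G i)"
      and bF: "\<And>T i x. x \<in> {-T..T} \<times> U \<Longrightarrow> norm (F i x) \<le> M T i"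
      and bG: "\<And>T i x. x \<in> {-T..T} \<times> U \<Longrightarrow> norm (G i x) \<le> D * M T i"
    for m t e F G D
  proof -
    define T where "T = \<bar>t\<bar> + 1"
    have tT: "(t, m) \<in> {-T..T} \<times> U" using m by (auto simp: T_def)
    \<comment> \<open>\<open>F 0\<close> is constant and \<open>F (Suc i)\<close> has derivative
      \<open>G i\<close>, so the differentiated series is that of \<open>G\<close> moved by one
      place, with 0 in front.\<close>
    let ?G = "\<lambda>i t. case i of 0 \<Rightarrow> 0 | Suc j \<Rightarrow> G j (t, m)"
    have "summable (\<lambda>i. D * M T i)" by (intro summable_mult sumM)
    then have sN: "summable (\<lambda>i. case i of 0 \<Rightarrow> 0 | Suc j \<Rightarrow> D * M T j)"
      by (subst summable_Suc_iff[symmetric]) simp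
    have uc: "uniformly_convergent_on {-T..T} (\<lambda>n x. \<Sum>i<n. ?G i x)"
      by (rule Weierstrass_m_test'[OF _ sN]) (use bG m in \<open>auto split: nat.splits\<close>)
    have "((\<lambda>t. \<Sum>i. F i (t, m)) has_real_derivative (\<Sum>i. ?G i t)) (at t)"
    proof (rule has_field_derivative_series'(2)[where f = "\<lambda>i t. F i (t, m)" and f' = ?G and S = "{-T..T}" and ?x0.0 = 0 and x = t])
      show "uniformly_convergent_on {-T..T} (\<lambda>n x. \<Sum>i<n. ?G i x)" by (rule uc)
      show "((\<lambda>t. F i (t, m)) has_real_derivative ?G i x) (at x within {-T..T})" for i x
        by (cases i) (auto simp: F intro!: has_field_derivative_at_within prim_deriv[OF cG m])
      show "0 \<in> {-T..T}" "t \<in> interior {-T..T}" by (auto simp: T_def)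
      show "summable (\<lambda>n. F n (0, m))"
        by (rule summable_comparison_test'[OF sumM[of T], of 0]) (use bF[of "(0, m)" T] m T_def in auto)
    qed auto
    moreover have "(\<Sum>i. ?G i t) = (\<Sum>i. G i (t, m))"
    proof -
      have "summable (\<lambda>i. G i (t, m))"
        by (rule summable_comparison_test'[OF \<open>summable (\<lambda>i. D * M T i)\<close>, of 0])
          (use bG[OF tT] in auto)
      then have "summable (\<lambda>i. ?G i t)"
        by (subst summable_Suc_iff[symmetric]) simp
      then show ?thesis
        using suminf_split_head[of "\<lambda>i. ?G i t"] by simp
    qed
    ultimately show ?thesis by simp
  qed
  have dery: "((\<lambda>t. y (t, m)) has_real_derivative v (t, m)) (at t)" if "m \<in> U" for m t
    unfolding y_def v_def
    by (rule der[where e = c and D = 1]) (use that contYV bndM Y_simps in auto)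
  have derv: "((\<lambda>t. v (t, m)) has_real_derivative a (t, m) * y (t, m)) (at t)" if "m \<in> U" for m t
  proof -
    have "((\<lambda>t. v (t, m)) has_real_derivative (\<Sum>i. a (t, m) * Y i (t, m))) (at t)"
      unfolding v_def
    proof (rule der[where e = d and D = B and G = "\<lambda>i x. a x * Y i x"])
      show "norm (a x * Y i x) \<le> B * M T i" if "x \<in> {-T..T} \<times> U" for i x T
        unfolding norm_mult using bound BC bndM[OF that] that
        by (intro mult_mono) (auto intro: order_trans)
    qed (use that contYV bndM V_simps in \<open>auto intro!: continuous_intros cont\<close>)
    moreover have tT: "(t, m) \<in> {-\<bar>t\<bar>..\<bar>t\<bar>} \<times> U" using that by auto
    have "summable (\<lambda>i. Y i (t, m))"
      by (rule summable_comparison_test'[OF sumM[of "\<bar>t\<bar>"], of 0]) (use bndM(1)[OF tT] in auto)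
    ultimately show ?thesis by (simp add: y_def suminf_mult)
  qed
  show thesis
    by (rule that[OF cy cv init dery derv])
qed

text \<open>Gronwall for E = y^2 + v^2: since 2 |y v| \<le> E, its derivative is bounded by (1 + A)
  E in absolute value, so E = 0 spreads from \<open>c\<close> both forwards and backwards.\<close>

lemma linear_ode_unique:
  fixes y v a :: "real \<Rightarrow> real"
  assumes y: "\<And>t. (y has_real_derivative v t) (at t)"
    and v: "\<And>t. (v has_real_derivative a t * y t) (at t)"
    and a: "\<And>t. \<bar>a t\<bar> \<le> A" and z: "y c = 0" "v c = 0"
  shows "y t = 0" "v t = 0"
proof -
  define E where "E t = (y t)\<^sup>2 + (v t)\<^sup>2" for t
  define E' where "E' t = 2 * (1 + a t) * (y t * v t)" for t
  have dE: "(E has_real_derivative E' t) (at t)" for t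
    unfolding E_def E'_def by (auto intro!: derivative_eq_intros y v simp: algebra_simps)
  have E': "\<bar>E' t\<bar> \<le> (1 + A) * E t" for t
  proof -
    have 1: "2 * \<bar>y t * v t\<bar> \<le> E t"
      unfolding E_def abs_mult using sum_squares_bound[of "\<bar>y t\<bar>" "\<bar>v t\<bar>"] by (simp add: mult_ac)
    have "E' t = (1 + a t) * (2 * (y t * v t))" by (simp add: E'_def)
    then have "\<bar>E' t\<bar> = \<bar>1 + a t\<bar> * (2 * \<bar>y t * v t\<bar>)"
      by (metis abs_mult abs_numeral)
    also have "\<dots> \<le> (1 + A) * E t"
      using a[of t] 1 by (intro mult_mono) auto
    finally show ?thesis .
  qed
  have Ec: "E c = 0" by (simp add: E_def z)
  have "E t \<le> 0"
  proof (cases "c \<le> t")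
    case True
    have "E t * exp (- (1 + A) * t) \<le> E c * exp (- (1 + A) * c)"
    proof (rule DERIV_nonpos_imp_nonincreasing[OF True])
      fix x
      have "((\<lambda>t. E t * exp (- (1 + A) * t)) has_real_derivative
          (E' x - (1 + A) * E x) * exp (- (1 + A) * x)) (at x)"
        by (auto intro!: derivative_eq_intros dE simp: algebra_simps)
      moreover have "(E' x - (1 + A) * E x) * exp (- (1 + A) * x) \<le> 0"
        using E'[of x] by (intro mult_nonpos_nonneg) auto
      ultimately show "\<exists>z. ((\<lambda>t. E t * exp (- (1 + A) * t)) has_real_derivative z) (at x) \<and> z \<le> 0"
        by blast
    qed
    then show ?thesis unfolding Ec by (simp add: mult_le_0_iff not_le)
  next
    case False
    then have "t \<le> c" by simp
    have "E t * exp ((1 + A) * t) \<le> E c * exp ((1 + A) * c)"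
    proof (rule DERIV_nonneg_imp_nondecreasing[OF \<open>t \<le> c\<close>])
      fix x
      have "((\<lambda>t. E t * exp ((1 + A) * t)) has_real_derivative
          (E' x + (1 + A) * E x) * exp ((1 + A) * x)) (at x)"
        by (auto intro!: derivative_eq_intros dE simp: algebra_simps)
      moreover have "(E' x + (1 + A) * E x) * exp ((1 + A) * x) \<ge> 0"
        using E'[of x] by (intro mult_nonneg_nonneg) auto
      ultimately show "\<exists>z. ((\<lambda>t. E t * exp ((1 + A) * t)) has_real_derivative z) (at x) \<and> 0 \<le> z"
        by blast
    qed
    then show ?thesis unfolding Ec by (simp add: mult_le_0_iff not_le)
  qed
  then show "y t = 0" "v t = 0"
    unfolding E_def sum_power2_le_zero_iff by auto
qed

lemma linear_ode_eq:
  fixes y v a :: "real \<Rightarrow> real"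
  assumes "\<And>t. (y has_real_derivative v t) (at t)" "\<And>t. (v has_real_derivative a t * y t) (at t)"
    and "\<And>t. (z has_real_derivative w t) (at t)" "\<And>t. (w has_real_derivative a t * z t) (at t)"
    and "\<And>t. \<bar>a t\<bar> \<le> A" "y c = z c" "v c = w c"
  shows "y t = z t" "v t = w t"
proof -
  have "((\<lambda>t. y t - z t) has_real_derivative v t - w t) (at t)"
    "((\<lambda>t. v t - w t) has_real_derivative a t * (y t - z t)) (at t)" for t
    using DERIV_diff[OF assms(2) assms(4)] DERIV_diff[OF assms(1) assms(3)]
    by (auto simp: right_diff_distrib)
  from linear_ode_unique[OF this assms(5), of c] assms(6,7)
  show "y t = z t" "v t = w t" by auto
qed

text \<open>The equation is invariant under reflection in \<open>c\<close>, so y(2 c - t) and s y(t)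
  both solve it, and the last hypotheses say that their data at \<open>c\<close> agree. For s = 1
  they mean v c = 0, for s = -1 they mean y c = 0.\<close>

lemma linear_ode_reflect:
  fixes y v a :: "real \<Rightarrow> real"
  assumes y: "\<And>t. (y has_real_derivative v t) (at t)"
    and v: "\<And>t. (v has_real_derivative a t * y t) (at t)"
    and a: "\<And>t. \<bar>a t\<bar> \<le> A" and sym: "\<And>t. a (2 * c - t) = a t"
    and z: "y c = s * y c" "- v c = s * v c"
  shows "y (2 * c - t) = s * y t"
proof (rule linear_ode_eq(1)[where y = "\<lambda>t. y (2 * c - t)" and v = "\<lambda>t. - v (2 * c - t)" and a = a
      and z = "\<lambda>t. s * y t" and w = "\<lambda>t. s * v t" and A = A and c = c])
  have d: "((\<lambda>t. 2 * c - t) has_real_derivative -1) (at t)" for t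
    by (auto intro!: derivative_eq_intros)
  show "((\<lambda>t. y (2 * c - t)) has_real_derivative - v (2 * c - t)) (at t)" for t
    using DERIV_chain2[OF y d] by simp
  show "((\<lambda>t. - v (2 * c - t)) has_real_derivative a t * y (2 * c - t)) (at t)" for t
    using DERIV_minus[OF DERIV_chain2[OF v d, of t]] by (simp add: sym)
  show "((\<lambda>t. s * y t) has_real_derivative s * v t) (at t)" for t
    by (rule DERIV_cmult[OF y])
  show "((\<lambda>t. s * v t) has_real_derivative a t * (s * y t)) (at t)" for t
    using DERIV_cmult[OF v, of s t] by (simp add: mult_ac)
qed (use a z in auto)

section \<open>Ground states by shooting\<close>

text \<open>A flag selects the boundary condition at an end point: \<open>True\<close> is Neumann, \<open>False\<close> is
  Dirichlet. Reflection in that end point then multiplies the solution by \<open>parity\<close>.\<close>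

definition parity :: "bool \<Rightarrow> real" where
  "parity b = (if b then 1 else -1)"

text \<open>Let y(t, m) be the solution for the parameter m that satisfies the boundary condition at
  0. The boundary quantity \<open>B\<close> at \<open>L\<close> is positive for m = 0; if it had no
  root, it would stay positive for all m below \<mu>0. Then y(., m) could never lose its positivity
  on (0, L), because a zero would have to appear as a double zero or enter through an end point.
  Comparison with \<phi> shows, however, that positivity is lost at \<mu>0. The hypothesis
  \<open>nt\<close> excludes the Neumann problem with p = 0, where already \<open>B 0 = 0\<close>
  and the constant function has eigenvalue 0.\<close>

lemma shooting:
  fixes \<rho> \<phi> \<psi> :: "real \<Rightarrow> real"
  assumes cont: "continuous_on UNIV \<rho>" and bound: "\<And>t. \<bar>\<rho> t\<bar> \<le> M"
    and L: "0 < L" and sym0: "\<And>t. \<rho> (- t) = \<rho> t" and symL: "\<And>t. \<rho> (2 * L - t) = \<rho> t"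
    and \<phi>: "\<And>t. (\<phi> has_real_derivative \<psi> t) (at t)"
    and \<psi>: "\<And>t. (\<psi> has_real_derivative (p0\<^sup>2 - \<mu>0 * \<rho> t) * \<phi> t) (at t)"
    and pos: "\<And>t. 0 < t \<Longrightarrow> t < L \<Longrightarrow> 0 < \<phi> t"
    and bc0: "if a then \<psi> 0 = 0 else \<phi> 0 = 0" and bcL: "if b then \<psi> L = 0 else \<phi> L = 0"
    and p: "0 \<le> p" "p < p0" and \<mu>0: "0 < \<mu>0" and nt: "\<not> (a \<and> b \<and> p = 0)"
  obtains \<mu> y v where "0 < \<mu>" "\<mu> < \<mu>0"
    "\<And>t. (y has_real_derivative v t) (at t)"
    "\<And>t. (v has_real_derivative (p\<^sup>2 - \<mu> * \<rho> t) * y t) (at t)"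
    "\<And>t. y (- t) = parity a * y t" "\<And>t. y (2 * L - t) = parity b * y t" "\<exists>t. y t \<noteq> 0"
proof -
  define U where "U = {0..\<mu>0}"
  define A where "A = p\<^sup>2 + \<mu>0 * M"
  let ?q = "\<lambda>x. p\<^sup>2 - snd x * \<rho> (fst x)"
  have M: "0 \<le> M" using bound[of 0] by simp
  have cq: "continuous_on (UNIV \<times> U) ?q"
    by (intro continuous_intros continuous_on_compose2[OF cont]) auto
  have qb: "\<bar>p\<^sup>2 - \<mu> * \<rho> t\<bar> \<le> A" if "\<mu> \<in> U" for t \<mu>
  proof -
    have "\<bar>\<mu> * \<rho> t\<bar> \<le> \<mu>0 * M"
      unfolding abs_mult using that bound[of t] M by (intro mult_mono) (auto simp: U_def)
    then show ?thesis unfolding A_def using zero_le_power2[of p] by linarith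
  qed
  have qb': "\<bar>?q (t, m)\<bar> \<le> A" if "m \<in> U" for t m
    using qb[OF that] by simp
  define c where "c = (if a then 1 else 0::real)"
  define d where "d = (if a then 0 else 1::real)"
  obtain y v where cy: "continuous_on (UNIV \<times> U) y" and cv: "continuous_on (UNIV \<times> U) v"
    and y0: "\<And>m. y (0, m) = c" and v0: "\<And>m. v (0, m) = d"
    and dy: "\<And>m t. m \<in> U \<Longrightarrow> ((\<lambda>t. y (t, m)) has_real_derivative v (t, m)) (at t)"
    and dv: "\<And>m t. m \<in> U \<Longrightarrow> ((\<lambda>t. v (t, m)) has_real_derivative ?q (t, m) * y (t, m)) (at t)"
    by (rule linear_ode_exists[OF cq qb', of c d], assumption) (rule that, assumption+)
  have dv: "((\<lambda>t. v (t, m)) has_real_derivative (p\<^sup>2 - m * \<rho> t) * y (t, m)) (at t)"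
    if "m \<in> U" for m t using dv[OF that, of t] by simp
  have nontriv: False if "m \<in> U" "y (t, m) = 0" "v (t, m) = 0" for m t
  proof -
    have "y (0, m) = 0 \<and> v (0, m) = 0"
      using linear_ode_unique[OF dy[OF that(1)] dv[OF that(1)] qb[OF that(1)] that(2,3)] by blast
    then show False using y0 v0 by (auto simp: c_def d_def split: if_splits)
  qed
  define B where "B m = (if b then v (L, m) else y (L, m))" for m
  have cB: "continuous_on A B" if "A \<subseteq> U" for A
    unfolding B_def
    by (cases b; simp; rule continuous_on_compose2[OF cv] continuous_on_compose2[OF cy])
      (use that in \<open>auto intro!: continuous_intros\<close>)
  have "\<exists>\<mu>. 0 < \<mu> \<and> \<mu> < \<mu>0 \<and> B \<mu> = 0"
  proof (rule ccontr)
    assume noroot: "\<not> ?thesis"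
    have 0: "0 \<in> U" using \<mu>0 by (simp add: U_def)
    \<comment> \<open>For m = 0 the equation is y'' = p^2 y, solved by cosh (p t), sinh (p t) / p
      or, in the Dirichlet case with p = 0, by t.\<close>
    have start: "0 < y (t, 0)" "0 < B 0" if "0 < t" for t
    proof -
      define z where "z t = (if a then cosh (p * t) else if p = 0 then t else sinh (p * t) / p)" for t
      define w where "w t = (if a then p * sinh (p * t) else if p = 0 then 1 else cosh (p * t))" for t
      have zw: "(z has_real_derivative w t) (at t)" "(w has_real_derivative (p\<^sup>2 - 0 * \<rho> t) * z t) (at t)" for t
        unfolding z_def w_def
        by (auto intro!: derivative_eq_intros simp: power2_eq_square mult_ac)
      have eq: "y (t, 0) = z t" "v (t, 0) = w t" for t
        using linear_ode_eq[OF dy[OF 0] dv[OF 0] zw qb[OF 0], where c = 0] y0 v0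
        by (auto simp: z_def w_def c_def d_def)
      have z: "0 < z t" if "0 < t" for t
        using that p by (auto simp: z_def)
      show "0 < y (t, 0)" using z[OF that] by (simp add: eq)
      show "0 < B 0"
        unfolding B_def eq using z[OF L] L p nt by (auto simp: w_def)
    qed
    have Bpos: "0 < B m" if m: "0 \<le> m" "m < \<mu>0" for m
    proof (rule ccontr)
      assume "\<not> 0 < B m"
      then obtain x where "0 \<le> x" "x \<le> m" "B x = 0"
        using IVT2'[of B m 0 0] start(2)[OF L] m cB[of "{0..m}"] by (auto simp: U_def)
      then show False using noroot start(2)[OF L] m by (metis less_eq_real_def less_irrefl order_le_less_trans)
    qed
    have Bend: "0 \<le> B \<mu>0"
    proof (rule ccontr)
      assume neg: "\<not> 0 \<le> B \<mu>0"
      then obtain x where "0 \<le> x" "x \<le> \<mu>0" "B x = 0"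
        using IVT2'[of B \<mu>0 0 0] start(2)[OF L] \<mu>0 cB[of "{0..\<mu>0}"] by (auto simp: U_def)
      then show False using noroot start(2)[OF L] neg by (metis less_eq_real_def less_irrefl)
    qed
    \<comment> \<open>\<open>S\<close> contains 0 and misses \<mu>0, while \<open>S\<close> and its
      complement in \<open>U\<close> are both closed. This contradicts the connectedness of
      \<open>U\<close>.\<close>
    define S where "S = {m\<in>U. \<forall>t\<in>{0<..<L}. 0 < y (t, m)}"
    have lim: "(\<lambda>i. f (s i, r i)) \<longlonglongrightarrow> f (t, m)"
      if "continuous_on (UNIV \<times> U) f" "s \<longlonglongrightarrow> t" "r \<longlonglongrightarrow> m" "\<And>i. r i \<in> U" "m \<in> U"
      for f :: "real \<times> real \<Rightarrow> real" and s r t m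
      by (rule continuous_on_tendsto_compose[OF that(1)]) (use that in \<open>auto intro!: tendsto_intros\<close>)
    have endp: "\<mu>0 \<notin> S"
    proof
      assume S: "\<mu>0 \<in> S"
      then have U: "\<mu>0 \<in> U" by (simp add: S_def)
      \<comment> \<open>The Wronskian with \<phi>. The terms with \<mu>0 cancel, so it decreases
        strictly from its value 0 at 0; but \<open>Bend\<close> and the boundary condition of \<phi>
        make it nonnegative at \<open>L\<close>.\<close>
      define W where "W t = v (t, \<mu>0) * \<phi> t - y (t, \<mu>0) * \<psi> t" for t
      have dW: "(W has_real_derivative (p\<^sup>2 - p0\<^sup>2) * (y (t, \<mu>0) * \<phi> t)) (at t)" for t
        unfolding W_def
        by (rule DERIV_cong[OF DERIV_diff[OF DERIV_mult[OF dv[OF U] \<phi>] DERIV_mult[OF dy[OF U] \<psi>]]])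
          (simp add: algebra_simps)
      have "p\<^sup>2 < p0\<^sup>2" using p by (simp add: power_strict_mono)
      have "W L < W 0"
      proof (rule DERIV_neg_imp_decreasing_open[OF L])
        fix t assume t: "0 < t" "t < L"
        have "(p\<^sup>2 - p0\<^sup>2) * (y (t, \<mu>0) * \<phi> t) < 0"
          using t S pos[OF t] \<open>p\<^sup>2 < p0\<^sup>2\<close> by (auto simp: S_def intro!: mult_neg_pos mult_pos_pos)
        then show "\<exists>z. (W has_real_derivative z) (at t) \<and> z < 0" using dW by blast
      qed (use dW DERIV_isCont in \<open>blast intro: continuous_at_imp_continuous_on\<close>)
      moreover have "W 0 = 0"
        using bc0 y0 v0 by (auto simp: W_def c_def d_def split: if_splits)
      moreover have "0 \<le> \<phi> L"
      proof (rule ccontr)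
        assume neg: "\<not> 0 \<le> \<phi> L"
        have "continuous_on {L/2..L} \<phi>"
          using \<phi> DERIV_isCont by (blast intro: continuous_at_imp_continuous_on)
        then obtain x where "L/2 \<le> x" "x \<le> L" "\<phi> x = 0"
          using IVT2'[of \<phi> L 0 "L/2"] neg pos[of "L/2"] L by auto
        then show False using pos[of x] neg L by (cases "x = L") auto
      qed
      moreover have "\<psi> L \<le> 0" if "\<phi> L = 0"
      proof (rule ccontr)
        assume "\<not> \<psi> L \<le> 0"
        then obtain e where e: "0 < e" "\<And>h. 0 < h \<Longrightarrow> h < e \<Longrightarrow> \<phi> (L - h) < \<phi> L"
          using DERIV_pos_inc_left[OF \<phi>[of L]] by auto
        define h where "h = min (e / 2) (L / 2)"
        have "0 < h" "h < e" "h < L" using e L by (auto simp: h_def)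
        then show False using e(2)[of h] pos[of "L - h"] that by auto
      qed
      ultimately have "W L < 0" "0 \<le> \<phi> L" "\<phi> L = 0 \<Longrightarrow> \<psi> L \<le> 0" by auto
      moreover have "0 \<le> v (L, \<mu>0) * \<phi> L" if b
        using Bend \<open>0 \<le> \<phi> L\<close> that by (auto simp: B_def)
      moreover have "y (L, \<mu>0) * \<psi> L \<le> 0" if "\<not> b"
        using Bend \<open>\<phi> L = 0 \<Longrightarrow> \<psi> L \<le> 0\<close> bcL that by (auto simp: B_def mult_nonneg_nonpos)
      ultimately show False
        using bcL by (auto simp: W_def split: if_splits)
    qed
    have closed: "closed S"
      unfolding closed_sequential_limits
    proof (intro allI impI)
      fix r m assume r: "(\<forall>n. r n \<in> S) \<and> r \<longlonglongrightarrow> m"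
      have rU: "r i \<in> U" for i using r by (auto simp: S_def)
      have mU: "m \<in> U"
        using r rU closed_sequentially[of U r m] by (auto simp: U_def)
      have nonneg: "0 \<le> y (t, m)" if "0 < t" "t < L" for t
      proof (rule LIMSEQ_le_const[OF lim[OF cy tendsto_const _ rU mU]])
        show "\<exists>N. \<forall>n\<ge>N. 0 \<le> y (t, r n)" using r that by (auto simp: S_def less_imp_le)
      qed (use r in auto)
      \<comment> \<open>An interior zero of the nonnegative limit would be a minimum, hence a double
        zero, which \<open>nontriv\<close> excludes.\<close>
      have "0 < y (t, m)" if t: "0 < t" "t < L" for t
      proof (rule ccontr)
        assume "\<not> ?thesis"
        then have z: "y (t, m) = 0" using nonneg[OF t] by simp
        have "v (t, m) = 0"
        proof (rule DERIV_local_min[OF dy[OF mU]])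
          show "0 < min t (L - t)" using t by simp
          show "\<forall>s. \<bar>t - s\<bar> < min t (L - t) \<longrightarrow> y (t, m) \<le> y (s, m)"
            using nonneg z by auto
        qed
        with z nontriv[OF mU] show False by blast
      qed
      then show "m \<in> S" using mU by (auto simp: S_def)
    qed
    have closed': "closed (U - S)"
      unfolding closed_sequential_limits
    proof (intro allI impI)
      fix r m assume r: "(\<forall>n. r n \<in> U - S) \<and> r \<longlonglongrightarrow> m"
      have rU: "r i \<in> U" for i using r by auto
      have mU: "m \<in> U"
        using r rU closed_sequentially[of U r m] by (auto simp: U_def)
      have "\<exists>t. 0 < t \<and> t < L \<and> y (t, r i) \<le> 0" for i
      proof -
        have "r i \<notin> S" using r by blast
        then show ?thesis using rU[of i] by (auto simp: S_def not_less)
      qed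
      then obtain s where s: "\<And>i. 0 < s i" "\<And>i. s i < L" "\<And>i. y (s i, r i) \<le> 0" by metis
      have "\<forall>i. s i \<in> {0..L}" using s by (auto intro: less_imp_le)
      then obtain t f where t: "t \<in> {0..L}" and f: "strict_mono f" "(s \<circ> f) \<longlonglongrightarrow> t"
        using compact_imp_seq_compact[OF compact_Icc[of 0 L]] unfolding seq_compact_def by blast
      have rf: "(r \<circ> f) \<longlonglongrightarrow> m" using r f(1) by (intro LIMSEQ_subseq_LIMSEQ) auto
      have rfU: "(r \<circ> f) i \<in> U" for i using rU by simp
      have yt: "y (t, m) \<le> 0"
        by (rule LIMSEQ_le_const2[OF lim[OF cy f(2) rf rfU mU]]) (use s in auto)
      show "m \<in> U - S"
      proof (rule ccontr)
        assume "m \<notin> U - S"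
        then have mS: "m \<in> S" using mU by simp
        then have m: "0 \<le> m" "m < \<mu>0"
          using mU endp by (auto simp: U_def less_le)
        \<comment> \<open>If the limit solution is positive inside, the points with nonpositive
          values can only accumulate at an end. At 0 this is excluded by the initial data, at
          \<open>L\<close> by the sign of \<open>B\<close>.\<close>
        have "t = 0 \<or> t = L"
        proof (rule ccontr)
          assume "\<not> ?thesis"
          then have "0 < y (t, m)" using t mS by (auto simp: S_def)
          then show False using yt by simp
        qed
        then show False
        proof
          assume t0: "t = 0"
          then have na: "\<not> a" using yt y0 by (auto simp: c_def)
          \<comment> \<open>Under the Dirichlet condition, the mean value theorem gives nonpositive
            slopes at points tending to 0, against the prescribed slope 1.\<close>
          have "\<exists>z. 0 < z \<and> z < s i \<and> v (z, r i) \<le> 0" for i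
          proof -
            obtain z where z: "0 < z" "z < s i" "y (s i, r i) - y (0, r i) = (s i - 0) * v (z, r i)"
              using MVT2[OF s(1)[of i], of "\<lambda>t. y (t, r i)" "\<lambda>t. v (t, r i)"] dy[OF rU] by auto
            then have "s i * v (z, r i) \<le> 0" using s(3)[of i] y0 na by (simp add: c_def)
            then show ?thesis using z s(1)[of i] by (auto simp: mult_le_0_iff)
          qed
          then obtain z where z: "\<And>i. 0 < z i" "\<And>i. z i < s i" "\<And>i. v (z i, r i) \<le> 0" by metis
          have "(z \<circ> f) \<longlonglongrightarrow> 0"
            by (rule tendsto_sandwich[OF _ _ tendsto_const f(2)[unfolded t0]])
              (use z in \<open>auto intro!: always_eventually less_imp_le\<close>)
          then have "v (0, m) \<le> 0"
            by (intro LIMSEQ_le_const2[OF lim[OF cv _ rf rfU mU]]) (use z in auto)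
          then show False using v0 na by (simp add: d_def)
        next
          assume tL: "t = L"
          show False
          proof (cases b)
            case False
            then show False using Bpos[OF m] yt tL by (simp add: B_def)
          next
            case True
            then have "0 < v (L, m)" using Bpos[OF m] by (simp add: B_def)
            then obtain e where e: "0 < e" "\<And>h. 0 < h \<Longrightarrow> h < e \<Longrightarrow> y (L - h, m) < y (L, m)"
              using DERIV_pos_inc_left[OF dy[OF mU, of L]] by auto
            define h where "h = min (e / 2) (L / 2)"
            have h: "0 < h" "h < e" "h < L" using e L by (auto simp: h_def)
            then have "0 < y (L - h, m)" using mS by (auto simp: S_def)
            then show False using e(2)[OF h(1,2)] yt tL by simp
          qed
        qed
      qed
    qed
    have "0 \<in> S" using start(1) 0 by (auto simp: S_def)
    moreover have "\<mu>0 \<in> U - S" using endp \<mu>0 by (auto simp: U_def)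
    moreover have "connected U" unfolding U_def by simp
    ultimately show False
      using closed closed' unfolding connected_closed S_def by blast
  qed
  then obtain \<mu> where \<mu>: "0 < \<mu>" "\<mu> < \<mu>0" "B \<mu> = 0" by blast
  then have U: "\<mu> \<in> U" by (simp add: U_def)
  show thesis
  proof (rule that[OF \<mu>(1,2) dy[OF U] dv[OF U]])
    fix t
    show "y (- t, \<mu>) = parity a * y (t, \<mu>)"
      using linear_ode_reflect[OF dy[OF U] dv[OF U] qb[OF U], of 0 "parity a" t] y0 v0 sym0
      by (simp add: parity_def c_def d_def)
    show "y (2 * L - t, \<mu>) = parity b * y (t, \<mu>)"
      using linear_ode_reflect[OF dy[OF U] dv[OF U] qb[OF U], of L "parity b" t] \<mu>(3) symL
      by (cases b) (simp_all add: parity_def B_def)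
  next
    have "y (0, \<mu>) \<noteq> 0 \<or> v (0, \<mu>) \<noteq> 0" using nontriv[OF U] by blast
    show "\<exists>t. y (t, \<mu>) \<noteq> 0"
    proof (rule ccontr)
      assume z: "\<not> ?thesis"
      then have "(\<lambda>t. y (t, \<mu>)) = (\<lambda>_. 0)" by auto
      then have "v (t, \<mu>) = 0" for t
        using dy[OF U, of t] DERIV_unique[OF _ DERIV_const] by metis
      then show False using nontriv[OF U] z by blast
    qed
  qed
qed

section \<open>Energy inequalities\<close>

lemma continuous_on_has_derivative:
  fixes f :: "real \<Rightarrow> real"
  assumes "\<And>t. (f has_real_derivative f' t) (at t)"
  shows "continuous_on A f"
  using assms DERIV_isCont by (blast intro: continuous_at_imp_continuous_on)

lemma integral_eq_0_imp_zero:
  fixes f :: "real \<Rightarrow> real"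
  assumes "a < b" "continuous_on {a..b} f" "\<And>t. t \<in> {a..b} \<Longrightarrow> 0 \<le> f t"
    and "integral {a..b} f \<le> 0" "t \<in> {a..b}"
  shows "f t = 0"
proof -
  have "0 \<le> integral {a..b} f"
    by (intro integral_nonneg integrable_continuous_real assms) auto
  then have "(f has_integral 0) (cbox a b)"
    using assms(4) integrable_integral[OF integrable_continuous_real[OF assms(2)]] by simp
  then show ?thesis
    using has_integral_0_cbox_imp_0[of a b f t] assms by auto
qed

text \<open>Integrate Picone's identity
  \<open>g'\<^sup>2 - w g\<^sup>2 = (g' - g \<psi> / \<phi>)\<^sup>2 + (g\<^sup>2 \<psi> / \<phi>)'\<close>. The boundary term is continuous with value \<open>0\<close> even at
  a zero of \<open>\<phi>\<close>, where the division convention gives the same value.\<close>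

lemma picone:
  fixes \<phi> \<psi> w g g' :: "real \<Rightarrow> real"
  assumes ab: "a < b"
    and \<phi>: "\<And>t. (\<phi> has_real_derivative \<psi> t) (at t)"
    and \<psi>: "\<And>t. (\<psi> has_real_derivative - w t * \<phi> t) (at t)"
    and w: "continuous_on UNIV w"
    and nz: "\<And>t. a < t \<Longrightarrow> t < b \<Longrightarrow> \<phi> t \<noteq> 0" and simple: "\<And>t. \<phi> t = 0 \<Longrightarrow> \<psi> t \<noteq> 0"
    and nz_end: "\<phi> a \<noteq> 0 \<or> \<phi> b \<noteq> 0"
    and g: "\<And>t. (g has_real_derivative g' t) (at t)" and g': "continuous_on UNIV g'"
    and ga: "g a = 0" and gb: "g b = 0"
  defines "I \<equiv> integral {a..b} (\<lambda>t. (g' t)\<^sup>2 - w t * (g t)\<^sup>2)"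
  shows "0 \<le> I" and "I \<le> 0 \<Longrightarrow> t \<in> {a..b} \<Longrightarrow> g t = 0"
proof -
  let ?D = "\<lambda>t. (g' t)\<^sup>2 - w t * (g t)\<^sup>2"
  let ?Q = "\<lambda>t. (g' t - g t * \<psi> t / \<phi> t)\<^sup>2"
  let ?H = "\<lambda>t. g t * (g t / \<phi> t) * \<psi> t"
  note cont = continuous_on_has_derivative[OF \<phi>] continuous_on_has_derivative[OF \<psi>]
    continuous_on_has_derivative[OF g] continuous_on_subset[OF w subset_UNIV]
    continuous_on_subset[OF g' subset_UNIV]
  have derH: "(?H has_real_derivative ?D t - ?Q t) (at t)" if "\<phi> t \<noteq> 0" for t
  proof -
    have "((\<lambda>t. g t / \<phi> t) has_real_derivative (g' t * \<phi> t - g t * \<psi> t) / (\<phi> t * \<phi> t)) (at t)"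
      by (rule DERIV_divide[OF g \<phi> that])
    from DERIV_mult[OF DERIV_mult[OF g this] \<psi>] show ?thesis
      by (rule DERIV_cong) (use that in \<open>simp add: field_simps power2_eq_square\<close>)
  qed
  have lim: "(?H \<longlongrightarrow> 0) (at e within S)" if "g e = 0" for e S
  proof (cases "\<phi> e = 0")
    case False
    have "isCont ?H e" using derH[OF False] DERIV_isCont by blast
    then have "(?H \<longlongrightarrow> ?H e) (at e)" by (simp add: isCont_def)
    then show ?thesis using that tendsto_within_subset[of ?H _ e UNIV S] by simp
  next
    case True
    have "((\<lambda>t. g t / (t - e)) \<longlongrightarrow> g' e) (at e within S)" "((\<lambda>t. \<phi> t / (t - e)) \<longlongrightarrow> \<psi> e) (at e within S)"
      using has_field_derivative_at_within[OF g[of e], of S] has_field_derivative_at_within[OF \<phi>[of e], of S] that True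
      by (simp_all add: has_field_derivative_iff)
    from tendsto_divide[OF this simple[OF True]]
    have "((\<lambda>t. g t / (t - e) / (\<phi> t / (t - e))) \<longlongrightarrow> g' e / \<psi> e) (at e within S)" .
    then have q: "((\<lambda>t. g t / \<phi> t) \<longlongrightarrow> g' e / \<psi> e) (at e within S)"
      by (rule Lim_transform_eventually) (auto simp: eventually_at_filter)
    have "(g \<longlongrightarrow> g e) (at e within S)" "(\<psi> \<longlongrightarrow> \<psi> e) (at e within S)"
      using DERIV_isCont[OF g[of e]] DERIV_isCont[OF \<psi>[of e]]
      by (auto simp: isCont_def intro: tendsto_within_subset)
    from tendsto_mult[OF tendsto_mult[OF this(1) q] this(2)] show ?thesis
      using that by simp
  qed
  have "continuous_on {a..b} ?H"
    unfolding continuous_on_def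
  proof
    fix t assume t: "t \<in> {a..b}"
    show "(?H \<longlongrightarrow> ?H t) (at t within {a..b})"
    proof (cases "g t = 0")
      case True
      then show ?thesis using lim[of t] by simp
    next
      case False
      then have "\<phi> t \<noteq> 0" using nz[of t] t ga gb by (metis atLeastAtMost_iff less_eq_real_def)
      then show ?thesis
        using DERIV_isCont[OF derH] by (auto simp: isCont_def intro: tendsto_within_subset)
    qed
  qed
  then have "((\<lambda>t. ?D t - ?Q t) has_integral (?H b - ?H a)) {a..b}"
    using ab derH nz
    by (intro fundamental_theorem_of_calculus_interior)
      (auto simp flip: has_real_derivative_iff_has_vector_derivative)
  moreover have "(?D has_integral I) {a..b}"
    unfolding I_def by (intro integrable_integral integrable_continuous_real continuous_intros cont)
  ultimately have "((\<lambda>t. ?D t - (?D t - ?Q t)) has_integral (I - 0)) {a..b}"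
    using ga gb by (intro has_integral_diff) auto
  then have Q: "(?Q has_integral I) {a..b}" by simp
  then show "0 \<le> I" by (rule has_integral_nonneg) simp
  assume I: "I \<le> 0" and t: "t \<in> {a..b}"
  \<comment> \<open>\<open>?Q\<close> may be discontinuous at an end where \<phi> vanishes, so the
    vanishing of the integral is exploited on a compact subinterval around \<open>s\<close>.\<close>
  have Q0: "?Q s = 0" if s: "a < s" "s < b" for s
  proof (rule integral_eq_0_imp_zero[where a = "(a + s) / 2" and b = "(s + b) / 2" and f = ?Q])
    have sub: "{(a + s) / 2..(s + b) / 2} \<subseteq> {a..b}" using s by auto
    have "\<phi> x \<noteq> 0" if "x \<in> {(a + s) / 2..(s + b) / 2}" for x
      using nz[of x] that s by auto
    then show c: "continuous_on {(a + s) / 2..(s + b) / 2} ?Q"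
      by (intro continuous_intros cont) auto
    have "integral {(a + s) / 2..(s + b) / 2} ?Q \<le> integral {a..b} ?Q"
      by (rule integral_subset_le[OF sub integrable_continuous_real[OF c]]) (use Q in auto)
    then show "integral {(a + s) / 2..(s + b) / 2} ?Q \<le> 0" using I integral_unique[OF Q] by simp
  qed (use s in auto)
  \<comment> \<open>Hence g is a multiple of \<phi> in the interior. The end with \<phi> \<noteq> 0
    supplied by \<open>nz_end\<close> forces the factor to be 0; if \<phi> vanished at both ends, g
    = \<phi> would be a counterexample.\<close>
  have d0: "((\<lambda>t. g t / \<phi> t) has_real_derivative 0) (at s)" if s: "a < s" "s < b" for s
  proof -
    have "g' s * \<phi> s - g s * \<psi> s = 0" using Q0[OF s] nz[OF s] by (simp add: field_simps)
    then show ?thesis using DERIV_divide[OF g \<phi> nz[OF s]] by simp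
  qed
  show "g t = 0"
  proof (cases "a < t \<and> t < b")
    case False
    then show ?thesis using t ga gb by (cases "t = a") auto
  next
    case True
    have c: "continuous_on A (\<lambda>t. g t / \<phi> t)" if "\<And>t. t \<in> A \<Longrightarrow> \<phi> t \<noteq> 0" for A
      by (intro continuous_intros cont) (use that in auto)
    have "g t / \<phi> t = 0"
      using nz_end
    proof
      assume na: "\<phi> a \<noteq> 0"
      have "g t / \<phi> t = g a / \<phi> a"
      proof (rule DERIV_isconst_end[where f = "\<lambda>t. g t / \<phi> t" and a = a and b = t])
        show "continuous_on {a..t} (\<lambda>t. g t / \<phi> t)"
          using na nz True by (intro c) (metis atLeastAtMost_iff less_eq_real_def order_le_less_trans)
      qed (use True d0 in auto)
      then show ?thesis using ga by simp
    next
      assume nb: "\<phi> b \<noteq> 0"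
      have "g b / \<phi> b = g t / \<phi> t"
      proof (rule DERIV_isconst_end[where f = "\<lambda>t. g t / \<phi> t" and a = t and b = b])
        show "continuous_on {t..b} (\<lambda>t. g t / \<phi> t)"
          using nb nz True by (intro c) (metis atLeastAtMost_iff less_eq_real_def order_less_le_trans)
      qed (use True d0 in auto)
      then show ?thesis using gb by simp
    qed
    then show ?thesis using nz[of t] True by simp
  qed
qed

text \<open>\<open>picone\<close> summed over adjacent intervals. Zeros of \<phi> may be partition
  points, though never two in a row. Thus \<phi> may change sign often and still control the energy,
  at the price of one vanishing condition on g per partition point.\<close>

lemma picone_partition:
  fixes \<phi> \<psi> w g g' :: "real \<Rightarrow> real" and \<tau> :: "nat \<Rightarrow> real"
  assumes \<phi>: "\<And>t. (\<phi> has_real_derivative \<psi> t) (at t)"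
    and \<psi>: "\<And>t. (\<psi> has_real_derivative - w t * \<phi> t) (at t)"
    and w: "continuous_on UNIV w" and simple: "\<And>t. \<phi> t = 0 \<Longrightarrow> \<psi> t \<noteq> 0"
    and g: "\<And>t. (g has_real_derivative g' t) (at t)" and g': "continuous_on UNIV g'"
    and \<tau>: "\<And>i. i < N \<Longrightarrow> \<tau> i < \<tau> (Suc i)"
    and nz: "\<And>i t. i < N \<Longrightarrow> \<tau> i < t \<Longrightarrow> t < \<tau> (Suc i) \<Longrightarrow> \<phi> t \<noteq> 0"
    and nz_end: "\<And>i. i < N \<Longrightarrow> \<phi> (\<tau> i) \<noteq> 0 \<or> \<phi> (\<tau> (Suc i)) \<noteq> 0"
    and g0: "\<And>i. i \<le> N \<Longrightarrow> g (\<tau> i) = 0"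
  shows "0 \<le> integral {\<tau> 0..\<tau> N} (\<lambda>t. (g' t)\<^sup>2 - w t * (g t)\<^sup>2) \<and>
    (integral {\<tau> 0..\<tau> N} (\<lambda>t. (g' t)\<^sup>2 - w t * (g t)\<^sup>2) \<le> 0 \<longrightarrow> (\<forall>t\<in>{\<tau> 0..\<tau> N}. g t = 0))"
  using \<tau> nz nz_end g0
proof (induction N)
  case 0
  then show ?case by simp
next
  case (Suc N)
  let ?D = "\<lambda>t. (g' t)\<^sup>2 - w t * (g t)\<^sup>2"
  have IH: "0 \<le> integral {\<tau> 0..\<tau> N} ?D \<and> (integral {\<tau> 0..\<tau> N} ?D \<le> 0 \<longrightarrow> (\<forall>t\<in>{\<tau> 0..\<tau> N}. g t = 0))"
  proof (rule Suc.IH)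
    show "\<phi> t \<noteq> 0" if "i < N" "\<tau> i < t" "t < \<tau> (Suc i)" for i t
      by (rule Suc.prems(2)[OF less_SucI]) (use that in auto)
  qed (use Suc.prems(1,3,4) in auto)
  note step = picone[OF Suc.prems(1)[OF lessI] \<phi> \<psi> w Suc.prems(2)[OF lessI] simple
      Suc.prems(3)[OF lessI] g g' Suc.prems(4)[OF le_SucI[OF order_refl]] Suc.prems(4)[OF order_refl]]
  have "\<tau> 0 \<le> \<tau> i" if "i \<le> N" for i
    using that
  proof (induction i)
    case (Suc i)
    then show ?case using Suc.prems \<open>\<And>i. i < Suc N \<Longrightarrow> \<tau> i < \<tau> (Suc i)\<close>[of i] by auto
  qed simp
  then have le: "\<tau> 0 \<le> \<tau> N" "\<tau> N \<le> \<tau> (Suc N)" using Suc.prems(1)[of N] by auto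
  have comb: "integral {\<tau> 0..\<tau> N} ?D + integral {\<tau> N..\<tau> (Suc N)} ?D = integral {\<tau> 0..\<tau> (Suc N)} ?D"
    by (rule Henstock_Kurzweil_Integration.integral_combine[OF le])
      (intro integrable_continuous_real continuous_intros continuous_on_has_derivative[OF g]
        continuous_on_subset[OF w subset_UNIV] continuous_on_subset[OF g' subset_UNIV])
  have "integral {\<tau> 0..\<tau> N} ?D \<le> 0 \<and> integral {\<tau> N..\<tau> (Suc N)} ?D \<le> 0"
    if "integral {\<tau> 0..\<tau> (Suc N)} ?D \<le> 0"
    using comb IH step(1) that by linarith
  then have zero: "g t = 0" if "integral {\<tau> 0..\<tau> (Suc N)} ?D \<le> 0" "t \<in> {\<tau> 0..\<tau> (Suc N)}" for t
    using IH step(2)[of t] that by (cases "t \<le> \<tau> N") auto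
  have "0 \<le> integral {\<tau> 0..\<tau> (Suc N)} ?D"
    using comb IH step(1) by linarith
  then show ?case using zero by blast
qed

lemma integral_derivative_periodic:
  fixes f f' :: "real \<Rightarrow> real"
  assumes "\<And>t. (f has_real_derivative f' t) (at t)" "0 \<le> P" "f P = f 0"
  shows "(f' has_integral 0) {0..P}"
proof -
  have "(f' has_integral (f P - f 0)) {0..P}"
    using assms(2) has_field_derivative_at_within[OF assms(1)]
    by (intro fundamental_theorem_of_calculus)
      (auto simp flip: has_real_derivative_iff_has_vector_derivative)
  then show ?thesis using assms(3) by simp
qed

text \<open>Let G be the sum of the modes. By orthogonality with weight \<rho>, the energy of G at
  level \<Lambda> is the sum of the terms (\<mu> - \<Lambda>) J \<mu>, which is \<le> 0, so
  coercivity makes G vanish. The integral of \<rho> G^2 is the sum of all J \<mu>, hence each J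
  \<mu> is 0 and each mode vanishes. The modes are periodic only up to \<epsilon>, but the boundary
  terms are quadratic and see \<epsilon>^2 = 1.\<close>

lemma eigenmodes_vanish:
  fixes g g' :: "real \<Rightarrow> real \<Rightarrow> real" and \<rho> :: "real \<Rightarrow> real"
  assumes fin: "finite F" and F: "\<And>\<mu>. \<mu> \<in> F \<Longrightarrow> \<mu> \<le> \<Lambda>"
    and P: "0 < P" and \<epsilon>: "\<epsilon> * \<epsilon> = 1"
    and \<rho>: "continuous_on UNIV \<rho>" "\<And>t. 0 < \<rho> t" "\<And>t. \<rho> t \<le> M"
    and g: "\<And>\<mu> t. \<mu> \<in> F \<Longrightarrow> (g \<mu> has_real_derivative g' \<mu> t) (at t)"
    and g': "\<And>\<mu> t. \<mu> \<in> F \<Longrightarrow> (g' \<mu> has_real_derivative (p\<^sup>2 - \<mu> * \<rho> t) * g \<mu> t) (at t)"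
    and per: "\<And>\<mu>. \<mu> \<in> F \<Longrightarrow> g \<mu> P = \<epsilon> * g \<mu> 0" "\<And>\<mu>. \<mu> \<in> F \<Longrightarrow> g' \<mu> P = \<epsilon> * g' \<mu> 0"
    and coercive: "\<And>t. t \<in> {0..P} \<Longrightarrow>
      integral {0..P} (\<lambda>t. (\<Sum>\<mu>\<in>F. g' \<mu> t)\<^sup>2 + (p\<^sup>2 - \<Lambda> * \<rho> t) * (\<Sum>\<mu>\<in>F. g \<mu> t)\<^sup>2) \<le> 0 \<Longrightarrow>
      (\<Sum>\<mu>\<in>F. g \<mu> t) = 0"
    and \<mu>: "\<mu> \<in> F"
  shows "g \<mu> t = 0"
proof -
  define G where "G t = (\<Sum>\<mu>\<in>F. g \<mu> t)" for t
  define G' where "G' t = (\<Sum>\<mu>\<in>F. g' \<mu> t)" for t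
  have cg: "continuous_on A (g \<mu>)" "continuous_on A (g' \<mu>)" if "\<mu> \<in> F" for \<mu> A
    using continuous_on_has_derivative[OF g[OF that]] continuous_on_has_derivative[OF g'[OF that]] by auto
  have c\<rho>: "continuous_on A \<rho>" for A by (rule continuous_on_subset[OF \<rho>(1)]) auto
  have orth: "((\<lambda>t. \<rho> t * (g \<mu> t * g \<nu> t)) has_integral 0) {0..P}" if "\<mu> \<in> F" "\<nu> \<in> F" "\<mu> \<noteq> \<nu>" for \<mu> \<nu>
  proof -
    have "((\<lambda>t. (\<nu> - \<mu>) * (\<rho> t * (g \<mu> t * g \<nu> t))) has_integral 0) {0..P}"
    proof (rule integral_derivative_periodic)
      show "((\<lambda>t. g' \<mu> t * g \<nu> t - g \<mu> t * g' \<nu> t) has_real_derivative (\<nu> - \<mu>) * (\<rho> t * (g \<mu> t * g \<nu> t))) (at t)" for t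
        by (rule DERIV_cong[OF DERIV_diff[OF DERIV_mult[OF g'[OF that(1)] g[OF that(2)]]
                DERIV_mult[OF g[OF that(1)] g'[OF that(2)]]]]) (simp add: algebra_simps)
      have "g' \<mu> P * g \<nu> P - g \<mu> P * g' \<nu> P = (\<epsilon> * \<epsilon>) * (g' \<mu> 0 * g \<nu> 0 - g \<mu> 0 * g' \<nu> 0)"
        using per that by (simp add: algebra_simps)
      then show "g' \<mu> P * g \<nu> P - g \<mu> P * g' \<nu> P = g' \<mu> 0 * g \<nu> 0 - g \<mu> 0 * g' \<nu> 0"
        using \<epsilon> by simp
    qed (use P in simp)
    from has_integral_mult_right[OF this, of "1 / (\<nu> - \<mu>)"] that(3) show ?thesis by simp
  qed
  define J where "J \<mu> = integral {0..P} (\<lambda>t. \<rho> t * (g \<mu> t)\<^sup>2)" for \<mu>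
  have J: "((\<lambda>t. \<rho> t * (g \<mu> t * g \<mu> t)) has_integral J \<mu>) {0..P}" if "\<mu> \<in> F" for \<mu>
    unfolding J_def power2_eq_square
    by (intro integrable_integral integrable_continuous_real continuous_intros cg[OF that] c\<rho>)
  have J0: "0 \<le> J \<mu>" if "\<mu> \<in> F" for \<mu>
    by (rule has_integral_nonneg[OF J[OF that]]) (use \<rho>(2) in \<open>simp add: less_imp_le\<close>)
  \<comment> \<open>Used twice: with coefficients \<mu> - \<Lambda> for the energy and with 1 for
    the weighted norm of G.\<close>
  have sumJ: "((\<lambda>t. \<rho> t * (G t * (\<Sum>\<nu>\<in>F. c \<nu> * g \<nu> t))) has_integral (\<Sum>\<mu>\<in>F. c \<mu> * J \<mu>)) {0..P}" for c
  proof -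
    have "((\<lambda>t. \<Sum>\<mu>\<in>F. \<Sum>\<nu>\<in>F. c \<nu> * (\<rho> t * (g \<mu> t * g \<nu> t))) has_integral
        (\<Sum>\<mu>\<in>F. \<Sum>\<nu>\<in>F. c \<nu> * (if \<mu> = \<nu> then J \<mu> else 0))) {0..P}"
      using orth J by (intro has_integral_sum fin has_integral_mult_right) auto
    also have "(\<Sum>\<mu>\<in>F. \<Sum>\<nu>\<in>F. c \<nu> * (if \<mu> = \<nu> then J \<mu> else 0)) = (\<Sum>\<mu>\<in>F. c \<mu> * J \<mu>)"
      using fin by (intro sum.cong) (auto simp: if_distrib[of "\<lambda>x. _ * x"] sum.delta cong: if_cong)
    also have "(\<lambda>t. \<Sum>\<mu>\<in>F. \<Sum>\<nu>\<in>F. c \<nu> * (\<rho> t * (g \<mu> t * g \<nu> t))) = (\<lambda>t. \<rho> t * (G t * (\<Sum>\<nu>\<in>F. c \<nu> * g \<nu> t)))"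
      unfolding G_def sum_product by (simp add: sum_distrib_left mult_ac)
    finally show ?thesis .
  qed
  have dG: "(G has_real_derivative G' t) (at t)" for t
    unfolding G_def G'_def by (intro DERIV_sum g)
  have dG': "(G' has_real_derivative (\<Sum>\<mu>\<in>F. (p\<^sup>2 - \<mu> * \<rho> t) * g \<mu> t)) (at t)" for t
    unfolding G'_def by (intro DERIV_sum g')
  have GP: "G P = \<epsilon> * G 0" "G' P = \<epsilon> * G' 0"
    using per by (simp_all add: G_def G'_def sum_distrib_left)
  have I1: "((\<lambda>t. (G' t)\<^sup>2 + p\<^sup>2 * (G t)\<^sup>2 - \<rho> t * (G t * (\<Sum>\<mu>\<in>F. \<mu> * g \<mu> t))) has_integral 0) {0..P}"
  proof (rule integral_derivative_periodic)
    show "((\<lambda>t. G t * G' t) has_real_derivative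
        (G' t)\<^sup>2 + p\<^sup>2 * (G t)\<^sup>2 - \<rho> t * (G t * (\<Sum>\<mu>\<in>F. \<mu> * g \<mu> t))) (at t)" for t
    proof (rule DERIV_cong[OF DERIV_mult[OF dG dG']])
      have "(\<Sum>\<mu>\<in>F. (p\<^sup>2 - \<mu> * \<rho> t) * g \<mu> t) = p\<^sup>2 * G t - \<rho> t * (\<Sum>\<mu>\<in>F. \<mu> * g \<mu> t)"
        by (simp add: G_def sum_distrib_left sum_subtractf[symmetric] algebra_simps)
      show "G' t * G' t + (\<Sum>\<mu>\<in>F. (p\<^sup>2 - \<mu> * \<rho> t) * g \<mu> t) * G t =
          (G' t)\<^sup>2 + p\<^sup>2 * (G t)\<^sup>2 - \<rho> t * (G t * (\<Sum>\<mu>\<in>F. \<mu> * g \<mu> t))"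
        unfolding \<open>_ = p\<^sup>2 * G t - _\<close> by (simp add: algebra_simps power2_eq_square)
    qed
    have "G P * G' P = (\<epsilon> * \<epsilon>) * (G 0 * G' 0)" using GP by simp
    then show "G P * G' P = G 0 * G' 0" using \<epsilon> by simp
  qed (use P in simp)
  have "((\<lambda>t. ((G' t)\<^sup>2 + p\<^sup>2 * (G t)\<^sup>2 - \<rho> t * (G t * (\<Sum>\<mu>\<in>F. \<mu> * g \<mu> t))) +
      \<rho> t * (G t * (\<Sum>\<mu>\<in>F. (\<mu> - \<Lambda>) * g \<mu> t))) has_integral (0 + (\<Sum>\<mu>\<in>F. (\<mu> - \<Lambda>) * J \<mu>))) {0..P}"
    by (intro has_integral_add I1 sumJ)
  moreover have "((G' t)\<^sup>2 + p\<^sup>2 * (G t)\<^sup>2 - \<rho> t * (G t * (\<Sum>\<mu>\<in>F. \<mu> * g \<mu> t))) +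
      \<rho> t * (G t * (\<Sum>\<mu>\<in>F. (\<mu> - \<Lambda>) * g \<mu> t)) = (G' t)\<^sup>2 + (p\<^sup>2 - \<Lambda> * \<rho> t) * (G t)\<^sup>2" for t
  proof -
    have "(\<Sum>\<mu>\<in>F. (\<mu> - \<Lambda>) * g \<mu> t) = (\<Sum>\<mu>\<in>F. \<mu> * g \<mu> t) - \<Lambda> * G t"
      by (simp add: G_def left_diff_distrib sum_subtractf sum_distrib_left)
    show ?thesis unfolding \<open>_ = _ - \<Lambda> * G t\<close> by (simp add: algebra_simps power2_eq_square)
  qed
  ultimately have "((\<lambda>t. (G' t)\<^sup>2 + (p\<^sup>2 - \<Lambda> * \<rho> t) * (G t)\<^sup>2) has_integral (\<Sum>\<mu>\<in>F. (\<mu> - \<Lambda>) * J \<mu>)) {0..P}"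
    by simp
  moreover have "(\<Sum>\<mu>\<in>F. (\<mu> - \<Lambda>) * J \<mu>) \<le> 0"
    using F J0 by (intro sum_nonpos mult_nonpos_nonneg) auto
  ultimately have "integral {0..P} (\<lambda>t. (G' t)\<^sup>2 + (p\<^sup>2 - \<Lambda> * \<rho> t) * (G t)\<^sup>2) \<le> 0"
    by (simp add: integral_unique)
  then have G0: "G t = 0" if "t \<in> {0..P}" for t
    using coercive[OF that] by (simp add: G_def G'_def)
  have "((\<lambda>t. \<rho> t * (G t * (\<Sum>\<nu>\<in>F. 1 * g \<nu> t))) has_integral 0) {0..P}"
    by (rule has_integral_is_0) (simp add: G0)
  then have "(\<Sum>\<mu>\<in>F. 1 * J \<mu>) = 0"
    using sumJ[of "\<lambda>_. 1"] has_integral_unique by blast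
  then have J\<mu>: "J \<mu> = 0" using J0 fin \<mu> by (simp add: sum_nonneg_eq_0_iff)
  have z: "g \<mu> t = 0" if "t \<in> {0..P}" for t
  proof -
    have "\<rho> t * (g \<mu> t)\<^sup>2 = 0"
      by (rule integral_eq_0_imp_zero[OF P _ _ _ that])
        (use J\<mu> \<rho>(2) cg[OF \<mu>] c\<rho> in \<open>auto simp: J_def less_imp_le intro!: continuous_intros\<close>)
    then show ?thesis using \<rho>(2)[of t] by simp
  qed
  \<comment> \<open>Vanishing on [0, P] gives a double zero at an inner point; uniqueness for the
    equation carries it to the whole line.\<close>
  have "g \<mu> (P / 2) = 0" using z P by simp
  moreover have "g' \<mu> (P / 2) = 0"
    by (rule DERIV_local_const[OF g[OF \<mu>], where d = "P / 2"]) (use z P in \<open>auto simp: abs_if split: if_splits\<close>)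
  moreover have "\<bar>p\<^sup>2 - \<mu> * \<rho> t\<bar> \<le> p\<^sup>2 + \<bar>\<mu>\<bar> * M" for t
  proof -
    have "\<bar>\<mu> * \<rho> t\<bar> \<le> \<bar>\<mu>\<bar> * M"
      unfolding abs_mult using \<rho>(2)[of t] \<rho>(3)[of t] by (intro mult_left_mono) auto
    then show ?thesis using zero_le_power2[of p] by linarith
  qed
  ultimately show ?thesis
    using linear_ode_unique(1)[OF g[OF \<mu>] g'[OF \<mu>]] by blast
qed

section \<open>Partial derivatives and smoothness in the plane\<close>

definition has_partials :: "(real^2 \<Rightarrow> real) \<Rightarrow> (real^2 \<Rightarrow> real) \<Rightarrow> (real^2 \<Rightarrow> real) \<Rightarrow> bool" where
  "has_partials f d1 d2 \<longleftrightarrow> (\<forall>z. (f has_derivative (\<lambda>h. h $ 1 * d1 z + h $ 2 * d2 z)) (at z))"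

lemma partial_deriv_eqI:
  assumes "((\<lambda>h. f (z + h *\<^sub>R axis i 1)) has_vector_derivative d) (at 0)"
  shows "partial_deriv i f z = d"
  unfolding partial_deriv_def by (rule vector_derivative_at[OF assms])

lemma partial_deriv_line:
  fixes f :: "real^2 \<Rightarrow> real"
  assumes "f differentiable at z"
  shows "((\<lambda>h. f (z + h *\<^sub>R axis i 1)) has_vector_derivative partial_deriv i f z) (at 0)"
proof -
  have "(\<lambda>h. f (z + h *\<^sub>R axis i 1)) differentiable (at 0)"
    by (rule differentiable_compose[of f "\<lambda>h. z + h *\<^sub>R axis i 1"])
      (use assms in \<open>auto intro!: derivative_intros\<close>)
  then show ?thesis
    unfolding partial_deriv_def by (rule vector_derivative_works[THEN iffD1])
qed

lemma has_partials_D: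
  assumes "has_partials f d1 d2"
  shows "partial_deriv 1 f = d1" "partial_deriv 2 f = d2" "f differentiable_on UNIV"
proof -
  have f: "(f has_derivative (\<lambda>h. h $ 1 * d1 z + h $ 2 * d2 z)) (at z)" for z
    using assms by (simp add: has_partials_def)
  have *: "((\<lambda>h. f (z + h *\<^sub>R axis i 1)) has_vector_derivative
      (axis i 1 :: real^2) $ 1 * d1 z + (axis i 1 :: real^2) $ 2 * d2 z) (at 0)" for z i
  proof -
    have 1: "((\<lambda>h::real. z + h *\<^sub>R axis i 1) has_derivative (\<lambda>h. h *\<^sub>R axis i 1)) (at 0)"
      by (auto intro!: derivative_eq_intros)
    have "(f \<circ> (\<lambda>h::real. z + h *\<^sub>R axis i 1) has_derivative
        (\<lambda>h. h $ 1 * d1 z + h $ 2 * d2 z) \<circ> (\<lambda>h. h *\<^sub>R axis i 1)) (at 0)"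
      by (rule diff_chain_at[OF 1]) (use f[of z] in simp)
    then show ?thesis
      by (simp add: has_vector_derivative_def o_def algebra_simps)
  qed
  show "partial_deriv 1 f = d1" "partial_deriv 2 f = d2"
    using partial_deriv_eqI[OF *] by (auto simp: axis_def fun_eq_iff)
  show "f differentiable_on UNIV"
    using f unfolding differentiable_on_def differentiable_def by auto
qed

lemma has_partials_const: "has_partials (\<lambda>_. c) (\<lambda>_. 0) (\<lambda>_. 0)"
  by (simp add: has_partials_def)

lemma has_partials_add:
  assumes "has_partials f d1 d2" "has_partials g e1 e2"
  shows "has_partials (\<lambda>z. f z + g z) (\<lambda>z. d1 z + e1 z) (\<lambda>z. d2 z + e2 z)"
  using assms unfolding has_partials_def
  by (auto intro!: derivative_eq_intros simp: fun_eq_iff algebra_simps)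

lemma has_partials_mult:
  assumes "has_partials f d1 d2" "has_partials g e1 e2"
  shows "has_partials (\<lambda>z. f z * g z) (\<lambda>z. d1 z * g z + f z * e1 z) (\<lambda>z. d2 z * g z + f z * e2 z)"
  unfolding has_partials_def
proof
  fix z
  have "(f has_derivative (\<lambda>h. h $ 1 * d1 z + h $ 2 * d2 z)) (at z)"
    "(g has_derivative (\<lambda>h. h $ 1 * e1 z + h $ 2 * e2 z)) (at z)"
    using assms by (auto simp: has_partials_def)
  from has_derivative_mult[OF this]
  show "((\<lambda>z. f z * g z) has_derivative (\<lambda>h. h $ 1 * (d1 z * g z + f z * e1 z) +
      h $ 2 * (d2 z * g z + f z * e2 z))) (at z)"
    by (rule has_derivative_eq_rhs) (simp add: fun_eq_iff algebra_simps)
qed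

lemma has_partials_coordinate:
  assumes "\<And>t. (\<phi> has_real_derivative \<psi> t) (at t)"
  shows "has_partials (\<lambda>z. \<phi> (z $ 1)) (\<lambda>z. \<psi> (z $ 1)) (\<lambda>_. 0)"
    and "has_partials (\<lambda>z. \<phi> (z $ 2)) (\<lambda>_. 0) (\<lambda>z. \<psi> (z $ 2))"
proof -
  have "((\<lambda>z::real^2. \<phi> (z $ i)) has_derivative (\<lambda>h. h $ i * \<psi> (z $ i))) (at z)" for i z
  proof -
    have "((\<lambda>z::real^2. z $ i) has_derivative (\<lambda>h. h $ i)) (at z)"
      by (intro bounded_linear_imp_has_derivative bounded_linear_vec_nth)
    moreover have "(\<phi> has_derivative (\<lambda>h. \<psi> (z $ i) * h)) (at (z $ i))"
      using assms[of "z $ i"] by (simp add: has_field_derivative_def)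
    ultimately have "(\<phi> \<circ> (\<lambda>z. z $ i) has_derivative (\<lambda>h. \<psi> (z $ i) * h) \<circ> (\<lambda>h. h $ i)) (at z)"
      by (rule diff_chain_at)
    then show ?thesis by (simp add: o_def mult.commute)
  qed
  then show "has_partials (\<lambda>z. \<phi> (z $ 1)) (\<lambda>z. \<psi> (z $ 1)) (\<lambda>_. 0)"
    "has_partials (\<lambda>z. \<phi> (z $ 2)) (\<lambda>_. 0) (\<lambda>z. \<psi> (z $ 2))"
    by (simp_all add: has_partials_def)
qed

section \<open>Smoothness from algebras closed under partial derivatives\<close>

inductive_set generated_algebra :: "('a \<Rightarrow> real) set \<Rightarrow> ('a \<Rightarrow> real) set" for G where
  gen: "f \<in> G \<Longrightarrow> f \<in> generated_algebra G"
| const: "(\<lambda>_. c) \<in> generated_algebra G"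
| add: "f \<in> generated_algebra G \<Longrightarrow> g \<in> generated_algebra G \<Longrightarrow> (\<lambda>z. f z + g z) \<in> generated_algebra G"
| mult: "f \<in> generated_algebra G \<Longrightarrow> g \<in> generated_algebra G \<Longrightarrow> (\<lambda>z. f z * g z) \<in> generated_algebra G"

text \<open>If the partial derivatives of the generators lie in the algebra, the product rule makes
  the whole algebra closed under partial derivatives, so every iterated one is differentiable
  without being computed.\<close>

lemma smooth_generated_algebra:
  assumes G: "\<And>g. g \<in> G \<Longrightarrow> \<exists>d1\<in>generated_algebra G. \<exists>d2\<in>generated_algebra G. has_partials g d1 d2"
    and f: "f \<in> generated_algebra G"
  shows "smooth f"
proof -
  have D: "\<exists>d1\<in>generated_algebra G. \<exists>d2\<in>generated_algebra G. has_partials g d1 d2"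
    if "g \<in> generated_algebra G" for g
    using that
  proof induction
    case (gen f)
    then show ?case by (rule G)
  next
    case (const c)
    then show ?case using has_partials_const generated_algebra.const by blast
  next
    case (add f g)
    then obtain d1 d2 e1 e2 where "d1 \<in> generated_algebra G" "d2 \<in> generated_algebra G"
      "has_partials f d1 d2" "e1 \<in> generated_algebra G" "e2 \<in> generated_algebra G" "has_partials g e1 e2"
      by blast
    then show ?case
      by (intro bexI) (assumption | rule has_partials_add generated_algebra.add)+
  next
    case (mult f g)
    then obtain d1 d2 e1 e2 where "d1 \<in> generated_algebra G" "d2 \<in> generated_algebra G"
      "has_partials f d1 d2" "e1 \<in> generated_algebra G" "e2 \<in> generated_algebra G" "has_partials g e1 e2"
      by blast
    then show ?case
      by (intro bexI)
        (assumption | rule has_partials_mult generated_algebra.add generated_algebra.mult mult.hyps)+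
  qed
  have P: "partial_deriv i g \<in> generated_algebra G" "g differentiable_on UNIV"
    if "g \<in> generated_algebra G" for g i
    using D[OF that] has_partials_D exhaust_2[of i] by metis+
  have "foldr partial_deriv is f \<in> generated_algebra G" for "is"
    by (induction "is") (simp_all add: f P(1))
  then show ?thesis unfolding smooth_def using P(2) by blast
qed

lemma smooth_partial_deriv: "smooth f \<Longrightarrow> smooth (partial_deriv i f)"
  unfolding smooth_def
proof
  fix "is"
  assume "\<forall>is. foldr partial_deriv is f differentiable_on UNIV"
  then have "foldr partial_deriv (is @ [i]) f differentiable_on UNIV" by blast
  then show "foldr partial_deriv is (partial_deriv i f) differentiable_on UNIV" by simp
qed

lemma smooth_differentiable:
  assumes "smooth f" shows "f differentiable at z" "continuous_on UNIV f"
proof -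
  have "foldr partial_deriv [] f differentiable_on UNIV" using assms unfolding smooth_def by blast
  then have d: "f differentiable_on UNIV" by simp
  then show "f differentiable at z" by (simp add: differentiable_on_def)
  show "continuous_on UNIV f" by (rule differentiable_imp_continuous_on[OF d])
qed

definition pt :: "real \<Rightarrow> real \<Rightarrow> real^2" where
  "pt s t = vector [s, t]"

lemma pt_nth [simp]: "pt s t $ 1 = s" "pt s t $ 2 = t"
  by (simp_all add: pt_def)

lemma pt_nths [simp]: "pt (z $ 1) (z $ 2) = z"
  by (simp add: vec_eq_iff forall_2)

lemma pt_add: "pt s t + pt s' t' = pt (s + s') (t + t')"
  by (simp add: vec_eq_iff forall_2)

lemma continuous_pt [continuous_intros]:
  "continuous_on A f \<Longrightarrow> continuous_on A g \<Longrightarrow> continuous_on A (\<lambda>x. pt (f x) (g x))"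
proof -
  assume fg: "continuous_on A f" "continuous_on A g"
  have "(\<lambda>x. pt (f x) (g x)) = (\<lambda>x. \<chi> i. if i = 1 then f x else g x)"
    by (auto simp: vec_eq_iff forall_2 fun_eq_iff)
  moreover have "continuous_on A (\<lambda>x. if i = 1 then f x else g x)" for i :: 2
    using fg by (cases "i = 1") auto
  ultimately show ?thesis by (simp only:) (rule continuous_on_vec_lambda)
qed

lemma smooth_slice_deriv:
  assumes "smooth f"
  shows "((\<lambda>s. f (pt s t)) has_real_derivative partial_deriv 1 f (pt s t)) (at s)"
    and "((\<lambda>t. f (pt s t)) has_real_derivative partial_deriv 2 f (pt s t)) (at t)"
proof -
  have *: "((\<lambda>h. f (pt s t + h *\<^sub>R axis i 1)) has_real_derivative partial_deriv i f (pt s t)) (at 0)" for i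
    unfolding has_real_derivative_iff_has_vector_derivative
    by (rule partial_deriv_line[OF smooth_differentiable(1)[OF assms]])
  have 1: "pt s t + h *\<^sub>R axis 1 1 = pt (h + s) t" "pt s t + h *\<^sub>R axis 2 1 = pt s (h + t)" for h
    by (simp_all add: vec_eq_iff forall_2 axis_def)
  show "((\<lambda>s. f (pt s t)) has_real_derivative partial_deriv 1 f (pt s t)) (at s)"
    using *[of 1] DERIV_shift[of "\<lambda>s. f (pt s t)" "partial_deriv 1 f (pt s t)" 0 s] unfolding 1 by simp
  show "((\<lambda>t. f (pt s t)) has_real_derivative partial_deriv 2 f (pt s t)) (at t)"
    using *[of 2] DERIV_shift[of "\<lambda>t. f (pt s t)" "partial_deriv 2 f (pt s t)" 0 t] unfolding 1 by simp
qed

section \<open>The metric of the tori\<close>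

lemma bounded_linear_axis: "bounded_linear (\<lambda>x::'a::real_inner. axis i x :: 'a^'n)"
proof (rule bounded_linear_intro[of _ 1])
  show "axis i (x + y) = axis i x + (axis i y :: 'a^'n)" for x y :: 'a
    by (simp add: vec_eq_iff axis_def)
  show "axis i (c *\<^sub>R x) = c *\<^sub>R (axis i x :: 'a^'n)" for c and x :: 'a
    by (simp add: vec_eq_iff axis_def)
  show "norm (axis i x :: 'a^'n) \<le> norm x * 1" for x
    by (simp add: norm_eq_sqrt_inner inner_axis_axis)
qed

lemma has_vector_derivative_vec:
  fixes f :: "real \<Rightarrow> 'a::real_inner^'n"
  assumes "\<And>i. ((\<lambda>t. f t $ i) has_vector_derivative f' $ i) F"
  shows "(f has_vector_derivative f') F"
proof -
  have v: "v = (\<Sum>i\<in>UNIV. axis i (v $ i))" for v :: "'a^'n"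
    by (simp add: vec_eq_iff axis_def sum_component)
  have "((\<lambda>t. \<Sum>i\<in>UNIV. axis i (f t $ i)) has_vector_derivative (\<Sum>i\<in>UNIV. axis i (f' $ i))) F"
    by (intro has_vector_derivative_sum bounded_linear.has_vector_derivative[OF bounded_linear_axis] assms)
  then show ?thesis unfolding v[symmetric] .
qed

lemma has_vector_derivative_vector3:
  fixes a b c :: "real \<Rightarrow> complex"
  assumes "(a has_vector_derivative a') F" "(b has_vector_derivative b') F" "(c has_vector_derivative c') F"
  shows "((\<lambda>x. vector [a x, b x, c x] :: complex^3) has_vector_derivative vector [a', b', c']) F"
proof (rule has_vector_derivative_vec)
  show "((\<lambda>x. (vector [a x, b x, c x] :: complex^3) $ i) has_vector_derivative (vector [a', b', c'] :: complex^3) $ i) F" for i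
    using assms exhaust_3[of i] by auto
qed

lemma inner_vector3:
  fixes a b c a' b' c' :: complex
  shows "(vector [a, b, c] :: complex^3) \<bullet> vector [a', b', c'] = a \<bullet> a' + b \<bullet> b' + c \<bullet> c'"
  by (simp add: inner_vec_def sum_3)

lemma inner_cis [simp]:
  "(complex_of_real a * cis x) \<bullet> (complex_of_real b * cis x) = a * b"
  "(\<i> * complex_of_real a * cis x) \<bullet> (\<i> * complex_of_real b * cis x) = a * b"
  "(\<i> * complex_of_real a * cis x) \<bullet> (complex_of_real b * cis x) = 0"
  "(complex_of_real a * cis x) \<bullet> (\<i> * complex_of_real b * cis x) = 0"
proof -
  have "a * b * (cos x)\<^sup>2 + a * b * (sin x)\<^sup>2 = a * b"
    by (simp flip: distrib_left)
  then show "(complex_of_real a * cis x) \<bullet> (complex_of_real b * cis x) = a * b"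
    "(\<i> * complex_of_real a * cis x) \<bullet> (\<i> * complex_of_real b * cis x) = a * b"
    by (simp_all add: inner_complex_def power2_eq_square algebra_simps)
qed (simp_all add: inner_complex_def algebra_simps)

locale torus =
  fixes m n :: nat
  assumes m0: "0 < m" and mn: "m < n"
begin

definition q :: real where "q = real m / real n"
abbreviation "r \<equiv> T_r m n"
abbreviation "k \<equiv> T_k m n"

lemma q0: "0 < q" and q1: "q < 1"
  using m0 mn by (auto simp: q_def)

lemma mn_q: "real n + real m = real n * (1 + q)" "2 * real n + real m = real n * (2 + q)"
  "real n + 2 * real m = real n * (1 + 2 * q)" "(real n)\<^sup>2 - (real m)\<^sup>2 = (real n)\<^sup>2 * (1 - q\<^sup>2)"
  using mn by (simp_all add: q_def field_simps)

lemma r_sq: "r\<^sup>2 = 1 + 2 * q"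
  using mn by (simp add: T_r_def q_def field_simps)

lemma r_pos: "0 < r"
  using mn by (simp add: T_r_def)

lemma k_sq: "k\<^sup>2 = (1 - q\<^sup>2) / (1 + 2 * q)"
proof -
  have "(real m)\<^sup>2 \<le> (real n)\<^sup>2" using mn by simp
  then have "k\<^sup>2 = ((real n)\<^sup>2 - (real m)\<^sup>2) / (real n * (real n + 2 * real m))"
    by (simp add: T_k_def)
  also have "\<dots> = (1 - q\<^sup>2) / (1 + 2 * q)"
    unfolding mn_q using mn by (simp add: power2_eq_square)
  finally show ?thesis .
qed

lemma rk_sq: "r\<^sup>2 * k\<^sup>2 = 1 - q\<^sup>2"
  using q0 by (simp add: r_sq k_sq)

sublocale modulus k
proof
  have "q\<^sup>2 < 1" using q0 q1 by (simp add: power_less_one_iff abs_square_less_1)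
  then have "0 < k\<^sup>2" using q0 by (simp add: k_sq)
  moreover have "0 \<le> k" unfolding T_k_def using mn by simp
  ultimately show "0 < k" by (cases "k = 0") auto
  have "k\<^sup>2 < 1\<^sup>2" using q0 \<open>q\<^sup>2 < 1\<close> by (simp add: k_sq) (smt (verit) zero_less_power)
  then show "k < 1" by (rule power_less_imp_less_base) simp
qed

text \<open>The quarter period in t: \<open>sn'\<close> rises from 0 to 1 on [0, L], and the second
  lattice vector has t-component 4 L or 2 L.\<close>

definition L :: real where "L = K / r"

lemma L_pos: "0 < L"
  using K_pos r_pos by (simp add: L_def)

lemma r_L: "r * L = K"
  using r_pos by (simp add: L_def)

section \<open>The Jacobi functions in the variable t\<close>

definition sn' :: "real \<Rightarrow> real" where "sn' t = sn (r * t)"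
definition cn' :: "real \<Rightarrow> real" where "cn' t = cn (r * t)"
definition dn' :: "real \<Rightarrow> real" where "dn' t = dn (r * t)"

lemma jacobi'_deriv:
  "(sn' has_real_derivative r * (cn' t * dn' t)) (at t)"
  "(cn' has_real_derivative - (r * (sn' t * dn' t))) (at t)"
  "(dn' has_real_derivative - (r * k\<^sup>2 * (sn' t * cn' t))) (at t)"
proof -
  have d: "((\<lambda>t. r * t) has_real_derivative r) (at t)"
    by (auto intro!: derivative_eq_intros)
  show "(sn' has_real_derivative r * (cn' t * dn' t)) (at t)"
    "(cn' has_real_derivative - (r * (sn' t * dn' t))) (at t)"
    "(dn' has_real_derivative - (r * k\<^sup>2 * (sn' t * cn' t))) (at t)"
    unfolding sn'_def[abs_def] cn'_def[abs_def] dn'_def[abs_def]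
    using DERIV_chain2[OF sn_deriv d] DERIV_chain2[OF cn_deriv d] DERIV_chain2[OF dn_deriv d]
    by (simp_all add: mult_ac)
qed

lemma jacobi'_sq: "(cn' t)\<^sup>2 = 1 - (sn' t)\<^sup>2" "(dn' t)\<^sup>2 = 1 - k\<^sup>2 * (sn' t)\<^sup>2"
  unfolding sn'_def cn'_def dn'_def by (simp_all add: cn_sq dn_sq)

lemma jacobi'_minus: "sn' (- t) = - sn' t" "cn' (- t) = cn' t" "dn' (- t) = dn' t"
  by (simp_all add: sn'_def cn'_def dn'_def)

lemma jacobi'_reflect: "sn' (2 * L - t) = sn' t" "cn' (2 * L - t) = - cn' t" "dn' (2 * L - t) = dn' t"
proof -
  have "r * (2 * L - t) = 2 * K - r * t" by (simp add: right_diff_distrib mult.left_commute[of r] r_L)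
  then show "sn' (2 * L - t) = sn' t" "cn' (2 * L - t) = - cn' t" "dn' (2 * L - t) = dn' t"
    by (simp_all add: sn'_def cn'_def dn'_def jacobi_reflect)
qed

lemma jacobi'_pos:
  assumes "0 < t" "t < L" shows "0 < sn' t" "0 < cn' t" "sn' t < 1"
proof -
  have "0 < r * t" "r * t < K"
    using assms r_pos mult_strict_left_mono[of t L r] by (auto simp: r_L)
  then show "0 < sn' t" "0 < cn' t" "sn' t < 1"
    unfolding sn'_def cn'_def by (auto intro: sn_cn_pos)
qed

lemma dn'_pos: "0 < dn' t"
  by (simp add: dn'_def dn_pos)

lemma jacobi'_at [simp]: "sn' 0 = 0" "cn' 0 = 1" "dn' 0 = 1" "sn' L = 1" "cn' L = 0"
  by (simp_all add: sn'_def cn'_def dn'_def r_L)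

definition \<rho> :: "real \<Rightarrow> real" where
  "\<rho> t = 1 + q - (1 - q\<^sup>2) * (sn' t)\<^sup>2"

lemma rho_bounds: "q + q\<^sup>2 \<le> \<rho> t" "\<rho> t \<le> 1 + q" "0 < \<rho> t"
proof -
  have s: "(sn' t)\<^sup>2 \<le> 1" using jacobi'_sq(1)[of t] zero_le_power2[of "cn' t"] by linarith
  have "0 \<le> 1 - q\<^sup>2" using q0 q1 by (simp add: power_le_one)
  then have "(1 - q\<^sup>2) * (sn' t)\<^sup>2 \<le> (1 - q\<^sup>2) * 1" "0 \<le> (1 - q\<^sup>2) * (sn' t)\<^sup>2"
    using s by (intro mult_left_mono mult_nonneg_nonneg; simp)+
  then show "q + q\<^sup>2 \<le> \<rho> t" "\<rho> t \<le> 1 + q" unfolding \<rho>_def by (auto simp: algebra_simps)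
  then show "0 < \<rho> t" using q0 zero_le_power2[of q] by linarith
qed

lemma rho_continuous: "continuous_on A \<rho>"
  unfolding \<rho>_def[abs_def]
  by (intro continuous_intros continuous_on_has_derivative[OF jacobi'_deriv(1)])

lemma rho_sym: "\<rho> (- t) = \<rho> t" "\<rho> (2 * L - t) = \<rho> t"
  by (simp_all add: \<rho>_def jacobi'_minus jacobi'_reflect)

section \<open>First fundamental form of the immersion and its Laplacian\<close>

abbreviation "u \<equiv> T_map m n"
abbreviation "c1 \<equiv> T_c1 m n"
abbreviation "c2 \<equiv> T_c2 m n"
abbreviation "c3 \<equiv> T_c3 m n"

lemma c_sq: "c1\<^sup>2 = (1 + q) / (2 + q)" "c2\<^sup>2 = (1 + q) / (1 + 2 * q)" "c3\<^sup>2 = 1 / (2 + q)"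
  unfolding T_c1_def T_c2_def T_c3_def mn_q using mn q0 by simp_all

lemma u_pt: "u (pt s t) = vector
    [complex_of_real (c1 * cn' t) * cis s, \<i> * complex_of_real (c2 * sn' t) * cis (q * s),
     complex_of_real (c3 * dn' t) * cis (- (1 + q) * s)]"
  by (simp add: T_map_def Let_def cn'_def sn'_def dn'_def q_def mult_ac)

definition us :: "real \<Rightarrow> real \<Rightarrow> complex^3" where
  "us s t = vector [\<i> * complex_of_real (c1 * cn' t) * cis s, complex_of_real (- (c2 * q * sn' t)) * cis (q * s),
     \<i> * complex_of_real (- (c3 * (1 + q) * dn' t)) * cis (- (1 + q) * s)]"

definition ut :: "real \<Rightarrow> real \<Rightarrow> complex^3" where
  "ut s t = vector [complex_of_real (- (c1 * r * (sn' t * dn' t))) * cis s,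
     \<i> * complex_of_real (c2 * r * (cn' t * dn' t)) * cis (q * s),
     complex_of_real (- (c3 * r * k\<^sup>2 * (sn' t * cn' t))) * cis (- (1 + q) * s)]"

lemma cis_deriv: "((\<lambda>h. cis (a * (s + h))) has_vector_derivative \<i> * complex_of_real a * cis (a * s)) (at 0)"
proof -
  have "((\<lambda>h. a * (s + h)) has_derivative (\<lambda>h. a * h)) (at 0)"
    by (auto intro!: derivative_eq_intros)
  from has_derivative_cis[OF this] show ?thesis
    by (simp add: has_vector_derivative_def scaleR_conv_of_real mult_ac)
qed

lemma has_vector_derivative_real_shift:
  assumes "\<And>t. (f has_real_derivative f' t) (at t)"
  shows "((\<lambda>h. complex_of_real (f (t + h))) has_vector_derivative complex_of_real (f' t)) (at 0)"
proof (rule bounded_linear.has_vector_derivative[OF bounded_linear_of_real])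
  show "((\<lambda>h. f (t + h)) has_vector_derivative f' t) (at 0)"
    using assms[of "0 + t"] DERIV_shift[of f "f' t" 0 t]
    by (simp add: has_real_derivative_iff_has_vector_derivative add.commute)
qed

lemma u_partials: "partial_deriv 1 u (pt s t) = us s t" "partial_deriv 2 u (pt s t) = ut s t"
proof -
  have "((\<lambda>h. u (pt (s + h) t)) has_vector_derivative us s t) (at 0)"
    unfolding u_pt us_def
  proof (rule has_vector_derivative_vector3)
    show "((\<lambda>h. complex_of_real (c1 * cn' t) * cis (s + h)) has_vector_derivative
        \<i> * complex_of_real (c1 * cn' t) * cis s) (at 0)"
      using has_vector_derivative_mult_right[OF cis_deriv[of 1 s], of "complex_of_real (c1 * cn' t)"]
      by (simp add: mult_ac)
    show "((\<lambda>h. \<i> * complex_of_real (c2 * sn' t) * cis (q * (s + h))) has_vector_derivative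
        complex_of_real (- (c2 * q * sn' t)) * cis (q * s)) (at 0)"
      using has_vector_derivative_mult_right[OF cis_deriv[of q s], of "\<i> * complex_of_real (c2 * sn' t)"]
      by (simp add: mult_ac)
    show "((\<lambda>h. complex_of_real (c3 * dn' t) * cis (- (1 + q) * (s + h))) has_vector_derivative
        \<i> * complex_of_real (- (c3 * (1 + q) * dn' t)) * cis (- (1 + q) * s)) (at 0)"
    proof -
      have e: "- (c3 * (1 + q) * dn' t) = c3 * dn' t * (- (1 + q))" by (simp add: algebra_simps)
      show ?thesis
        using has_vector_derivative_mult_right[OF cis_deriv[of "- (1 + q)" s], of "complex_of_real (c3 * dn' t)"]
        unfolding e of_real_mult by (simp only: mult_ac)
    qed
  qed
  moreover have "((\<lambda>h. u (pt s (t + h))) has_vector_derivative ut s t) (at 0)"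
    unfolding u_pt ut_def
  proof (rule has_vector_derivative_vector3)
    have *: "((\<lambda>h. c * complex_of_real (f (t + h)) * d) has_vector_derivative c * complex_of_real (f' t) * d) (at 0)"
      if "\<And>t. (f has_real_derivative f' t) (at t)" for c d f f'
      by (intro has_vector_derivative_mult_left has_vector_derivative_mult_right
          has_vector_derivative_real_shift that)
    show "((\<lambda>h. complex_of_real (c1 * cn' (t + h)) * cis s) has_vector_derivative
        complex_of_real (- (c1 * r * (sn' t * dn' t))) * cis s) (at 0)"
      using *[OF jacobi'_deriv(2), of c1 "cis s"] by (simp add: mult_ac)
    show "((\<lambda>h. \<i> * complex_of_real (c2 * sn' (t + h)) * cis (q * s)) has_vector_derivative
        \<i> * complex_of_real (c2 * r * (cn' t * dn' t)) * cis (q * s)) (at 0)"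
      using *[OF jacobi'_deriv(1), of "\<i> * c2" "cis (q * s)"] by (simp add: mult_ac)
    show "((\<lambda>h. complex_of_real (c3 * dn' (t + h)) * cis (- (1 + q) * s)) has_vector_derivative
        complex_of_real (- (c3 * r * k\<^sup>2 * (sn' t * cn' t))) * cis (- (1 + q) * s)) (at 0)"
      using *[OF jacobi'_deriv(3), of c3 "cis (- (1 + q) * s)"] by (simp add: mult_ac)
  qed
  moreover have "pt s t + h *\<^sub>R axis 1 1 = pt (s + h) t" "pt s t + h *\<^sub>R axis 2 1 = pt s (t + h)" for h
    by (simp_all add: vec_eq_iff forall_2 axis_def)
  ultimately show "partial_deriv 1 u (pt s t) = us s t" "partial_deriv 2 u (pt s t) = ut s t"
    by (auto intro!: partial_deriv_eqI)
qed

text \<open>In each coordinate one derivative is a real and the other an imaginary multiple of the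
  same phase, so they are orthogonal coordinate by coordinate. The squared norms are polynomials in
  \<open>S\<close> = sn^2 with coefficients rational in q; the values of c1, c2, c3, r and k make
  both collapse to \<rho>.\<close>

lemma us_ut: "us s t \<bullet> us s t = \<rho> t" "ut s t \<bullet> ut s t = \<rho> t" "us s t \<bullet> ut s t = 0"
proof -
  define S where "S = (sn' t)\<^sup>2"
  have pos: "1 + 2 * q \<noteq> 0" "2 + q \<noteq> 0" using q0 by auto
  have "us s t \<bullet> us s t = c1\<^sup>2 * (cn' t)\<^sup>2 + c2\<^sup>2 * q\<^sup>2 * (sn' t)\<^sup>2 + c3\<^sup>2 * (1 + q)\<^sup>2 * (dn' t)\<^sup>2"
    unfolding us_def inner_vector3 inner_cis by (simp add: power2_eq_square algebra_simps)
  also have "\<dots> = (1 + q) / (2 + q) * (1 - S) + (1 + q) / (1 + 2 * q) * q\<^sup>2 * S +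
      1 / (2 + q) * (1 + q)\<^sup>2 * (1 - (1 - q\<^sup>2) / (1 + 2 * q) * S)"
    by (simp add: S_def c_sq jacobi'_sq k_sq)
  also have "\<dots> = 1 + q - (1 - q\<^sup>2) * S"
    using pos by (simp add: divide_simps) algebra
  finally show "us s t \<bullet> us s t = \<rho> t" by (simp add: \<rho>_def S_def)
  have "ut s t \<bullet> ut s t = r\<^sup>2 * (c1\<^sup>2 * ((sn' t)\<^sup>2 * (dn' t)\<^sup>2) + c2\<^sup>2 * ((cn' t)\<^sup>2 * (dn' t)\<^sup>2) +
      c3\<^sup>2 * (k\<^sup>2)\<^sup>2 * ((sn' t)\<^sup>2 * (cn' t)\<^sup>2))"
    unfolding ut_def inner_vector3 inner_cis by (simp add: power2_eq_square algebra_simps)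
  also have "\<dots> = (1 + 2 * q) * ((1 + q) / (2 + q) * (S * (1 - (1 - q\<^sup>2) / (1 + 2 * q) * S)) +
      (1 + q) / (1 + 2 * q) * ((1 - S) * (1 - (1 - q\<^sup>2) / (1 + 2 * q) * S)) +
      1 / (2 + q) * ((1 - q\<^sup>2) / (1 + 2 * q))\<^sup>2 * (S * (1 - S)))"
    by (simp add: S_def c_sq jacobi'_sq k_sq r_sq)
  also have "\<dots> = 1 + q - (1 - q\<^sup>2) * S"
    using pos by (simp add: divide_simps) algebra
  finally show "ut s t \<bullet> ut s t = \<rho> t" by (simp add: \<rho>_def S_def)
  show "us s t \<bullet> ut s t = 0"
    unfolding us_def ut_def inner_vector3 inner_cis by simp
qed

lemma induced_metric_u: "induced_metric u z = mat (\<rho> (z $ 2))"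
proof -
  obtain s t where z: "z = pt s t" using pt_nths[of z] by metis
  show ?thesis
    unfolding z induced_metric_def mat_def vec_eq_iff forall_2
    by (simp add: u_partials us_ut inner_commute[of "ut s t"])
qed

text \<open>In dimension two the density sqrt det cancels against the inverse of a conformal metric,
  so the divergence term is the flat one and \<rho> survives only as a denominator.\<close>

lemma laplacian_u:
  "laplacian u f z = - (partial_deriv 1 (partial_deriv 1 f) z + partial_deriv 2 (partial_deriv 2 f) z) / \<rho> (z $ 2)"
proof -
  have inv: "matrix_inv (mat a :: real^2^2) = mat (1 / a)" if "a \<noteq> 0" for a
  proof -
    let ?A = "mat a :: real^2^2"
    have 1: "mat (1 / a) ** mat a = (mat 1 :: real^2^2)" "mat a ** mat (1 / a) = (mat 1 :: real^2^2)"
      using that by (simp_all add: matrix_matrix_mult_def mat_def vec_eq_iff forall_2 sum_2)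
    then have "\<exists>B. ?A ** B = mat 1 \<and> B ** ?A = mat 1" by blast
    then have "?A ** matrix_inv ?A = mat 1"
      unfolding matrix_inv_def by (rule someI2_ex) simp
    then have "mat (1 / a) ** ?A ** matrix_inv ?A = mat (1 / a)"
      by (metis matrix_mul_assoc matrix_mul_rid)
    then show ?thesis by (simp add: 1)
  qed
  have "det (mat a :: real^2^2) = a\<^sup>2" for a
    by (simp add: det_2 mat_def power2_eq_square)
  then have det: "sqrt (det (induced_metric u w)) = \<rho> (w $ 2)" for w
    using rho_bounds(3)[of "w $ 2"] by (simp add: induced_metric_u)
  have eq: "(\<lambda>w. \<Sum>j\<in>UNIV. sqrt (det (induced_metric u w)) * matrix_inv (induced_metric u w) $ i $ j * partial_deriv j f w) =
      partial_deriv i f" for i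
  proof
    fix w :: "real^2"
    have "\<rho> (w $ 2) \<noteq> 0" using rho_bounds(3)[of "w $ 2"] by simp
    then show "(\<Sum>j\<in>UNIV. sqrt (det (induced_metric u w)) * matrix_inv (induced_metric u w) $ i $ j * partial_deriv j f w) =
        partial_deriv i f w"
      unfolding det unfolding induced_metric_u inv[OF \<open>_ \<noteq> 0\<close>] sum_2
      using exhaust_2[of i] by (auto simp: mat_def)
  qed
  show ?thesis
    unfolding laplacian_def eq unfolding det sum_2
    by (simp add: diff_divide_distrib add_divide_distrib)
qed

end

section \<open>Eigenfunctions by separation of variables\<close>

context torus
begin

abbreviation "circ \<equiv> 2 * real n * pi"

definition freq :: "int \<Rightarrow> real" where "freq j = of_int j / real n"

text \<open>The real Fourier basis for period 2 n pi, indexed by all integers: cosines for j \<ge>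
  0, sines for j < 0. A frequency bound therefore becomes a bound on |j|, and counting modes becomes
  counting integers.\<close>

definition tr :: "int \<Rightarrow> real \<Rightarrow> real" where
  "tr j s = (if 0 \<le> j then cos (freq j * s) else sin (freq j * s))"

definition tr' :: "int \<Rightarrow> real \<Rightarrow> real" where
  "tr' j s = (if 0 \<le> j then - freq j * sin (freq j * s) else freq j * cos (freq j * s))"

lemma n_pos: "0 < real n" using mn by simp

lemma tr_deriv: "(tr j has_real_derivative tr' j s) (at s)"
  unfolding tr_def[abs_def] tr'_def
  by (cases "0 \<le> j") (auto intro!: derivative_eq_intros)

lemma tr'_deriv: "(tr' j has_real_derivative - (freq j)\<^sup>2 * tr j s) (at s)"
  unfolding tr'_def[abs_def] tr_def
  by (cases "0 \<le> j") (auto intro!: derivative_eq_intros simp: power2_eq_square)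

lemma trig_shift:
  "cos (x + of_int j * pi) = (if even j then 1 else -1) * cos x"
  "sin (x + of_int j * pi) = (if even j then 1 else -1) * sin x"
proof -
  have "sin (of_int j * pi) = 0" by (simp add: sin_zero_iff_int2)
  moreover have "cos (of_int j * pi) = (if even j then 1 else -1)"
    by (metis cos_npi_int mult.commute)
  ultimately show "cos (x + of_int j * pi) = (if even j then 1 else -1) * cos x"
    "sin (x + of_int j * pi) = (if even j then 1 else -1) * sin x"
    by (simp_all add: cos_add sin_add)
qed

lemma tr_shift: "tr j (s + real n * pi) = (if even j then 1 else -1) * tr j s"
proof -
  have "freq j * (s + real n * pi) = freq j * s + of_int j * pi"
    using n_pos by (simp add: freq_def field_simps)
  then show ?thesis by (simp only: tr_def trig_shift) simp
qed

lemma tr_periodic: "tr j (s + circ) = tr j s"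
proof -
  have "s + circ = (s + real n * pi) + real n * pi" by simp
  then show ?thesis by (simp only: tr_shift) simp
qed

lemma tr'_periodic: "tr' j (s + circ) = tr' j s"
proof -
  have "freq j * (s + circ) = freq j * s + of_int (2 * j) * pi"
    using n_pos by (simp add: freq_def field_simps)
  then show ?thesis by (simp only: tr'_def trig_shift) simp
qed

abbreviation "\<Lambda> \<equiv> T_lattice m n"

lemma basis_pt: "T_basis1 m n = pt (circ) 0"
  "T_basis2 m n = (if even (m * n) then pt 0 (4 * L) else pt (real n * pi) (2 * L))"
  by (simp_all add: T_basis1_def T_basis2_def pt_def L_def)

lemma periodic_of_int:
  fixes f :: "'v::real_vector \<Rightarrow> 'b"
  assumes "\<And>z. f (z + p) = f z"
  shows "f (z + of_int a *\<^sub>R p) = f z"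
proof (induction a arbitrary: z rule: int_induct[where k = 0])
  case (step1 i)
  have "f (z + of_int (i + 1) *\<^sub>R p) = f ((z + of_int i *\<^sub>R p) + p)"
    by (simp add: algebra_simps)
  then show ?case using assms step1 by simp
next
  case (step2 i)
  have "f (z + of_int i *\<^sub>R p) = f ((z + of_int (i - 1) *\<^sub>R p) + p)"
    by (simp add: algebra_simps)
  then show ?case using assms step2 by simp
qed simp

lemma periodic_wrt_lattice:
  "periodic_wrt \<Lambda> f \<longleftrightarrow> (\<forall>z. f (z + T_basis1 m n) = f z) \<and> (\<forall>z. f (z + T_basis2 m n) = f z)"
proof
  assume f: "periodic_wrt \<Lambda> f"
  have "T_basis1 m n = of_int 1 *\<^sub>R T_basis1 m n + of_int 0 *\<^sub>R T_basis2 m n"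
    "T_basis2 m n = of_int 0 *\<^sub>R T_basis1 m n + of_int 1 *\<^sub>R T_basis2 m n" by simp_all
  then have "T_basis1 m n \<in> \<Lambda>" "T_basis2 m n \<in> \<Lambda>" unfolding T_lattice_def by blast+
  then show "(\<forall>z. f (z + T_basis1 m n) = f z) \<and> (\<forall>z. f (z + T_basis2 m n) = f z)"
    using f by (simp add: periodic_wrt_def)
next
  assume f: "(\<forall>z. f (z + T_basis1 m n) = f z) \<and> (\<forall>z. f (z + T_basis2 m n) = f z)"
  show "periodic_wrt \<Lambda> f"
    unfolding periodic_wrt_def T_lattice_def
  proof (safe)
    fix a b z
    have "f (z + (of_int a *\<^sub>R T_basis1 m n + of_int b *\<^sub>R T_basis2 m n)) =
        f ((z + of_int a *\<^sub>R T_basis1 m n) + of_int b *\<^sub>R T_basis2 m n)" by (simp add: add.assoc)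
    then show "f (z + (of_int a *\<^sub>R T_basis1 m n + of_int b *\<^sub>R T_basis2 m n)) = f z"
      using periodic_of_int[of f "T_basis1 m n"] periodic_of_int[of f "T_basis2 m n"] f by simp
  qed
qed

text \<open>\<open>mode a b p \<mu> y\<close>: the function \<open>y\<close> is the \<open>t\<close>-part of an eigenfunction with frequency \<open>p\<close> in
  \<open>s\<close> and eigenvalue \<open>\<mu>\<close>; the flags give its parity with respect to \<open>0\<close> and to \<open>L\<close>.\<close>

definition mode :: "bool \<Rightarrow> bool \<Rightarrow> real \<Rightarrow> real \<Rightarrow> (real \<Rightarrow> real) \<Rightarrow> bool" where
  "mode a b p \<mu> y \<longleftrightarrow> (\<exists>v. (\<forall>t. (y has_real_derivative v t) (at t)) \<and>
     (\<forall>t. (v has_real_derivative (p\<^sup>2 - \<mu> * \<rho> t) * y t) (at t))) \<and>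
     (\<forall>t. y (- t) = parity a * y t) \<and> (\<forall>t. y (2 * L - t) = parity b * y t) \<and> (\<exists>t. y t \<noteq> 0)"

text \<open>The reflections in 0 and in \<open>L\<close> compose to the translation by 2 L, whose
  sign is the product of the two parities.\<close>

lemma mode_shift:
  assumes "mode a b p \<mu> y"
  shows "y (t + 2 * L) = parity a * parity b * y t" "y (t + 4 * L) = y t"
proof -
  have y: "y (- t) = parity a * y t" "y (2 * L - t) = parity b * y t" for t
    using assms by (auto simp: mode_def)
  show *: "y (t + 2 * L) = parity a * parity b * y t" for t
    using y(2)[of "- t"] y(1)[of t] by (simp add: add.commute mult_ac)
  show "y (t + 4 * L) = y t"
  proof -
    have "t + 4 * L = (t + 2 * L) + 2 * L" by simp
    then show ?thesis by (simp only: *) (simp add: parity_def)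
  qed
qed

lemma eigenfunction:
  assumes y: "mode a b (freq j) \<mu> y" and par: "odd (m * n) \<Longrightarrow> even j \<longleftrightarrow> a = b"
  shows "(\<lambda>z. tr j (z $ 1) * y (z $ 2)) \<in> eigenspace u \<Lambda> \<mu>"
proof -
  let ?f = "\<lambda>z::real^2. tr j (z $ 1) * y (z $ 2)"
  obtain v where dy: "\<And>t. (y has_real_derivative v t) (at t)"
    and dv: "\<And>t. (v has_real_derivative ((freq j)\<^sup>2 - \<mu> * \<rho> t) * y t) (at t)"
    using y by (auto simp: mode_def)
  \<comment> \<open>These functions generate an algebra closed under differentiation: the derivative
    of \<open>v\<close> involves \<rho>, a polynomial in \<open>sn'\<close>, and \<open>sn'\<close>
    brings in \<open>cn'\<close> and \<open>dn'\<close>.\<close>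
  define G where "G = {\<lambda>z::real^2. tr j (z $ 1), \<lambda>z. tr' j (z $ 1), \<lambda>z. sn' (z $ 2), \<lambda>z. cn' (z $ 2),
    \<lambda>z. dn' (z $ 2), \<lambda>z. y (z $ 2), \<lambda>z. v (z $ 2)}"
  let ?A = "generated_algebra G"
  have gen: "(\<lambda>z. tr j (z $ 1)) \<in> ?A" "(\<lambda>z. tr' j (z $ 1)) \<in> ?A"
    "(\<lambda>z. sn' (z $ 2)) \<in> ?A" "(\<lambda>z. cn' (z $ 2)) \<in> ?A"
    "(\<lambda>z. dn' (z $ 2)) \<in> ?A" "(\<lambda>z. y (z $ 2)) \<in> ?A"
    "(\<lambda>z. v (z $ 2)) \<in> ?A"
    by (auto intro!: generated_algebra.gen simp: G_def)
  have cst: "(\<lambda>_. c) \<in> ?A" for c by (rule generated_algebra.const)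
  have scal: "(\<lambda>z. c * f z) \<in> ?A" if "f \<in> ?A" for c f
    by (rule generated_algebra.mult[OF cst that])
  have mul: "(\<lambda>z. f z * g z) \<in> ?A"
    if "f \<in> ?A" "g \<in> ?A" for f g
    by (rule generated_algebra.mult[OF that])
  have "(\<lambda>z. ((freq j)\<^sup>2 + - (\<mu> * (1 + q))) + \<mu> * (1 - q\<^sup>2) * (sn' (z $ 2) * sn' (z $ 2))) \<in> ?A"
    by (intro generated_algebra.add[OF cst] scal mul gen)
  then have coeff: "(\<lambda>z. (freq j)\<^sup>2 - \<mu> * \<rho> (z $ 2)) \<in> ?A"
    by (rule back_subst[of "\<lambda>f. f \<in> _"]) (simp add: \<rho>_def fun_eq_iff power2_eq_square algebra_simps)
  have D: "\<exists>d1\<in>?A. \<exists>d2\<in>?A. has_partials g d1 d2" if "g \<in> G" for g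
  proof -
    have 1: ?thesis if "g = (\<lambda>z. \<phi> (z $ 1))" "\<And>t. (\<phi> has_real_derivative \<psi> t) (at t)"
      "(\<lambda>z. \<psi> (z $ 1)) \<in> ?A" for \<phi> \<psi>
      using has_partials_coordinate(1)[OF that(2)] that(1,3) cst by blast
    have 2: ?thesis if "g = (\<lambda>z. \<phi> (z $ 2))" "\<And>t. (\<phi> has_real_derivative \<psi> t) (at t)"
      "(\<lambda>z. \<psi> (z $ 2)) \<in> ?A" for \<phi> \<psi>
      using has_partials_coordinate(2)[OF that(2)] that(1,3) cst by blast
    have m: "(\<lambda>z. - f z) \<in> ?A" if "f \<in> ?A" for f
      using scal[OF that, of "-1"] by simp
    consider (t1) "g = (\<lambda>z. tr j (z $ 1))" | (t2) "g = (\<lambda>z. tr' j (z $ 1))" | (s1) "g = (\<lambda>z. sn' (z $ 2))"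
      | (s2) "g = (\<lambda>z. cn' (z $ 2))" | (s3) "g = (\<lambda>z. dn' (z $ 2))" | (y) "g = (\<lambda>z. y (z $ 2))"
      | (v) "g = (\<lambda>z. v (z $ 2))"
      using \<open>g \<in> G\<close> by (auto simp: G_def)
    then show ?thesis
    proof cases
      case t1
      show ?thesis by (rule 1[OF t1 tr_deriv]) (intro scal m mul gen coeff)
    next
      case t2
      show ?thesis by (rule 1[OF t2 tr'_deriv]) (intro scal m mul gen coeff)
    next
      case s1
      show ?thesis by (rule 2[OF s1 jacobi'_deriv(1)]) (intro scal m mul gen coeff)
    next
      case s2
      show ?thesis by (rule 2[OF s2 jacobi'_deriv(2)]) (intro scal m mul gen coeff)
    next
      case s3
      show ?thesis by (rule 2[OF s3 jacobi'_deriv(3)]) (intro scal m mul gen coeff)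
    next
      case y
      show ?thesis by (rule 2[OF y dy]) (intro scal m mul gen coeff)
    next
      case v
      show ?thesis by (rule 2[OF v dv]) (intro scal m mul gen coeff)
    qed
  qed
  have smooth: "smooth ?f"
    by (rule smooth_generated_algebra[OF D], assumption) (intro mul gen)
  have p: "has_partials ?f (\<lambda>z. tr' j (z $ 1) * y (z $ 2)) (\<lambda>z. tr j (z $ 1) * v (z $ 2))"
    using has_partials_mult[OF has_partials_coordinate(1)[OF tr_deriv] has_partials_coordinate(2)[OF dy]] by simp
  have p1: "has_partials (\<lambda>z. tr' j (z $ 1) * y (z $ 2)) (\<lambda>z. - (freq j)\<^sup>2 * tr j (z $ 1) * y (z $ 2))
      (\<lambda>z. tr' j (z $ 1) * v (z $ 2))"
    using has_partials_mult[OF has_partials_coordinate(1)[OF tr'_deriv] has_partials_coordinate(2)[OF dy]] by simp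
  have p2: "has_partials (\<lambda>z. tr j (z $ 1) * v (z $ 2)) (\<lambda>z. tr' j (z $ 1) * v (z $ 2))
      (\<lambda>z. tr j (z $ 1) * (((freq j)\<^sup>2 - \<mu> * \<rho> (z $ 2)) * y (z $ 2)))"
    using has_partials_mult[OF has_partials_coordinate(1)[OF tr_deriv] has_partials_coordinate(2)[OF dv]] by simp
  have "laplacian u ?f z = \<mu> * ?f z" for z
  proof -
    have "\<rho> (z $ 2) \<noteq> 0" using rho_bounds(3)[of "z $ 2"] by simp
    then show ?thesis
      unfolding laplacian_u has_partials_D(1,2)[OF p] has_partials_D(1,2)[OF p1] has_partials_D(1,2)[OF p2]
      by (simp add: field_simps)
  qed
  moreover have "periodic_wrt \<Lambda> ?f"
    unfolding periodic_wrt_lattice basis_pt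
    using par mode_shift[OF y] by (auto simp: tr_periodic tr_shift parity_def)
  ultimately show ?thesis
    using smooth by (simp add: eigenspace_def)
qed

text \<open>At p = p0 the given \<phi> itself serves, below p0 it is \<open>shooting\<close>. The
  Neumann problem with p = 0, excluded there, is served by the constant function with eigenvalue 0;
  this is why \<mu> > 0 is asserted only if a Dirichlet condition is present.\<close>

lemma ground_state:
  assumes \<phi>: "\<And>t. (\<phi> has_real_derivative \<psi> t) (at t)"
    and \<psi>: "\<And>t. (\<psi> has_real_derivative (p0\<^sup>2 - \<mu>0 * \<rho> t) * \<phi> t) (at t)"
    and pos: "\<And>t. 0 < t \<Longrightarrow> t < L \<Longrightarrow> 0 < \<phi> t"
    and bc0: "if a then \<psi> 0 = 0 else \<phi> 0 = 0" and bcL: "if b then \<psi> L = 0 else \<phi> L = 0"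
    and \<mu>0: "0 < \<mu>0" and p: "0 \<le> p" "p \<le> p0"
  shows "\<exists>\<mu> y. mode a b p \<mu> y \<and> 0 \<le> \<mu> \<and> \<mu> \<le> \<mu>0 \<and> (p < p0 \<longrightarrow> \<mu> < \<mu>0) \<and> (\<not> (a \<and> b) \<longrightarrow> 0 < \<mu>)"
proof -
  have rb: "\<bar>\<rho> t\<bar> \<le> 1 + q" for t using rho_bounds[of t] by simp
  consider "p = p0" | "p < p0" "a \<and> b \<and> p = 0" | "p < p0" "\<not> (a \<and> b \<and> p = 0)"
    using p by fastforce
  then show ?thesis
  proof cases
    case 1
    have B: "\<bar>p0\<^sup>2 - \<mu>0 * \<rho> t\<bar> \<le> p0\<^sup>2 + \<mu>0 * (1 + q)" for t
    proof -
      have "\<bar>\<mu>0 * \<rho> t\<bar> \<le> \<mu>0 * (1 + q)"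
        unfolding abs_mult using rb[of t] \<mu>0 by (intro mult_mono) auto
      then show ?thesis using zero_le_power2[of p0] by linarith
    qed
    have "\<phi> (2 * 0 - t) = parity a * \<phi> t" for t
      by (rule linear_ode_reflect[OF \<phi> \<psi> B]) (use bc0 rho_sym in \<open>cases a; simp add: parity_def\<close>)+
    moreover have "\<phi> (2 * L - t) = parity b * \<phi> t" for t
      by (rule linear_ode_reflect[OF \<phi> \<psi> B]) (use bcL rho_sym in \<open>cases b; simp add: parity_def\<close>)+
    moreover have "\<phi> (L / 2) \<noteq> 0" using pos[of "L / 2"] L_pos by simp
    ultimately have "mode a b p \<mu>0 \<phi>"
      unfolding mode_def 1 using \<phi> \<psi> by auto
    then show ?thesis using \<mu>0 1 by (intro exI[of _ \<mu>0] exI[of _ \<phi>]) auto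
  next
    case 2
    have "mode a b p 0 (\<lambda>_. 1)"
      unfolding mode_def using 2 by (auto simp: parity_def intro!: exI[of _ "\<lambda>_. 0"])
    then show ?thesis using 2 \<mu>0 by (intro exI[of _ 0] exI[of _ "\<lambda>_. 1"]) auto
  next
    case 3
    obtain \<mu> y v where "0 < \<mu>" "\<mu> < \<mu>0" "\<And>t. (y has_real_derivative v t) (at t)"
      "\<And>t. (v has_real_derivative (p\<^sup>2 - \<mu> * \<rho> t) * y t) (at t)"
      "\<And>t. y (- t) = parity a * y t" "\<And>t. y (2 * L - t) = parity b * y t" "\<exists>t. y t \<noteq> 0"
      using shooting[OF rho_continuous rb L_pos rho_sym \<phi> \<psi> pos bc0 bcL p(1) 3(1) \<mu>0 3(2)] by blast
    then show ?thesis unfolding mode_def by (intro exI[of _ \<mu>] exI[of _ y]) auto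
  qed
qed

section \<open>Explicit solutions of Lame's equation\<close>

lemma dn'_deriv2:
  "((\<lambda>t. - (r * k\<^sup>2 * (sn' t * cn' t))) has_real_derivative ((1 + q)\<^sup>2 - 2 * \<rho> t) * dn' t) (at t)"
  apply (rule DERIV_cong)
   apply (rule DERIV_minus DERIV_cmult DERIV_mult jacobi'_deriv)+
  using jacobi'_sq[of t] r_sq rk_sq unfolding \<rho>_def by algebra

text \<open>The functions \<open>dn'\<close>, \<open>cn'\<close>, \<open>sn'\<close> with
  frequencies 1 + q, 1, q are the t-parts of the coordinates of the immersion; the coordinates of a
  minimal surface in the unit sphere are eigenfunctions for 2.\<close>

lemma lame1:
  "\<lbrakk>0 \<le> p; p \<le> 1 + q\<rbrakk> \<Longrightarrow> \<exists>\<mu> y. mode True True p \<mu> y \<and> 0 \<le> \<mu> \<and> \<mu> \<le> 2"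
  "\<lbrakk>0 \<le> p; p \<le> 1\<rbrakk> \<Longrightarrow> \<exists>\<mu> y. mode True False p \<mu> y \<and> 0 \<le> \<mu> \<and> \<mu> \<le> 2"
  "\<lbrakk>0 \<le> p; p \<le> q\<rbrakk> \<Longrightarrow> \<exists>\<mu> y. mode False True p \<mu> y \<and> 0 \<le> \<mu> \<and> \<mu> \<le> 2"
proof -
  show "\<exists>\<mu> y. mode True True p \<mu> y \<and> 0 \<le> \<mu> \<and> \<mu> \<le> 2" if "0 \<le> p" "p \<le> 1 + q"
    using ground_state[OF jacobi'_deriv(3) dn'_deriv2, where a = True and b = True and p = p] that dn'_pos by auto
  have cn: "((\<lambda>t. - (r * (sn' t * dn' t))) has_real_derivative (1\<^sup>2 - 2 * \<rho> t) * cn' t) (at t)" for t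
    apply (rule DERIV_cong)
     apply (rule DERIV_minus DERIV_cmult DERIV_mult jacobi'_deriv)+
    using jacobi'_sq[of t] r_sq rk_sq unfolding \<rho>_def power_one by algebra
  show "\<exists>\<mu> y. mode True False p \<mu> y \<and> 0 \<le> \<mu> \<and> \<mu> \<le> 2" if "0 \<le> p" "p \<le> 1"
    using ground_state[OF jacobi'_deriv(2) cn, where a = True and b = False and p = p] that jacobi'_pos by auto
  have sn: "((\<lambda>t. r * (cn' t * dn' t)) has_real_derivative (q\<^sup>2 - 2 * \<rho> t) * sn' t) (at t)" for t
    apply (rule DERIV_cong)
     apply (rule DERIV_minus DERIV_cmult DERIV_mult jacobi'_deriv)+
    using jacobi'_sq[of t] r_sq rk_sq unfolding \<rho>_def by algebra
  show "\<exists>\<mu> y. mode False True p \<mu> y \<and> 0 \<le> \<mu> \<and> \<mu> \<le> 2" if "0 \<le> p" "p \<le> q"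
    using ground_state[OF jacobi'_deriv(1) sn, where a = False and b = True and p = p] that jacobi'_pos by auto
qed

text \<open>For the class even at both ends \<open>lame1\<close> does not exclude \<mu> = 0. The
  count in the open interval (0, 6) needs a positive eigenvalue in this class, and at p = 1 + q it
  is exactly 2.\<close>

lemma lame1_dn: "\<exists>y. mode True True (1 + q) 2 y"
proof -
  have "\<exists>t. dn' t \<noteq> 0" using dn'_pos[of 0] by (intro exI[of _ 0]) simp
  then have "mode True True (1 + q) 2 dn'"
    unfolding mode_def using jacobi'_deriv(3) dn'_deriv2 jacobi'_minus(3) jacobi'_reflect(3)
    by (auto simp: parity_def intro!: exI[of _ "\<lambda>t. - (r * k\<^sup>2 * (sn' t * cn' t))"])
  then show ?thesis by blast
qed

text \<open>The products cn dn, sn dn, sn cn with frequencies 2 + q, 1 + 2 q, 1 - q are the t-parts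
  of the products of one coordinate of the immersion with the conjugate of another. Each of them
  contains \<open>cn'\<close> or \<open>sn'\<close> and so satisfies a Dirichlet condition, which
  makes \<mu> positive.\<close>

lemma lame2:
  "\<lbrakk>0 \<le> p; p \<le> 2 + q\<rbrakk> \<Longrightarrow> \<exists>\<mu> y. mode True False p \<mu> y \<and> 0 < \<mu> \<and> \<mu> \<le> 6 \<and> (p < 2 + q \<longrightarrow> \<mu> < 6)"
  "\<lbrakk>0 \<le> p; p \<le> 1 + 2 * q\<rbrakk> \<Longrightarrow> \<exists>\<mu> y. mode False True p \<mu> y \<and> 0 < \<mu> \<and> \<mu> \<le> 6 \<and> (p < 1 + 2 * q \<longrightarrow> \<mu> < 6)"
  "\<lbrakk>0 \<le> p; p \<le> 1 - q\<rbrakk> \<Longrightarrow> \<exists>\<mu> y. mode False False p \<mu> y \<and> 0 < \<mu> \<and> \<mu> \<le> 6 \<and> (p < 1 - q \<longrightarrow> \<mu> < 6)"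
proof -
  let ?cd = "\<lambda>t. cn' t * dn' t" and ?sd = "\<lambda>t. sn' t * dn' t" and ?sc = "\<lambda>t. sn' t * cn' t"
  let ?cd' = "\<lambda>t. - r * (sn' t * (dn' t)\<^sup>2 + k\<^sup>2 * sn' t * (cn' t)\<^sup>2)"
  let ?sd' = "\<lambda>t. r * (cn' t * (dn' t)\<^sup>2 - k\<^sup>2 * (sn' t)\<^sup>2 * cn' t)"
  let ?sc' = "\<lambda>t. r * dn' t * ((cn' t)\<^sup>2 - (sn' t)\<^sup>2)"
  have d: "(?cd has_real_derivative ?cd' t) (at t)" "(?sd has_real_derivative ?sd' t) (at t)"
    "(?sc has_real_derivative ?sc' t) (at t)" for t
    by (auto intro!: derivative_eq_intros jacobi'_deriv simp: power2_eq_square algebra_simps)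
  have cd: "(?cd' has_real_derivative ((2 + q)\<^sup>2 - 6 * \<rho> t) * ?cd t) (at t)" for t
    apply (rule derivative_eq_intros jacobi'_deriv refl)+
    using jacobi'_sq[of t] r_sq rk_sq unfolding \<rho>_def by simp algebra
  have sd: "(?sd' has_real_derivative ((1 + 2 * q)\<^sup>2 - 6 * \<rho> t) * ?sd t) (at t)" for t
    apply (rule derivative_eq_intros jacobi'_deriv refl)+
    using jacobi'_sq[of t] r_sq rk_sq unfolding \<rho>_def by simp algebra
  have sc: "(?sc' has_real_derivative ((1 - q)\<^sup>2 - 6 * \<rho> t) * ?sc t) (at t)" for t
    apply (rule derivative_eq_intros jacobi'_deriv refl)+
    using jacobi'_sq[of t] r_sq rk_sq unfolding \<rho>_def by simp algebra
  show "\<exists>\<mu> y. mode True False p \<mu> y \<and> 0 < \<mu> \<and> \<mu> \<le> 6 \<and> (p < 2 + q \<longrightarrow> \<mu> < 6)" if "0 \<le> p" "p \<le> 2 + q"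
    using ground_state[OF d(1) cd, where a = True and b = False and p = p] that jacobi'_pos dn'_pos by auto
  show "\<exists>\<mu> y. mode False True p \<mu> y \<and> 0 < \<mu> \<and> \<mu> \<le> 6 \<and> (p < 1 + 2 * q \<longrightarrow> \<mu> < 6)" if "0 \<le> p" "p \<le> 1 + 2 * q"
    using ground_state[OF d(2) sd, where a = False and b = True and p = p] that jacobi'_pos dn'_pos by auto
  show "\<exists>\<mu> y. mode False False p \<mu> y \<and> 0 < \<mu> \<and> \<mu> \<le> 6 \<and> (p < 1 - q \<longrightarrow> \<mu> < 6)" if "0 \<le> p" "p \<le> 1 - q"
    using ground_state[OF d(3) sc, where a = False and b = False and p = p] that jacobi'_pos by auto
qed

end

section \<open>Bounds for eigenvalue counts\<close>

lemma sum_fun_apply: "(\<Sum>x\<in>A. g x) z = (\<Sum>x\<in>A. (g x z :: real))"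
  by (induction A rule: infinite_finite_induct) (simp_all add: plus_fun_def zero_fun_def)

text \<open>Passes from coefficients of an indexed family to the set of its values. Injectivity is
  included because it is needed to count that set by its indices.\<close>

lemma realfun_independentI:
  fixes f :: "'x \<Rightarrow> 'a \<Rightarrow> real"
  assumes X: "finite X" and indep: "\<And>c. (\<And>z. (\<Sum>x\<in>X. c x * f x z) = 0) \<Longrightarrow> \<forall>x\<in>X. c x = 0"
  shows "inj_on f X" "realfun.independent (f ` X)"
proof -
  show inj: "inj_on f X"
  proof (rule inj_onI, rule ccontr)
    fix x y assume xy: "x \<in> X" "y \<in> X" "f x = f y" "x \<noteq> y"
    let ?c = "\<lambda>w. if w = x then 1 else if w = y then -1 else 0 :: real"
    have "(\<Sum>w\<in>X. ?c w * f w z) = (\<Sum>w\<in>{x, y}. ?c w * f w z)" for z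
      by (rule sum.mono_neutral_right) (use X xy in auto)
    then have "(\<Sum>w\<in>X. ?c w * f w z) = 0" for z
      using xy by simp
    from indep[OF this] xy show False by auto
  qed
  show "realfun.independent (f ` X)"
  proof
    assume "realfun.dependent (f ` X)"
    then obtain t w where t: "t \<subseteq> f ` X" "(\<Sum>v\<in>t. (\<lambda>z. w v * v z)) = 0" "\<exists>v\<in>t. w v \<noteq> 0"
      unfolding realfun.dependent_explicit by blast
    let ?c = "\<lambda>x. if f x \<in> t then w (f x) else 0"
    have "(\<Sum>x\<in>X. ?c x * f x z) = 0" for z
    proof -
      have "(\<Sum>x\<in>X. ?c x * f x z) = (\<Sum>v\<in>f ` X. (if v \<in> t then w v else 0) * v z)"
        by (simp add: sum.reindex[OF inj])
      also have "\<dots> = (\<Sum>v\<in>t. w v * v z)"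
        by (rule sum.mono_neutral_cong_right) (use X t in auto)
      also have "\<dots> = (\<Sum>v\<in>t. (\<lambda>z. w v * v z)) z" by (simp add: sum_fun_apply)
      finally show ?thesis using t(2) by simp
    qed
    then have "\<forall>x\<in>X. ?c x = 0" by (rule indep)
    then show False using t by fastforce
  qed
qed

lemma multiplicity_ge:
  assumes S: "S \<subseteq> eigenspace u L \<mu>" "realfun.independent S"
  shows "enat (card S) \<le> multiplicity_of u L \<mu>"
proof (cases "\<exists>B. finite B \<and> eigenspace u L \<mu> \<subseteq> realfun.span B")
  case True
  then obtain B where B: "finite B" "eigenspace u L \<mu> \<subseteq> realfun.span B" by blast
  obtain T where T: "S \<subseteq> T" "T \<subseteq> eigenspace u L \<mu>" "realfun.independent T" "eigenspace u L \<mu> \<subseteq> realfun.span T"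
    using realfun.maximal_independent_subset_extend[OF S] by blast
  have "finite T" using realfun.independent_span_bound[OF B(1) T(3)] T(2) B(2) by blast
  then have "card S \<le> card T" using T(1) by (rule card_mono)
  also have "card T = realfun.dim (eigenspace u L \<mu>)"
    by (rule realfun.basis_card_eq_dim[OF T(2,4,3)])
  finally show ?thesis using True by (simp add: multiplicity_of_def)
next
  case False
  then have "multiplicity_of u L \<mu> = \<infinity>" unfolding multiplicity_of_def by (rule if_not_P)
  then show ?thesis by simp
qed

text \<open>Joint independence is required of the whole family, so the eigenvalues may coincide in
  any way: grouping the indices by \<open>\<mu>\<close> gives an independent set in each eigenspace
  that occurs.\<close>

lemma eigenvalue_count_ge:
  fixes f :: "'x \<Rightarrow> real^2 \<Rightarrow> real"
  assumes X: "finite X" and f: "\<And>x. x \<in> X \<Longrightarrow> f x \<in> eigenspace u L (\<mu> x)" "\<And>x. x \<in> X \<Longrightarrow> \<mu> x \<in> I"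
    and indep: "\<And>c. (\<And>z. (\<Sum>x\<in>X. c x * f x z) = 0) \<Longrightarrow> \<forall>x\<in>X. c x = 0"
  shows "ereal (real (card X)) \<le> eigenvalue_count u L I"
proof -
  have mult: "enat (card {x \<in> X. \<mu> x = \<nu>}) \<le> multiplicity_of u L \<nu>" for \<nu>
  proof -
    let ?X = "{x \<in> X. \<mu> x = \<nu>}"
    note ind = realfun_independentI[of X f, OF X indep]
    have sub: "f ` ?X \<subseteq> eigenspace u L \<nu>" using f by auto
    have "realfun.independent (f ` ?X)"
      by (rule realfun.independent_mono[OF ind(2)]) auto
    note mge = multiplicity_ge[OF sub this]
    have "card ?X = card (f ` ?X)"
      by (rule card_image[symmetric]) (rule inj_on_subset[OF ind(1)], auto)
    also have "enat \<dots> \<le> multiplicity_of u L \<nu>"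
      by (rule mge)
    finally show ?thesis .
  qed
  have "enat (card X) = enat (\<Sum>\<nu>\<in>\<mu> ` X. card {x \<in> X. \<mu> x = \<nu>})"
    using sum.group[OF X finite_imageI[OF X], of \<mu> \<mu> "\<lambda>_. 1::nat"] by simp
  also have "\<dots> = (\<Sum>\<nu>\<in>\<mu> ` X. enat (card {x \<in> X. \<mu> x = \<nu>}))"
    by (simp add: of_nat_eq_enat[symmetric] del: of_nat_eq_enat)
  also have "\<dots> \<le> (\<Sum>\<nu>\<in>\<mu> ` X. multiplicity_of u L \<nu>)"
    by (intro sum_mono mult)
  also have "\<dots> \<le> (SUP F\<in>{F. finite F \<and> F \<subseteq> I}. \<Sum>\<nu>\<in>F. multiplicity_of u L \<nu>)"
    by (rule SUP_upper) (use X f in auto)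
  finally have le: "enat (card X) \<le> (SUP F\<in>{F. finite F \<and> F \<subseteq> I}. \<Sum>\<nu>\<in>F. multiplicity_of u L \<nu>)" .
  have "ereal (real (card X)) = ereal_of_enat (enat (card X))" by simp
  then show ?thesis
    unfolding eigenvalue_count_def using le by (simp only: ereal_of_enat_le_iff)
qed

text \<open>For a single eigenvalue the hypothesis forbids N + 1 independent eigenfunctions, so each
  multiplicity is finite and equals the size of a basis. For bases over a finite set of eigenvalues
  it bounds each partial sum of multiplicities.\<close>

lemma eigenvalue_count_le:
  assumes bound: "\<And>F B. finite F \<Longrightarrow> F \<subseteq> I \<Longrightarrow>
      (\<And>\<mu>. \<mu> \<in> F \<Longrightarrow> finite (B \<mu>) \<and> B \<mu> \<subseteq> eigenspace u L \<mu> \<and> realfun.independent (B \<mu>)) \<Longrightarrow>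
      (\<Sum>\<mu>\<in>F. card (B \<mu>)) \<le> N"
  shows "eigenvalue_count u L I \<le> ereal (real N)"
proof -
  have fin: "\<exists>B. finite B \<and> B \<subseteq> eigenspace u L \<mu> \<and> realfun.independent B \<and> multiplicity_of u L \<mu> = enat (card B)"
    if \<mu>: "\<mu> \<in> I" for \<mu>
  proof -
    obtain B where B: "B \<subseteq> eigenspace u L \<mu>" "realfun.independent B" "eigenspace u L \<mu> \<subseteq> realfun.span B"
      using realfun.maximal_independent_subset by blast
    have "finite B"
    proof (rule ccontr)
      assume "infinite B"
      then obtain T where T: "T \<subseteq> B" "finite T" "card T = Suc N"
        using infinite_arbitrarily_large by blast
      have "realfun.independent T" by (rule realfun.independent_mono[OF B(2) T(1)])
      then have "(\<Sum>\<mu>\<in>{\<mu>}. card T) \<le> N"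
        by (intro bound) (use T B \<mu> in auto)
      then show False using T by simp
    qed
    moreover have "multiplicity_of u L \<mu> = enat (card B)"
      using \<open>finite B\<close> B realfun.basis_card_eq_dim[OF B(1,3,2)] by (auto simp: multiplicity_of_def)
    ultimately show ?thesis using B by blast
  qed
  have "(SUP F\<in>{F. finite F \<and> F \<subseteq> I}. \<Sum>\<mu>\<in>F. multiplicity_of u L \<mu>) \<le> enat N"
  proof (rule SUP_least)
    fix F assume "F \<in> {F. finite F \<and> F \<subseteq> I}"
    then have F: "finite F" "F \<subseteq> I" by auto
    have "\<forall>\<mu>\<in>F. \<exists>B. finite B \<and> B \<subseteq> eigenspace u L \<mu> \<and> realfun.independent B \<and> multiplicity_of u L \<mu> = enat (card B)"
      using fin F by blast
    then obtain B where B: "\<forall>\<mu>\<in>F. finite (B \<mu>) \<and> B \<mu> \<subseteq> eigenspace u L \<mu> \<and> realfun.independent (B \<mu>) \<and>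
        multiplicity_of u L \<mu> = enat (card (B \<mu>))"
      by (rule bchoice[THEN exE])
    have "(\<Sum>\<mu>\<in>F. multiplicity_of u L \<mu>) = (\<Sum>\<mu>\<in>F. enat (card (B \<mu>)))"
      using B by (intro sum.cong) auto
    also have "\<dots> = enat (\<Sum>\<mu>\<in>F. card (B \<mu>))"
      by (simp add: of_nat_eq_enat[symmetric] del: of_nat_eq_enat)
    also have "\<dots> \<le> enat N"
      using bound[OF F, of B] B by simp
    finally show "(\<Sum>\<mu>\<in>F. multiplicity_of u L \<mu>) \<le> enat N" .
  qed
  then have "eigenvalue_count u L I \<le> ereal_of_enat (enat N)"
    unfolding eigenvalue_count_def by (subst ereal_of_enat_le_iff)
  then show ?thesis by simp
qed

text \<open>N homogeneous equations in more than N unknowns. The columns, continued by 0, lie in the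
  span of N unit functions, so they cannot be independent.\<close>

lemma nontrivial_kernel:
  fixes a :: "nat \<Rightarrow> 'x \<Rightarrow> real"
  assumes X: "finite X" and N: "N < card X"
  obtains c where "\<And>i. i < N \<Longrightarrow> (\<Sum>x\<in>X. c x * a i x) = 0" "\<exists>x\<in>X. c x \<noteq> 0"
proof (rule ccontr)
  assume contr: "\<not> thesis"
  note nontriv = that
  define w where "w x i = (if i < N then a i x else 0)" for x i
  have indep: "\<forall>x\<in>X. c x = 0" if "\<And>i. (\<Sum>x\<in>X. c x * w x i) = 0" for c
  proof (rule ccontr)
    assume "\<not> (\<forall>x\<in>X. c x = 0)"
    moreover have "(\<Sum>x\<in>X. c x * a i x) = 0" if "i < N" for i
      using \<open>\<And>i. (\<Sum>x\<in>X. c x * w x i) = 0\<close>[of i] that by (simp add: w_def)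
    ultimately show False using nontriv[of c] contr by blast
  qed
  note ind = realfun_independentI[of X w, OF X indep]
  let ?e = "\<lambda>l i::nat. if i = l then 1 else 0 :: real"
  have "w x \<in> realfun.span (?e ` {..<N})" for x
  proof -
    have "w x = (\<Sum>l<N. (\<lambda>i. a l x * ?e l i))"
      by (rule ext) (simp add: w_def sum_fun_apply if_distrib[of "(*) _"] cong: if_cong)
    also have "\<dots> \<in> realfun.span (?e ` {..<N})"
      by (intro realfun.span_sum realfun.span_scale realfun.span_base) auto
    finally show ?thesis .
  qed
  then have "card (w ` X) \<le> card (?e ` {..<N})"
    using realfun.independent_span_bound[OF _ ind(2), of "?e ` {..<N}"] by auto
  also have "\<dots> \<le> N" using card_image_le[of "{..<N}" ?e] by simp
  finally show False using card_image[OF ind(1)] N by simp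
qed

section \<open>Counting modes\<close>

context torus
begin

lemma tr_orthogonal:
  "i \<noteq> j \<Longrightarrow> ((\<lambda>s. tr i s * tr j s) has_integral 0) {0..circ}"
  "0 < integral {0..circ} (\<lambda>s. tr j s * tr j s)"
proof -
  have P: "0 < circ" using n_pos by simp
  have cont: "continuous_on A (tr j)" for j A
    by (rule continuous_on_has_derivative[OF tr_deriv])
  show "((\<lambda>s. tr i s * tr j s) has_integral 0) {0..circ}" if "i \<noteq> j"
  proof (cases "i = - j")
    case False
    then have ne: "(freq j)\<^sup>2 - (freq i)\<^sup>2 \<noteq> 0"
      using that n_pos by (simp add: freq_def power_divide power2_eq_iff field_simps flip: of_int_power)
    have "((\<lambda>s. ((freq j)\<^sup>2 - (freq i)\<^sup>2) * (tr i s * tr j s)) has_integral 0) {0..circ}"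
    proof (rule integral_derivative_periodic)
      show "((\<lambda>s. tr' i s * tr j s - tr i s * tr' j s) has_real_derivative
          ((freq j)\<^sup>2 - (freq i)\<^sup>2) * (tr i s * tr j s)) (at s)" for s
        by (rule DERIV_cong[OF DERIV_diff[OF DERIV_mult[OF tr'_deriv tr_deriv] DERIV_mult[OF tr_deriv tr'_deriv]]])
          (simp add: algebra_simps)
      show "tr' i (circ) * tr j (circ) - tr i (circ) * tr' j (circ) =
          tr' i 0 * tr j 0 - tr i 0 * tr' j 0"
        using tr_periodic[of _ 0] tr'_periodic[of _ 0] by simp
    qed (use P in simp)
    from has_integral_mult_right[OF this, of "1 / ((freq j)\<^sup>2 - (freq i)\<^sup>2)"] ne show ?thesis by simp
  next
    case True
    \<comment> \<open>Cosine and sine of the same frequency: the Wronskian identity of the other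
      case degenerates, but the product is the derivative of a multiple of the squared sine.\<close>
    define l where "l = \<bar>j\<bar>"
    have l: "0 < l" "freq (- l) = - freq l" "freq l \<noteq> 0"
      using that True n_pos by (auto simp: l_def freq_def)
    have "tr i s * tr j s = tr l s * tr (- l) s" for s
      using True l by (cases "0 \<le> j") (auto simp: l_def mult.commute)
    moreover have "((\<lambda>s. tr l s * tr (- l) s) has_integral 0) {0..circ}"
    proof (rule integral_derivative_periodic)
      show "((\<lambda>s. - (1 / (2 * freq l)) * (tr (- l) s * tr (- l) s)) has_real_derivative tr l s * tr (- l) s) (at s)" for s
        by (rule DERIV_cong[OF DERIV_cmult[OF DERIV_mult[OF tr_deriv tr_deriv]]])
          (use l in \<open>simp add: tr_def tr'_def field_simps\<close>)
      show "- (1 / (2 * freq l)) * (tr (- l) (circ) * tr (- l) (circ)) =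
          - (1 / (2 * freq l)) * (tr (- l) 0 * tr (- l) 0)"
        using tr_periodic[of _ 0] by simp
    qed (use P in simp)
    ultimately show ?thesis by simp
  qed
  show "0 < integral {0..circ} (\<lambda>s. tr j s * tr j s)"
  proof (rule ccontr)
    assume "\<not> ?thesis"
    then have "tr j s * tr j s = 0" if "s \<in> {0..circ}" for s
      using integral_eq_0_imp_zero[OF P, of "\<lambda>s. tr j s * tr j s" s] that
      by (auto intro!: continuous_intros cont)
    then have z: "tr j s = 0" if "0 \<le> s" "s \<le> circ" for s using that by auto
    show False
    proof (cases "0 \<le> j")
      case True
      then show False using z[of 0] n_pos by (simp add: tr_def)
    next
      case False
      let ?s = "real n * pi / (2 * \<bar>real_of_int j\<bar>)"
      have "1 \<le> \<bar>real_of_int j\<bar>" using False by simp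
      then have "?s \<le> circ"
        using n_pos by (simp add: field_simps)
      moreover have "freq j * ?s = - (pi / 2)"
        using False n_pos by (simp add: freq_def field_simps)
      then have "tr j ?s = -1"
        using False by (simp only: tr_def if_False) simp
      ultimately show False
        using z[of ?s] n_pos by simp
    qed
  qed
qed

text \<open>Evaluating the sum at t, -t, 2 L - t and 2 L + t gives four equations whose sign matrix
  is the character table of the group of the two parities, hence invertible.\<close>

lemma parity_separation:
  fixes h :: "bool \<Rightarrow> bool \<Rightarrow> real \<Rightarrow> real"
  assumes "\<And>a b t. h a b (- t) = parity a * h a b t" "\<And>a b t. h a b (2 * L - t) = parity b * h a b t"
    and sum: "\<And>t. (\<Sum>a\<in>UNIV. \<Sum>b\<in>UNIV. h a b t) = 0"
  shows "h a b t = 0"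
proof -
  have "h a b (2 * L - - t) = parity b * (parity a * h a b t)" for a b
    by (simp only: assms)
  then have "h True True t + h True False t + h False True t + h False False t = 0"
    "h True True t + h True False t - h False True t - h False False t = 0"
    "h True True t - h True False t + h False True t - h False False t = 0"
    "h True True t - h True False t - h False True t + h False False t = 0"
    using sum[of t] sum[of "- t"] sum[of "2 * L - t"] sum[of "2 * L - - t"]
    by (simp_all add: UNIV_bool assms(1,2) parity_def)
  then show ?thesis by (cases a; cases b; simp)
qed

text \<open>Integration against \<open>tr i\<close> isolates one Fourier index, then the parities
  isolate one class. A class and an index together determine at most one function of the family, and
  that function is not 0.\<close>

lemma modes_independent:
  assumes X: "finite X" and Y: "\<And>a b j. ((a, b), j) \<in> X \<Longrightarrow> mode a b (freq j) (\<mu> ((a, b), j)) (Y ((a, b), j))"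
    and sum: "\<And>z::real^2. (\<Sum>x\<in>X. c x * (tr (snd x) (z $ 1) * Y x (z $ 2))) = 0"
  shows "\<forall>x\<in>X. c x = 0"
proof (safe)
  fix a b i assume x: "((a, b), i) \<in> X"
  \<comment> \<open>Continuation by 0 makes the parity relations hold for all four classes,
    including those absent from \<open>X\<close>.\<close>
  define d where "d x = (if x \<in> X then c x else 0)" for x
  let ?S = "{0..circ}"
  let ?N = "integral ?S (\<lambda>s. tr i s * tr i s)"
  have eq: "(\<Sum>a\<in>UNIV. \<Sum>b\<in>UNIV. d ((a, b), i) * Y ((a, b), i) t) = 0" for t
  proof -
    have int: "((\<lambda>s. tr i s * tr j s) has_integral (if j = i then ?N else 0)) ?S" for j
      using tr_orthogonal(1)[of i j]
      by (auto intro!: integrable_integral integrable_continuous_real continuous_intros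
          continuous_on_has_derivative[OF tr_deriv])
    have "((\<lambda>s. \<Sum>x\<in>X. (c x * Y x t) * (tr i s * tr (snd x) s)) has_integral
        (\<Sum>x\<in>X. (c x * Y x t) * (if snd x = i then ?N else 0))) ?S"
      by (intro has_integral_sum X has_integral_mult_right int)
    moreover have "(\<Sum>x\<in>X. (c x * Y x t) * (tr i s * tr (snd x) s)) = 0" for s
    proof -
      have "(\<Sum>x\<in>X. (c x * Y x t) * (tr i s * tr (snd x) s)) = tr i s * (\<Sum>x\<in>X. c x * (tr (snd x) s * Y x t))"
        unfolding sum_distrib_left by (intro sum.cong refl) (simp add: mult_ac)
      then show ?thesis using sum[of "pt s t"] by simp
    qed
    ultimately have "(\<Sum>x\<in>X. (c x * Y x t) * (if snd x = i then ?N else 0)) = 0"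
      by (simp add: has_integral_0_eq)
    also have "(\<Sum>x\<in>X. (c x * Y x t) * (if snd x = i then ?N else 0)) =
        (\<Sum>x\<in>UNIV \<times> {i}. d x * Y x t * ?N)"
      by (rule sum.mono_neutral_cong) (use X in \<open>auto simp: d_def\<close>)
    also have "\<dots> = (\<Sum>p\<in>UNIV. d (p, i) * Y (p, i) t) * ?N"
      unfolding sum_distrib_right
      by (rule sum.reindex_bij_witness[where i = "\<lambda>p. (p, i)" and j = fst]) auto
    also have "(\<Sum>p\<in>UNIV. d (p, i) * Y (p, i) t) = (\<Sum>a\<in>UNIV. \<Sum>b\<in>UNIV. d ((a, b), i) * Y ((a, b), i) t)"
      by (simp add: sum.cartesian_product split_beta flip: UNIV_Times_UNIV)
    finally show ?thesis using tr_orthogonal(2)[of i] by simp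
  qed
  have par: "d ((a, b), i) * Y ((a, b), i) (- t) = parity a * (d ((a, b), i) * Y ((a, b), i) t)"
    "d ((a, b), i) * Y ((a, b), i) (2 * L - t) = parity b * (d ((a, b), i) * Y ((a, b), i) t)" for a b t
    using Y[of a b i] by (auto simp: d_def mode_def)
  have "d ((a, b), i) * Y ((a, b), i) t = 0" for t
    by (rule parity_separation[where h = "\<lambda>a b t. d ((a, b), i) * Y ((a, b), i) t", OF par eq])
  moreover obtain t where "Y ((a, b), i) t \<noteq> 0" using Y[OF x] by (auto simp: mode_def)
  ultimately show "c ((a, b), i) = 0" using x by (auto simp: d_def)
qed

text \<open>Only the square of the frequency enters the equation, so a mode for |freq j| serves both
  \<open>j\<close> and \<open>- j\<close>, once with a cosine and once with a sine.\<close>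

lemma count_modes:
  fixes J :: "bool \<Rightarrow> bool \<Rightarrow> int set"
  assumes fin: "\<And>a b. finite (J a b)"
    and ex: "\<And>a b j. j \<in> J a b \<Longrightarrow> \<exists>\<mu> y. mode a b \<bar>freq j\<bar> \<mu> y \<and> \<mu> \<in> I"
    and par: "\<And>a b j. j \<in> J a b \<Longrightarrow> odd (m * n) \<Longrightarrow> even j \<longleftrightarrow> a = b"
  shows "ereal (real (card (J True True) + card (J True False) + card (J False True) + card (J False False)))
    \<le> eigenvalue_count u \<Lambda> I"
proof -
  define X where "X = (SIGMA p:UNIV. J (fst p) (snd p))"
  have X: "finite X" unfolding X_def using fin by (intro finite_SigmaI) auto
  have "\<forall>x\<in>X. \<exists>w. mode (fst (fst x)) (snd (fst x)) (freq (snd x)) (fst w) (snd w) \<and> fst w \<in> I"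
    using ex by (fastforce simp: X_def mode_def)
  then obtain w where w: "\<forall>x\<in>X. mode (fst (fst x)) (snd (fst x)) (freq (snd x)) (fst (w x)) (snd (w x)) \<and> fst (w x) \<in> I"
    by (rule bchoice[THEN exE])
  have "ereal (real (card X)) \<le> eigenvalue_count u \<Lambda> I"
  proof (rule eigenvalue_count_ge[OF X])
    show "(\<lambda>z. tr (snd x) (z $ 1) * snd (w x) (z $ 2)) \<in> eigenspace u \<Lambda> (fst (w x))" if "x \<in> X" for x
      by (rule eigenfunction[of "fst (fst x)" "snd (fst x)"]) (use that w par in \<open>auto simp: X_def\<close>)
    show "fst (w x) \<in> I" if "x \<in> X" for x using w that by blast
    show "\<forall>x\<in>X. c x = 0" if "\<And>z::real^2. (\<Sum>x\<in>X. c x * (tr (snd x) (z $ 1) * snd (w x) (z $ 2))) = 0" for c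
      by (rule modes_independent[OF X _ that]) (use w in force)
  qed
  moreover have "card X = (\<Sum>p\<in>UNIV. card (J (fst p) (snd p)))"
    unfolding X_def using fin by (intro card_SigmaI) auto
  moreover have "\<dots> = card (J True True) + card (J True False) + card (J False True) + card (J False False)"
    by (simp add: UNIV_bool flip: UNIV_Times_UNIV)
  ultimately show ?thesis by simp
qed

end

section \<open>Lower bounds\<close>

lemma card_sym_interval:
  "card {j::int. \<bar>j\<bar> \<le> int N} = 2 * N + 1" "0 < N \<Longrightarrow> card {j::int. \<bar>j\<bar> < int N} = 2 * N - 1"
proof -
  have "{j::int. \<bar>j\<bar> \<le> int N} = {- int N..int N}" by auto
  then show "card {j::int. \<bar>j\<bar> \<le> int N} = 2 * N + 1" by simp
  have "{j::int. \<bar>j\<bar> < int N} = {- int N<..<int N}" by auto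
  then show "0 < N \<Longrightarrow> card {j::int. \<bar>j\<bar> < int N} = 2 * N - 1" by simp
qed

lemma finite_sym_interval [simp]: "finite {j::int. \<bar>j\<bar> \<le> N \<and> P j}" "finite {j::int. \<bar>j\<bar> < N \<and> P j}"
  by (rule finite_subset[of _ "{-N..N}"]; auto)+

text \<open>The admissible integers are 2 i - N with 0 \<le> i \<le> N. Both end points have the
  right parity, so the strict inequality costs exactly two of them.\<close>

lemma card_sym_interval_parity:
  assumes "0 < N"
  shows "card {j::int. \<bar>j\<bar> \<le> int N \<and> (even j \<longleftrightarrow> even N)} = N + 1"
    and "card {j::int. \<bar>j\<bar> < int N \<and> (even j \<longleftrightarrow> even N)} = N - 1"
proof -
  have "bij_betw (\<lambda>i. 2 * int i - int N) {..N} {j::int. \<bar>j\<bar> \<le> int N \<and> (even j \<longleftrightarrow> even N)}"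
  proof (rule bij_betw_byWitness[where f' = "\<lambda>j. nat ((j + int N) div 2)"])
    show "(\<lambda>j. nat ((j + int N) div 2)) ` {j::int. \<bar>j\<bar> \<le> int N \<and> (even j \<longleftrightarrow> even N)} \<subseteq> {..N}" by auto
    show "\<forall>j\<in>{j::int. \<bar>j\<bar> \<le> int N \<and> (even j \<longleftrightarrow> even N)}. 2 * int (nat ((j + int N) div 2)) - int N = j"
      by (auto simp: abs_le_iff)
  qed auto
  from bij_betw_same_card[OF this]
  show 1: "card {j::int. \<bar>j\<bar> \<le> int N \<and> (even j \<longleftrightarrow> even N)} = N + 1" by simp
  have "{j::int. \<bar>j\<bar> < int N \<and> (even j \<longleftrightarrow> even N)} = {j::int. \<bar>j\<bar> \<le> int N \<and> (even j \<longleftrightarrow> even N)} - {int N, - int N}"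
    using assms by auto
  also have "card \<dots> = (N + 1) - card {int N, - int N}"
    unfolding 1[symmetric] by (rule card_Diff_subset) auto
  finally show "card {j::int. \<bar>j\<bar> < int N \<and> (even j \<longleftrightarrow> even N)} = N - 1" using assms by simp
qed

context torus
begin

lemma freq_le_iff:
  "\<bar>freq j\<bar> \<le> 1 + q \<longleftrightarrow> \<bar>j\<bar> \<le> int (n + m)" "\<bar>freq j\<bar> \<le> 1 \<longleftrightarrow> \<bar>j\<bar> \<le> int n" "\<bar>freq j\<bar> \<le> q \<longleftrightarrow> \<bar>j\<bar> \<le> int m"
  "\<bar>freq j\<bar> \<le> 2 + q \<longleftrightarrow> \<bar>j\<bar> \<le> int (2 * n + m)" "\<bar>freq j\<bar> \<le> 1 + 2 * q \<longleftrightarrow> \<bar>j\<bar> \<le> int (n + 2 * m)"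
  "\<bar>freq j\<bar> \<le> 1 - q \<longleftrightarrow> \<bar>j\<bar> \<le> int (n - m)"
  "\<bar>freq j\<bar> < 2 + q \<longleftrightarrow> \<bar>j\<bar> < int (2 * n + m)" "\<bar>freq j\<bar> < 1 + 2 * q \<longleftrightarrow> \<bar>j\<bar> < int (n + 2 * m)"
  "\<bar>freq j\<bar> < 1 - q \<longleftrightarrow> \<bar>j\<bar> < int (n - m)"
proof -
  have le: "\<bar>freq j\<bar> \<le> x \<longleftrightarrow> \<bar>j\<bar> \<le> N" if "x * real n = of_int N" for x N
  proof -
    have "\<bar>freq j\<bar> \<le> x \<longleftrightarrow> real_of_int \<bar>j\<bar> \<le> x * real n"
      using n_pos by (simp add: freq_def abs_divide pos_divide_le_eq)
    then show ?thesis unfolding that of_int_le_iff .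
  qed
  have less: "\<bar>freq j\<bar> < x \<longleftrightarrow> \<bar>j\<bar> < N" if "x * real n = of_int N" for x N
  proof -
    have "\<bar>freq j\<bar> < x \<longleftrightarrow> real_of_int \<bar>j\<bar> < x * real n"
      using n_pos by (simp add: freq_def abs_divide pos_divide_less_eq)
    then show ?thesis unfolding that of_int_less_iff .
  qed
  have qn: "q * real n = real m" using n_pos by (simp add: q_def)
  show "\<bar>freq j\<bar> \<le> 1 + q \<longleftrightarrow> \<bar>j\<bar> \<le> int (n + m)" "\<bar>freq j\<bar> \<le> 1 \<longleftrightarrow> \<bar>j\<bar> \<le> int n" "\<bar>freq j\<bar> \<le> q \<longleftrightarrow> \<bar>j\<bar> \<le> int m"
    "\<bar>freq j\<bar> \<le> 2 + q \<longleftrightarrow> \<bar>j\<bar> \<le> int (2 * n + m)" "\<bar>freq j\<bar> \<le> 1 + 2 * q \<longleftrightarrow> \<bar>j\<bar> \<le> int (n + 2 * m)"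
    "\<bar>freq j\<bar> \<le> 1 - q \<longleftrightarrow> \<bar>j\<bar> \<le> int (n - m)"
    by (rule le; use qn mn in \<open>simp add: algebra_simps of_nat_diff\<close>)+
  show "\<bar>freq j\<bar> < 2 + q \<longleftrightarrow> \<bar>j\<bar> < int (2 * n + m)" "\<bar>freq j\<bar> < 1 + 2 * q \<longleftrightarrow> \<bar>j\<bar> < int (n + 2 * m)"
    "\<bar>freq j\<bar> < 1 - q \<longleftrightarrow> \<bar>j\<bar> < int (n - m)"
    by (rule less; use qn mn in \<open>simp add: algebra_simps of_nat_diff\<close>)+
qed

lemma mode_dn: "\<bar>j\<bar> = int (n + m) \<Longrightarrow> \<exists>y. mode True True \<bar>freq j\<bar> 2 y"
proof -
  assume "\<bar>j\<bar> = int (n + m)"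
  then have "\<bar>freq j\<bar> = 1 + q"
    using n_pos by (simp add: freq_def q_def abs_divide field_simps flip: of_int_abs)
  then show ?thesis using lame1_dn by simp
qed

lemma mode_const: "\<exists>y. mode True True \<bar>freq 0\<bar> 0 y"
proof -
  have "mode True True 0 0 (\<lambda>_. 1)"
    unfolding mode_def by (auto simp: parity_def intro!: exI[of _ "\<lambda>_. 0"])
  then show ?thesis by (auto simp: freq_def)
qed

text \<open>For odd \<open>m n\<close> the second lattice vector also translates \<open>s\<close> by half a period, under which
  \<open>tr j\<close> gets the sign \<open>(-1)\<^sup>j\<close>; this has to cancel against the sign of the \<open>t\<close>-part.\<close>

definition admissible :: "bool \<Rightarrow> bool \<Rightarrow> int \<Rightarrow> bool" where
  "admissible a b j \<longleftrightarrow> (odd (m * n) \<longrightarrow> (even j \<longleftrightarrow> a = b))"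

text \<open>For odd \<open>m * n\<close> the end point N must itself be admissible. This holds
  wherever it is applied: n + m and n - m are even and belong to equal parities, while n, m, 2 n + m
  and n + 2 m are odd and belong to different ones.\<close>

lemma card_admissible_le:
  assumes "0 < N" "odd (m * n) \<Longrightarrow> even N \<longleftrightarrow> a = b"
  shows "card {j. \<bar>j\<bar> \<le> int N \<and> admissible a b j} = (if even (m * n) then 2 * N + 1 else N + 1)"
    and "card {j. \<bar>j\<bar> < int N \<and> admissible a b j} = (if even (m * n) then 2 * N - 1 else N - 1)"
  using assms(2) card_sym_interval[of N] card_sym_interval_parity[OF assms(1)] assms(1)
  by (cases "even (m * n)"; simp add: admissible_def)+

lemma lower_bound_N1:
  "ereal (if even (m * n) then 4 * real n + 4 * real m + 3 else 2 * real n + 2 * real m + 3)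
    \<le> eigenvalue_count u \<Lambda> {0..2}"
proof -
  \<comment> \<open>The bound -1 empties the class odd at both ends, for which \<open>lame1\<close>
    provides nothing.\<close>
  define J where "J a b = {j. \<bar>j\<bar> \<le> (if a then if b then int (n + m) else int n else if b then int m else -1)
      \<and> admissible a b j}" for a b
  have "ereal (real (card (J True True) + card (J True False) + card (J False True) + card (J False False)))
    \<le> eigenvalue_count u \<Lambda> {0..2}"
  proof (rule count_modes)
    show "\<exists>\<mu> y. mode a b \<bar>freq j\<bar> \<mu> y \<and> \<mu> \<in> {0..2}" if "j \<in> J a b" for a b j
      using that lame1[of "\<bar>freq j\<bar>"]
      by (cases a; cases b) (auto simp: J_def freq_le_iff)
  qed (auto simp: J_def admissible_def split: if_splits)
  moreover have "card (J True True) = (if even (m * n) then 2 * (n + m) + 1 else n + m + 1)"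
    unfolding J_def if_True by (rule card_admissible_le) (use mn in auto)
  moreover have "card (J True False) = (if even (m * n) then 2 * n + 1 else n + 1)"
    unfolding J_def if_True if_False by (rule card_admissible_le) (use mn in auto)
  moreover have "card (J False True) = (if even (m * n) then 2 * m + 1 else m + 1)"
    unfolding J_def if_True if_False by (rule card_admissible_le) (use m0 in auto)
  moreover have "J False False = {}"
    by (auto simp: J_def)
  ultimately show ?thesis
    by (cases "even (m * n)") (simp_all add: algebra_simps)
qed

text \<open>The class even at both ends contributes three functions, the constant and the two
  \<open>dn'\<close> modes; the other classes are counted up to the end frequencies of
  \<open>lame2\<close>.\<close>

lemma lower_bound_N2:
  "ereal (if even (m * n) then 8 * real n + 4 * real m + 6 else 4 * real n + 2 * real m + 6)
    \<le> eigenvalue_count u \<Lambda> {0..6}"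
proof -
  define J where "J a b = (if a \<and> b then {0, int (n + m), - int (n + m)} else
    {j. \<bar>j\<bar> \<le> int (if a then 2 * n + m else if b then n + 2 * m else n - m) \<and> admissible a b j})" for a b
  have "ereal (real (card (J True True) + card (J True False) + card (J False True) + card (J False False)))
    \<le> eigenvalue_count u \<Lambda> {0..6}"
  proof (rule count_modes)
    show "\<exists>\<mu> y. mode a b \<bar>freq j\<bar> \<mu> y \<and> \<mu> \<in> {0..6}" if j: "j \<in> J a b" for a b j
    proof (cases "a \<and> b")
      case True
      then have "j = 0 \<or> \<bar>j\<bar> = int (n + m)" using j by (auto simp: J_def)
      then have "(\<exists>y. mode True True \<bar>freq j\<bar> 0 y) \<or> (\<exists>y. mode True True \<bar>freq j\<bar> 2 y)"
        using mode_dn mode_const by blast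
      then show ?thesis using True by auto
    next
      case False
      then show ?thesis
        using j lame2[of "\<bar>freq j\<bar>"]
        by (cases a; cases b) (auto simp: J_def freq_le_iff less_imp_le)
    qed
  qed (auto simp: J_def admissible_def split: if_splits)
  moreover have "card (J True True) = 3"
    using mn by (simp add: J_def)
  moreover have "card (J True False) = (if even (m * n) then 2 * (2 * n + m) + 1 else 2 * n + m + 1)"
    unfolding J_def by (simp only: if_True if_False simp_thms) (rule card_admissible_le; use mn in auto)
  moreover have "card (J False True) = (if even (m * n) then 2 * (n + 2 * m) + 1 else n + 2 * m + 1)"
    unfolding J_def by (simp only: if_True if_False simp_thms) (rule card_admissible_le; use mn in auto)
  moreover have "card (J False False) = (if even (m * n) then 2 * (n - m) + 1 else n - m + 1)"
    unfolding J_def by (simp only: if_True if_False simp_thms) (rule card_admissible_le; use mn in auto)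
  ultimately show ?thesis
    using mn by (cases "even (m * n)") (simp_all add: algebra_simps of_nat_diff)
qed

text \<open>Here the end frequencies drop out, because only below them does \<open>lame2\<close>
  give an eigenvalue strictly less than 6, and the constant drops out because its eigenvalue is
  0.\<close>

lemma lower_bound_l_ind:
  "ereal (if even (m * n) then 8 * real n + 4 * real m - 1 else 4 * real n + 2 * real m - 1)
    \<le> eigenvalue_count u \<Lambda> {0<..<6}"
proof -
  define J where "J a b = (if a \<and> b then {int (n + m), - int (n + m)} else
    {j. \<bar>j\<bar> < int (if a then 2 * n + m else if b then n + 2 * m else n - m) \<and> admissible a b j})" for a b
  have "ereal (real (card (J True True) + card (J True False) + card (J False True) + card (J False False)))
    \<le> eigenvalue_count u \<Lambda> {0<..<6}"
  proof (rule count_modes)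
    show "\<exists>\<mu> y. mode a b \<bar>freq j\<bar> \<mu> y \<and> \<mu> \<in> {0<..<6}" if j: "j \<in> J a b" for a b j
    proof (cases "a \<and> b")
      case True
      then have "\<bar>j\<bar> = int (n + m)" using j by (auto simp: J_def)
      then have "(\<exists>y. mode True True \<bar>freq j\<bar> 2 y)"
        using mode_dn by blast
      then show ?thesis using True by auto
    next
      case False
      then show ?thesis
        using j lame2[of "\<bar>freq j\<bar>"]
        by (cases a; cases b) (auto simp: J_def freq_le_iff less_imp_le)
    qed
  qed (auto simp: J_def admissible_def split: if_splits)
  moreover have "card (J True True) = 2"
    using mn by (simp add: J_def)
  moreover have "card (J True False) = (if even (m * n) then 2 * (2 * n + m) - 1 else 2 * n + m - 1)"
    unfolding J_def by (simp only: if_True if_False simp_thms) (rule card_admissible_le; use mn in auto)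
  moreover have "card (J False True) = (if even (m * n) then 2 * (n + 2 * m) - 1 else n + 2 * m - 1)"
    unfolding J_def by (simp only: if_True if_False simp_thms) (rule card_admissible_le; use mn in auto)
  moreover have "card (J False False) = (if even (m * n) then 2 * (n - m) - 1 else n - m - 1)"
    unfolding J_def by (simp only: if_True if_False simp_thms) (rule card_admissible_le; use mn in auto)
  ultimately show ?thesis
    using mn m0 by (cases "even (m * n)") (simp_all add: algebra_simps of_nat_diff)
qed

section \<open>A one-parameter group of symmetries of the cone\<close>

definition rotation :: "real \<Rightarrow> complex^3^3" where
  "rotation \<theta> = (\<chi> i j. if i = j then vector [cis \<theta>, cis (q * \<theta>), cis (- (1 + q) * \<theta>)] $ i else 0)"

lemma rotation_nth:
  "rotation \<theta> $ i $ j = (if i = j then vector [cis \<theta>, cis (q * \<theta>), cis (- (1 + q) * \<theta>)] $ i else 0)"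
  by (simp add: rotation_def)

lemma rotation_add: "rotation (\<theta> + \<theta>') = rotation \<theta> ** rotation \<theta>'"
  by (simp add: vec_eq_iff forall_3 matrix_matrix_mult_def sum_3 rotation_nth cis_mult algebra_simps)

lemma rotation_SU3: "rotation \<theta> \<in> SU3"
proof -
  have "rotation \<theta> ** conj_transpose (rotation \<theta>) = mat 1"
    by (simp add: vec_eq_iff forall_3 matrix_matrix_mult_def sum_3 rotation_nth conj_transpose_def mat_def
        cis_mult cis_cnj)
  moreover have "det (rotation \<theta>) = 1"
  proof -
    have "\<theta> + q * \<theta> + - (1 + q) * \<theta> = 0" by (simp add: algebra_simps)
    then show ?thesis by (simp add: det_3 rotation_nth cis_mult)
  qed
  ultimately show ?thesis by (simp add: SU3_def)
qed

lemma rotation_u: "rotation \<theta> *v u (pt s t) = u (pt (s + \<theta>) t)"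
proof -
  have "cis \<theta> * cis s = cis (s + \<theta>)" "cis (q * \<theta>) * cis (q * s) = cis (q * (s + \<theta>))"
    "cis (- (1 + q) * \<theta>) * cis (- (1 + q) * s) = cis (- (1 + q) * (s + \<theta>))"
    by (simp_all add: cis_mult algebra_simps)
  then show ?thesis
    unfolding u_pt by (simp add: vec_eq_iff forall_3 matrix_vector_mult_def sum_3 rotation_nth mult_ac)
qed

text \<open>A rotation only translates s on the image of the immersion, so it maps the cone into
  itself; applying this to the inverse rotation gives equality.\<close>

lemma rotation_cone: "(\<lambda>x. rotation \<theta> *v x) ` (cone hull range u) = cone hull range u"
proof -
  have sub: "(\<lambda>x. rotation \<theta> *v x) ` (cone hull range u) \<subseteq> cone hull range u" for \<theta>
  proof
    fix x assume "x \<in> (\<lambda>x. rotation \<theta> *v x) ` (cone hull range u)"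
    then obtain c z where cz: "0 \<le> c" "x = rotation \<theta> *v (c *\<^sub>R u z)"
      by (auto simp: cone_hull_expl)
    have "rotation \<theta> *v u z = u (pt (z $ 1 + \<theta>) (z $ 2))"
      using rotation_u[of \<theta> "z $ 1" "z $ 2"] by simp
    moreover have "rotation \<theta> *v (c *\<^sub>R u z) = c *\<^sub>R (rotation \<theta> *v u z)"
      by (simp add: vec_eq_iff matrix_vector_mult_def scaleR_sum_right)
    ultimately show "x \<in> cone hull range u"
      using cz by (auto simp: cone_hull_expl)
  qed
  have "rotation \<theta> *v (rotation (- \<theta>) *v x) = x" for x
  proof -
    have "rotation \<theta> ** rotation (- \<theta>) = mat 1"
      unfolding rotation_add[symmetric] by (simp add: vec_eq_iff forall_3 rotation_nth mat_def)
    then show ?thesis by (simp add: matrix_vector_mul_assoc)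
  qed
  then have "x \<in> (\<lambda>x. rotation \<theta> *v x) ` (cone hull range u)" if "x \<in> cone hull range u" for x
    using sub[of "- \<theta>"] that by (intro image_eqI[of _ _ "rotation (- \<theta>) *v x"]) auto
  then show ?thesis using sub by blast
qed

text \<open>The exponents 1, q, -(1 + q) add up to 0, so the rotations lie in SU(3); their initial
  velocity is a nonzero element of the Lie algebra of the symmetry group.\<close>

lemma lie_dim_pos: "1 \<le> lie_dim (cone_symmetries u)"
proof -
  define X :: "complex^3^3" where
    "X = (\<chi> i j. if i = j then vector [\<i>, \<i> * complex_of_real q, \<i> * complex_of_real (- (1 + q))] $ i else 0)"
  have c: "((\<lambda>t. cis (a * t)) has_vector_derivative \<i> * complex_of_real a) (at 0)" for a
    using cis_deriv[of a 0] by simp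
  have "(rotation has_vector_derivative X) (at 0)"
  proof (intro has_vector_derivative_vec)
    show "((\<lambda>t. rotation t $ i $ j) has_vector_derivative X $ i $ j) (at 0)" for i j
      using exhaust_3[of i] c[of 1] c[of q] c[of "- (1 + q)"]
      by (cases "i = j") (auto simp: rotation_nth X_def)
  qed
  moreover have "range rotation \<subseteq> cone_symmetries u"
    using rotation_SU3 rotation_cone by (auto simp: cone_symmetries_def)
  ultimately have "X \<in> lie_algebra (cone_symmetries u)"
    unfolding lie_algebra_def using rotation_add by blast
  then have "dim {X} \<le> lie_dim (cone_symmetries u)"
    unfolding lie_dim_def by (intro dim_subset) simp
  moreover have "X $ 1 $ 1 \<noteq> 0" by (simp add: X_def)
  then have "X \<noteq> 0" by auto
  ultimately show ?thesis by simp
qed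

end

section \<open>Uniqueness of Fourier coefficients\<close>

context torus
begin

definition trig :: "(real \<Rightarrow> real) set" where
  "trig = realfun.span (range tr)"

lemma trig_linear:
  "f \<in> trig \<Longrightarrow> g \<in> trig \<Longrightarrow> (\<lambda>s. f s + g s) \<in> trig" "f \<in> trig \<Longrightarrow> (\<lambda>s. c * f s) \<in> trig"
  unfolding trig_def using realfun.span_add[of f _ g] realfun.span_scale[of f _ c]
  by (auto simp: plus_fun_def)

lemma freq_add: "freq (i + j) = freq i + freq j" "freq (- j) = - freq j" "freq 0 = 0"
  by (simp_all add: freq_def add_divide_distrib)

lemma trig_cos_sin: "(\<lambda>s. cos (freq j * s)) \<in> trig" "(\<lambda>s. sin (freq j * s)) \<in> trig"
proof -
  have tr: "tr i \<in> trig" for i unfolding trig_def by (rule realfun.span_base) simp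
  have "(\<lambda>s. cos (freq j * s)) = tr \<bar>j\<bar>"
    by (cases "0 \<le> j") (auto simp: tr_def fun_eq_iff freq_add)
  then show "(\<lambda>s. cos (freq j * s)) \<in> trig" using tr by simp
  consider "j < 0" | "j = 0" | "0 < j" by linarith
  then show "(\<lambda>s. sin (freq j * s)) \<in> trig"
  proof cases
    case 1
    then have "(\<lambda>s. sin (freq j * s)) = tr j" by (auto simp: tr_def fun_eq_iff)
    then show ?thesis using tr by simp
  next
    case 2
    then show ?thesis using trig_linear(2)[OF tr[of 0], of 0] by (simp add: freq_add)
  next
    case 3
    then have "(\<lambda>s. sin (freq j * s)) = (\<lambda>s. (-1) * tr (- j) s)" by (auto simp: tr_def fun_eq_iff freq_add)
    then show ?thesis using trig_linear(2)[OF tr[of "- j"], of "-1"] by simp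
  qed
qed

lemma trig_product_tr: "(\<lambda>s. tr i s * tr j s) \<in> trig"
proof -
  note cs = trig_cos_sin[of "i + j"] trig_cos_sin[of "i - j"]
  have diff: "freq (i - j) = freq i - freq j" using freq_add(1)[of i "- j"] freq_add(2) by simp
  have comb: "(\<lambda>s. a * f s + b * g s) \<in> trig" if "f \<in> trig" "g \<in> trig" for a b f g
    by (intro trig_linear that)
  have e: "cos (freq i * s) * cos (freq j * s) = 1/2 * cos (freq (i + j) * s) + 1/2 * cos (freq (i - j) * s)"
    "sin (freq i * s) * sin (freq j * s) = -1/2 * cos (freq (i + j) * s) + 1/2 * cos (freq (i - j) * s)"
    "sin (freq i * s) * cos (freq j * s) = 1/2 * sin (freq (i + j) * s) + 1/2 * sin (freq (i - j) * s)"
    "cos (freq i * s) * sin (freq j * s) = 1/2 * sin (freq (i + j) * s) + -1/2 * sin (freq (i - j) * s)" for s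
    unfolding freq_add(1) diff distrib_right left_diff_distrib cos_add cos_diff sin_add sin_diff
    by (simp_all add: field_simps)
  have prods: "(\<lambda>s. cos (freq i * s) * cos (freq j * s)) \<in> trig" "(\<lambda>s. sin (freq i * s) * sin (freq j * s)) \<in> trig"
    "(\<lambda>s. sin (freq i * s) * cos (freq j * s)) \<in> trig" "(\<lambda>s. cos (freq i * s) * sin (freq j * s)) \<in> trig"
    unfolding e by (rule comb[OF cs(1,3)] comb[OF cs(2,4)])+
  show ?thesis
    unfolding tr_def by (cases "0 \<le> i"; cases "0 \<le> j"; simp only: if_True if_False; rule prods)
qed

text \<open>The addition theorems make the trigonometric polynomials an algebra, as
  Stone-Weierstrass requires.\<close>

lemma trig_mult:
  assumes "f \<in> trig" "g \<in> trig" shows "(\<lambda>s. f s * g s) \<in> trig"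
proof -
  have z: "(\<lambda>s. 0) \<in> trig" using trig_linear(2)[OF assms(1), of 0] by simp
  have 1: "(\<lambda>s. f s * tr j s) \<in> trig" for j
    using assms(1)[unfolded trig_def]
  proof (induction rule: realfun.span_induct_alt)
    case base
    then show ?case using z by (simp add: zero_fun_def)
  next
    case (step c x y)
    then obtain i where "x = tr i" by auto
    then have "(\<lambda>s. c * (tr i s * tr j s) + y s * tr j s) \<in> trig"
      using step trig_product_tr by (intro trig_linear) auto
    then show ?case using \<open>x = tr i\<close> by (simp add: plus_fun_def algebra_simps)
  qed
  show ?thesis
    using assms(2)[unfolded trig_def]
  proof (induction rule: realfun.span_induct_alt)
    case base
    then show ?case using z by (simp add: zero_fun_def)
  next
    case (step c x y)
    then obtain i where "x = tr i" by auto
    then have "(\<lambda>s. c * (f s * tr i s) + f s * y s) \<in> trig"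
      using step 1 by (intro trig_linear) auto
    then show ?case using \<open>x = tr i\<close> by (simp add: plus_fun_def algebra_simps)
  qed
qed

text \<open>Carried to the unit circle, a compact space, the trigonometric polynomials contain Re
  and Im and separate points, so some \<phi> among them is uniformly close to h. As h is orthogonal
  to \<phi>, the integral of h^2 equals that of h (h - \<phi>) and is arbitrarily small.\<close>

lemma fourier_uniqueness:
  assumes h: "continuous_on UNIV h" and per: "\<And>s. h (s + circ) = h s"
    and coeff: "\<And>j. integral {0..circ} (\<lambda>s. h s * tr j s) = 0"
  shows "h s = 0"
proof -
  let ?P = "circ" and ?S = "{0..circ}"
  have P: "0 < ?P" using n_pos by simp
  have hc: "continuous_on A (\<lambda>x. h (g x))" if "continuous_on A g" for A and g :: "'z::topological_space \<Rightarrow> real"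
    by (rule continuous_on_compose2[OF h that]) auto
  have orth: "continuous_on UNIV \<phi> \<and> ((\<lambda>s. h s * \<phi> s) has_integral 0) ?S" if "\<phi> \<in> trig" for \<phi>
    using that[unfolded trig_def]
  proof (induction rule: realfun.span_induct_alt)
    case base
    then show ?case by (simp add: zero_fun_def)
  next
    case (step c x y)
    then obtain i where i: "x = tr i" by auto
    have ct: "continuous_on A (tr i)" for A by (rule continuous_on_has_derivative[OF tr_deriv])
    have "continuous_on ?S (\<lambda>s. h s * tr i s)"
      by (intro continuous_on_mult continuous_on_subset[OF h subset_UNIV] ct)
    then have "((\<lambda>s. h s * tr i s) has_integral 0) ?S"
      using integrable_integral[OF integrable_continuous_real] coeff[of i] by metis
    from has_integral_add[OF has_integral_mult_right[OF this, of c]] step.IH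
    have "((\<lambda>s. c * (h s * tr i s) + h s * y s) has_integral (c * 0 + 0)) ?S" by blast
    moreover have "continuous_on UNIV (\<lambda>s. c * tr i s + y s)"
      using step.IH by (intro continuous_intros ct) auto
    ultimately show ?case using i by (simp add: plus_fun_def distrib_left mult_ac)
  qed
  define p where "p x = h (?P * x)" for x
  \<comment> \<open>\<open>Arg2pi\<close> jumps at 1, so continuity of the transported function is
    not immediate. It comes with the passage from loops to maps of the circle, applied to the
    trivial homotopy of \<open>p\<close>.\<close>
  have "homotopic_loops UNIV p p"
    using per[of 0] by (auto simp: homotopic_loops_refl path_def pathfinish_def pathstart_def p_def
        intro!: hc continuous_intros)
  from homotopic_loops_imp_homotopic_circlemaps[OF this]
  have cont: "continuous_on (sphere 0 1) (\<lambda>z. p (Arg2pi z / (2 * pi)))"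
    by (auto dest!: homotopic_with_imp_continuous simp: o_def)
  have circ: "p (Arg2pi (cis (s / n)) / (2 * pi)) = h s" if "0 \<le> s" "s \<le> ?P" for s
  proof (cases "s = ?P")
    case True
    then have "cis (s / n) = 1" using n_pos by (simp add: complex_eq_iff)
    then show ?thesis using True per[of 0] by (simp add: p_def Arg2pi_of_real[of 1, simplified])
  next
    case False
    then have "s / n < 2 * pi" using that n_pos by (simp add: field_simps)
    then have "Arg2pi (cis (s / n)) = s / n"
      using that n_pos by (intro Arg2pi_unique[of 1]) (auto simp: cis_conv_exp)
    then show ?thesis using n_pos by (simp add: p_def)
  qed
  define Q where "Q F \<longleftrightarrow> continuous_on (sphere 0 1) F \<and> (\<lambda>s. F (cis (s / n))) \<in> trig" for F :: "complex \<Rightarrow> real"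
  have re_im: "Q Re" "Q Im"
    using trig_cos_sin[of 1] by (auto simp: Q_def freq_def intro!: continuous_intros)
  have const: "Q (\<lambda>_. c)" for c
    using trig_linear(2)[OF trig_cos_sin(1)[of 0], of c] by (simp add: Q_def freq_add)
  have approx: "\<exists>\<phi>\<in>trig. \<forall>s\<in>?S. \<bar>h s - \<phi> s\<bar> < e" if e: "0 < e" for e
  proof -
    have "\<exists>g. Q g \<and> (\<forall>z\<in>sphere 0 1. \<bar>p (Arg2pi z / (2 * pi)) - g z\<bar> < e)"
    proof (rule Stone_Weierstrass_HOL[where P = Q and f = "\<lambda>z. p (Arg2pi z / (2 * pi))"])
      show "\<exists>f. Q f \<and> f x \<noteq> f y" if "x \<in> sphere 0 1 \<and> y \<in> sphere 0 1 \<and> x \<noteq> y" for x y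
        using that re_im by (auto simp: complex_eq_iff)
    qed (use cont const e in \<open>auto simp: Q_def intro!: continuous_intros trig_linear trig_mult\<close>)
    then obtain g where g: "Q g" "\<And>z. z \<in> sphere 0 1 \<Longrightarrow> \<bar>p (Arg2pi z / (2 * pi)) - g z\<bar> < e" by blast
    have "\<bar>h s - g (cis (s / n))\<bar> < e" if "s \<in> ?S" for s
      using g(2)[of "cis (s / n)"] circ[of s] that by simp
    then show ?thesis
      using g(1) by (intro bexI[of _ "\<lambda>s. g (cis (s / n))"]) (auto simp: Q_def)
  qed
  have hS: "continuous_on ?S h" using hc[of ?S "\<lambda>s. s"] by simp
  then have "bounded (h ` ?S)" by (intro compact_imp_bounded compact_continuous_image) auto
  then obtain M where M: "0 < M" "\<And>s. s \<in> ?S \<Longrightarrow> \<bar>h s\<bar> \<le> M"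
    by (auto simp: bounded_pos)
  have "integral ?S (\<lambda>s. h s * h s) \<le> e" if e: "0 < e" for e
  proof -
    \<comment> \<open>Chosen so that the bound \<open>M * e'\<close>, integrated over one period,
      gives \<open>e\<close>.\<close>
    define e' where "e' = e / (M * ?P)"
    have e': "0 < e'" using e M P by (simp add: e'_def)
    obtain \<phi> where \<phi>: "\<phi> \<in> trig" "\<And>s. s \<in> ?S \<Longrightarrow> \<bar>h s - \<phi> s\<bar> < e'" using approx[OF e'] by blast
    have c\<phi>: "continuous_on ?S \<phi>" using orth[OF \<phi>(1)] continuous_on_subset by blast
    have hh: "(\<lambda>s. h s * h s) integrable_on ?S" "(\<lambda>s. h s * \<phi> s) integrable_on ?S"
      by (intro integrable_continuous_real continuous_intros hS c\<phi>)+
    have "integral ?S (\<lambda>s. h s * \<phi> s) = 0" using orth[OF \<phi>(1)] by (simp add: integral_unique)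
    then have "integral ?S (\<lambda>s. h s * h s) = integral ?S (\<lambda>s. h s * h s - h s * \<phi> s)"
      using integral_diff[OF hh] by simp
    also have "\<dots> \<le> integral ?S (\<lambda>s. M * e')"
    proof (rule integral_le)
      show "h s * h s - h s * \<phi> s \<le> M * e'" if s: "s \<in> ?S" for s
      proof -
        have "h s * h s - h s * \<phi> s \<le> \<bar>h s\<bar> * \<bar>h s - \<phi> s\<bar>"
          by (simp flip: abs_mult right_diff_distrib)
        also have "\<dots> \<le> M * e'" using M \<phi>(2)[OF s] s by (intro mult_mono) (auto intro: less_imp_le)
        finally show ?thesis .
      qed
    qed (auto intro!: integrable_continuous_real continuous_intros hS c\<phi>)
    also have "\<dots> = e" using M n_pos by (simp add: e'_def)
    finally show ?thesis .
  qed
  then have "integral ?S (\<lambda>s. h s * h s) \<le> 0"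
    by (metis dual_order.refl field_le_epsilon add_0)
  then have z: "h s = 0" if "s \<in> ?S" for s
    using integral_eq_0_imp_zero[OF P, of "\<lambda>s. h s * h s" s] that hS
    by (auto intro!: continuous_intros)
  define l where "l = \<lfloor>s / ?P\<rfloor>"
  have "of_int l * ?P \<le> s" "s \<le> (of_int l + 1) * ?P"
    unfolding l_def using P by (simp_all add: floor_divide_lower floor_divide_upper less_imp_le)
  then have "s + of_int (- l) * ?P \<in> ?S" by (simp add: algebra_simps)
  moreover have "h (s + of_int (- l) *\<^sub>R ?P) = h s"
    by (rule periodic_of_int) (rule per)
  ultimately show ?thesis using z by simp
qed

section \<open>The second Lame function\<close>

text \<open>The function \<open>lame\<close> solves the equation for \<open>\<mu> = 6\<close>, \<open>p = 0\<close>; its zeros are the points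
  \<open>\<pm>z + 2 L \<int>\<close>.\<close>

definition c0 :: real where "c0 = (1 + 2 * q) / (3 * (1 + q))"

definition lame :: "real \<Rightarrow> real" where "lame t = (sn' t)\<^sup>2 - c0"

definition lame' :: "real \<Rightarrow> real" where "lame' t = 2 * r * (sn' t * (cn' t * dn' t))"

lemma c0_bounds: "0 < c0" "c0 < 1"
  using q0 q1 by (simp_all add: c0_def field_simps)

lemma lame_deriv: "(lame has_real_derivative lame' t) (at t)"
  unfolding lame_def[abs_def] lame'_def
  by (auto intro!: derivative_eq_intros jacobi'_deriv)

text \<open>At t = 0 the second derivative of sn'^2 is 2 r^2, while the right-hand side is 6 (1 + q)
  c0; this forces c0 = r^2 / (3 (1 + q)). With this value the coefficients of sn'^2 and sn'^4 agree
  as well.\<close>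

lemma lame'_deriv: "(lame' has_real_derivative - (6 * \<rho> t) * lame t) (at t)"
proof -
  have d: "(lame' has_real_derivative 2 * r * (r * (cn' t * dn' t) * (cn' t * dn' t) +
      (- (r * (sn' t * dn' t)) * dn' t + - (r * k\<^sup>2 * (sn' t * cn' t)) * cn' t) * sn' t)) (at t)"
    unfolding lame'_def[abs_def]
    by (rule DERIV_cmult DERIV_mult jacobi'_deriv)+
  have c: "3 * (1 + q) * c0 = 1 + 2 * q" using q0 by (simp add: c0_def)
  show ?thesis
    by (rule DERIV_cong[OF d]) (use jacobi'_sq[of t] r_sq rk_sq c in \<open>unfold \<rho>_def lame_def, algebra\<close>)
qed

text \<open>At a double zero \<open>sn'\<close> or \<open>cn'\<close> would vanish, so that c0 would
  be 0 or 1.\<close>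

lemma lame_simple_zeros: "lame t = 0 \<Longrightarrow> lame' t \<noteq> 0"
proof
  assume "lame t = 0" "lame' t = 0"
  then have s: "(sn' t)\<^sup>2 = c0" and "sn' t = 0 \<or> cn' t = 0"
    using r_pos dn'_pos[of t] by (auto simp: lame_def lame'_def)
  then show False using c0_bounds jacobi'_sq(1)[of t] by auto
qed

lemma lame_sym: "lame (2 * L - t) = lame t" "lame (t + 2 * L * real i) = lame t"
proof -
  show "lame (2 * L - t) = lame t" for t by (simp add: lame_def jacobi'_reflect)
  have shift: "lame (t + 2 * L) = lame t" for t
    using jacobi'_reflect(1)[of "- t"] by (simp add: lame_def jacobi'_minus add.commute)
  show "lame (t + 2 * L * real i) = lame t"
  proof (induction i)
    case (Suc i)
    have "t + 2 * L * real (Suc i) = (t + 2 * L * real i) + 2 * L" by (simp add: algebra_simps)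
    then show ?case using shift[of "t + 2 * L * real i"] Suc by (simp only:)
  qed simp
qed

lemma sn'_mono:
  assumes "0 \<le> s" "s < t" "t \<le> L" shows "sn' s < sn' t"
proof (rule DERIV_pos_imp_increasing_open[OF assms(2)])
  fix x assume "s < x" "x < t"
  then have "0 < r * (cn' x * dn' x)" using assms jacobi'_pos[of x] dn'_pos[of x] r_pos by simp
  then show "\<exists>y. (sn' has_real_derivative y) (at x) \<and> 0 < y" using jacobi'_deriv(1) by blast
qed (rule continuous_on_has_derivative[OF jacobi'_deriv(1)])

lemma ex_zero: "\<exists>z. 0 < z \<and> z < L \<and> (\<forall>t. 0 \<le> t \<longrightarrow> t \<le> L \<longrightarrow> (lame t = 0 \<longleftrightarrow> t = z))"
proof -
  have "lame 0 < 0" "0 < lame L" using c0_bounds by (auto simp: lame_def)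
  then obtain z where z: "0 \<le> z" "z \<le> L" "lame z = 0"
    using IVT'[of lame 0 0 L] continuous_on_has_derivative[OF lame_deriv] L_pos by auto
  then have zz: "0 < z" "z < L" using \<open>lame 0 < 0\<close> \<open>0 < lame L\<close> by (auto simp: less_le)
  moreover have "t = z" if "0 \<le> t" "t \<le> L" "lame t = 0" for t
  proof -
    have "(sn' t)\<^sup>2 = (sn' z)\<^sup>2" using z that by (simp add: lame_def)
    moreover have "0 \<le> sn' t" "0 < sn' z"
      using sn'_mono[of 0 t] sn'_mono[of 0 z] that zz by (cases "t = 0"; simp add: less_imp_le)+
    ultimately have "sn' t = sn' z" by (simp add: power2_eq_iff_nonneg)
    then show ?thesis
      using sn'_mono[of t z] sn'_mono[of z t] that zz by (cases t z rule: linorder_cases) auto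
  qed
  ultimately show ?thesis using z by blast
qed

definition zero :: real where
  "zero = (SOME z. 0 < z \<and> z < L \<and> (\<forall>t. 0 \<le> t \<longrightarrow> t \<le> L \<longrightarrow> (lame t = 0 \<longleftrightarrow> t = z)))"

lemma zero: "0 < zero" "zero < L" "0 \<le> t \<Longrightarrow> t \<le> L \<Longrightarrow> lame t = 0 \<longleftrightarrow> t = zero"
  using someI_ex[OF ex_zero] unfolding zero_def[symmetric] by blast+

lemma lame_zero_iff:
  assumes "0 \<le> t" "t \<le> 2 * L" shows "lame t = 0 \<longleftrightarrow> t = zero \<or> t = 2 * L - zero"
proof (cases "t \<le> L")
  case True
  then show ?thesis using zero assms by auto
next
  case False
  then have "lame t = 0 \<longleftrightarrow> 2 * L - t = zero"
    using zero(3)[of "2 * L - t"] lame_sym(1)[of t] assms by simp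
  then show ?thesis using False zero by auto
qed

text \<open>The four nodes of one half period [0, 2 L]. From index 4 on the value is 2 L, so that
  the right neighbour of the last node can be written as \<open>node0 (Suc l)\<close> without
  passing to the next half period.\<close>

definition node0 :: "nat \<Rightarrow> real" where
  "node0 l = (if l = 0 then 0 else if l = 1 then zero else if l = 2 then L else if l = 3 then 2 * L - zero else 2 * L)"

definition node :: "nat \<Rightarrow> real" where
  "node i = 2 * L * real (i div 4) + node0 (i mod 4)"

lemma node_Suc: "node (Suc i) = 2 * L * real (i div 4) + node0 (Suc (i mod 4))"
proof (cases "i mod 4 = 3")
  case True
  then have "Suc i mod 4 = 0" "Suc i div 4 = Suc (i div 4)" by (simp_all add: mod_Suc div_Suc)
  then show ?thesis using True by (simp add: node_def node0_def algebra_simps)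
next
  case False
  then have "Suc i mod 4 = Suc (i mod 4)" "Suc i div 4 = i div 4" by (simp_all add: mod_Suc div_Suc)
  then show ?thesis by (simp add: node_def)
qed

text \<open>\<open>lame\<close> vanishes exactly at the nodes of odd index, so each interval between
  neighbouring nodes has one end where \<open>lame\<close> is 0 and one where it is not, as
  \<open>picone_partition\<close> demands. The points 0 and \<open>L\<close> are inserted for this
  reason.\<close>

lemma picone_nodes:
  fixes g g' :: "real \<Rightarrow> real"
  assumes g: "\<And>t. (g has_real_derivative g' t) (at t)" and g': "continuous_on UNIV g'"
    and g0: "\<And>i. i \<le> 4 * w \<Longrightarrow> g (node i) = 0"
  defines "I \<equiv> integral {0..2 * L * real w} (\<lambda>t. (g' t)\<^sup>2 - 6 * \<rho> t * (g t)\<^sup>2)"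
  shows "0 \<le> I \<and> (I \<le> 0 \<longrightarrow> (\<forall>t\<in>{0..2 * L * real w}. g t = 0))"
proof -
  have cases4: "l = 0 \<or> l = 1 \<or> l = 2 \<or> l = 3" if "l < 4" for l :: nat using that by linarith
  have mod4: "i mod 4 = 0 \<or> i mod 4 = 1 \<or> i mod 4 = 2 \<or> i mod 4 = 3" for i :: nat
    by (rule cases4) simp
  have lt: "node0 l < node0 (Suc l)" "0 \<le> node0 l" "node0 (Suc l) \<le> 2 * L" if "l < 4" for l
    using cases4[OF that] zero(1,2) by (auto simp: node0_def)
  have "node 0 = 0" "node (4 * w) = 2 * L * real w" by (simp_all add: node_def node0_def)
  moreover have "0 \<le> integral {node 0..node (4 * w)} (\<lambda>t. (g' t)\<^sup>2 - 6 * \<rho> t * (g t)\<^sup>2) \<and>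
    (integral {node 0..node (4 * w)} (\<lambda>t. (g' t)\<^sup>2 - 6 * \<rho> t * (g t)\<^sup>2) \<le> 0 \<longrightarrow>
      (\<forall>t\<in>{node 0..node (4 * w)}. g t = 0))"
  proof (rule picone_partition[where \<phi> = lame and \<psi> = lame' and w = "\<lambda>t. 6 * \<rho> t"])
    show "node i < node (Suc i)" for i
      unfolding node_Suc unfolding node_def using lt(1)[of "i mod 4"] by simp
    show "lame t \<noteq> 0" if t: "node i < t" "t < node (Suc i)" for i t
    proof -
      define s where "s = t - 2 * L * real (i div 4)"
      have s: "node0 (i mod 4) < s" "s < node0 (Suc (i mod 4))"
        using t unfolding node_Suc unfolding node_def s_def by auto
      then have "0 \<le> s" "s \<le> 2 * L" using lt[of "i mod 4"] by auto
      moreover have "s \<noteq> zero" "s \<noteq> 2 * L - zero"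
        using s mod4[of i] zero(1,2) by (auto simp: node0_def)
      ultimately have "lame s \<noteq> 0" using lame_zero_iff by simp
      then show ?thesis using lame_sym(2)[of s "i div 4"] by (simp add: s_def)
    qed
    show "lame (node i) \<noteq> 0 \<or> lame (node (Suc i)) \<noteq> 0" for i
    proof -
      have "lame (node0 (i mod 4)) \<noteq> 0 \<or> lame (node0 (Suc (i mod 4))) \<noteq> 0"
        using mod4[of i] zero(1,2) by (auto simp: node0_def lame_zero_iff)
      then show ?thesis
        unfolding node_Suc unfolding node_def
        using lame_sym(2)[of "node0 (i mod 4)" "i div 4"] lame_sym(2)[of "node0 (Suc (i mod 4))" "i div 4"]
        by (simp add: add.commute)
    qed
    show "(lame' has_real_derivative - (6 * \<rho> t) * lame t) (at t)" for t by (rule lame'_deriv)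
    show "lame t = 0 \<Longrightarrow> lame' t \<noteq> 0" for t by (rule lame_simple_zeros)
  qed (auto intro!: continuous_intros rho_continuous lame_deriv g g' g0)
  ultimately show ?thesis by (simp add: I_def)
qed

end

section \<open>Upper bound\<close>

context torus
begin

definition fourier :: "(real^2 \<Rightarrow> real) \<Rightarrow> int \<Rightarrow> real \<Rightarrow> real" where
  "fourier f j t = integral {0..circ} (\<lambda>s. f (pt s t) * tr j s)"

lemma continuous_tr: "continuous_on A g \<Longrightarrow> continuous_on A (\<lambda>x. tr j (g x))"
  by (rule continuous_on_compose2[OF continuous_on_has_derivative[OF tr_deriv, of UNIV]]) auto

lemma continuous_slice:
  assumes "continuous_on UNIV f" "continuous_on A g" "continuous_on A h"
  shows "continuous_on A (\<lambda>x. f (pt (g x) (h x)))"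
  by (rule continuous_on_compose2[OF assms(1)]) (auto intro!: continuous_intros assms)

lemma fourier_has_integral:
  assumes "continuous_on UNIV f"
  shows "((\<lambda>s. f (pt s t) * tr j s) has_integral fourier f j t) {0..circ}"
  unfolding fourier_def
  by (intro integrable_integral integrable_continuous_real continuous_intros continuous_slice continuous_tr assms)

lemma fourier_deriv:
  assumes f: "smooth f"
  shows "(fourier f j has_real_derivative fourier (partial_deriv 2 f) j t) (at t)"
proof -
  have c: "continuous_on UNIV f" "continuous_on UNIV (partial_deriv 2 f)"
    using f smooth_partial_deriv smooth_differentiable(2) by blast+
  have "((\<lambda>t. integral (cbox 0 (circ)) (\<lambda>s. f (pt s t) * tr j s)) has_real_derivative
      integral (cbox 0 (circ)) (\<lambda>s. partial_deriv 2 f (pt s t) * tr j s)) (at t within UNIV)"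
  proof (rule leibniz_rule_field_derivative)
    show "((\<lambda>t. f (pt s t) * tr j s) has_real_derivative partial_deriv 2 f (pt s t) * tr j s) (at t within UNIV)"
      for t s by (rule DERIV_cmult_right[OF smooth_slice_deriv(2)[OF f]])
    show "(\<lambda>s. f (pt s t) * tr j s) integrable_on cbox 0 (circ)" for t
      by (intro integrable_continuous continuous_intros continuous_slice continuous_tr c)
    show "continuous_on (UNIV \<times> cbox 0 (circ)) (\<lambda>(t, s). partial_deriv 2 f (pt s t) * tr j s)"
      unfolding split_beta by (intro continuous_intros continuous_slice continuous_tr c)
  qed auto
  then show ?thesis
    by (simp add: fourier_def[abs_def] cbox_interval)
qed

lemma partial_deriv_periodic:
  assumes "\<And>z. f (z + p) = f z"
  shows "partial_deriv i f (z + p) = partial_deriv i f z"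
proof -
  have "f (z + p + h *\<^sub>R axis i 1) = f (z + h *\<^sub>R axis i 1)" for h
    using assms[of "z + h *\<^sub>R axis i 1"] by (simp add: add_ac)
  then show ?thesis by (simp add: partial_deriv_def)
qed

lemma lattice_periods:
  assumes "periodic_wrt \<Lambda> f"
  shows "f (pt (s + circ) t) = f (pt s t)"
    and "even (m * n) \<Longrightarrow> f (pt s (t + 4 * L)) = f (pt s t)"
    and "odd (m * n) \<Longrightarrow> f (pt (s + real n * pi) (t + 2 * L)) = f (pt s t)"
proof -
  have f: "f (pt s t + T_basis1 m n) = f (pt s t)" "f (pt s t + T_basis2 m n) = f (pt s t)"
    using assms by (auto simp: periodic_wrt_lattice)
  show "f (pt (s + circ) t) = f (pt s t)" using f(1) by (simp add: basis_pt pt_add)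
  show "even (m * n) \<Longrightarrow> f (pt s (t + 4 * L)) = f (pt s t)" using f(2) by (simp add: basis_pt pt_add)
  show "odd (m * n) \<Longrightarrow> f (pt (s + real n * pi) (t + 2 * L)) = f (pt s t)"
    using f(2) by (simp add: basis_pt pt_add)
qed

lemma periodic_wrt_partial_deriv: "periodic_wrt \<Lambda> f \<Longrightarrow> periodic_wrt \<Lambda> (partial_deriv i f)"
  unfolding periodic_wrt_def using partial_deriv_periodic by blast

text \<open>Two integrations by parts in s turn the s-part of the Laplacian into the factor freq^2;
  the boundary terms cancel by periodicity in s.\<close>

lemma fourier_ode:
  assumes f: "f \<in> eigenspace u \<Lambda> \<mu>"
  shows "fourier (partial_deriv 2 (partial_deriv 2 f)) j t = ((freq j)\<^sup>2 - \<mu> * \<rho> t) * fourier f j t"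
proof -
  let ?S = "{0..circ}" and ?f1 = "partial_deriv 1 f" and ?f11 = "partial_deriv 1 (partial_deriv 1 f)"
  have smooth: "smooth f" and per: "periodic_wrt \<Lambda> f" and eq: "\<And>z. laplacian u f z = \<mu> * f z"
    using f by (auto simp: eigenspace_def)
  have c: "continuous_on UNIV f" using smooth smooth_differentiable(2) by blast
  have f22: "partial_deriv 2 (partial_deriv 2 f) (pt s t) = - \<mu> * \<rho> t * f (pt s t) - ?f11 (pt s t)" for s
    using eq[of "pt s t"] rho_bounds(3)[of t] unfolding laplacian_u
    by (simp add: field_simps)
  have A: "((\<lambda>s. ?f11 (pt s t) * tr j s + (freq j)\<^sup>2 * (f (pt s t) * tr j s)) has_integral 0) ?S"
  proof (rule integral_derivative_periodic)
    show "((\<lambda>s. ?f1 (pt s t) * tr j s - f (pt s t) * tr' j s) has_real_derivative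
        ?f11 (pt s t) * tr j s + (freq j)\<^sup>2 * (f (pt s t) * tr j s)) (at s)" for s
      by (rule DERIV_cong[OF DERIV_diff[OF DERIV_mult[OF smooth_slice_deriv(1)[OF smooth_partial_deriv[OF smooth]] tr_deriv]
              DERIV_mult[OF smooth_slice_deriv(1)[OF smooth] tr'_deriv]]]) (simp add: algebra_simps)
    show "?f1 (pt (circ) t) * tr j (circ) - f (pt (circ) t) * tr' j (circ) =
        ?f1 (pt 0 t) * tr j 0 - f (pt 0 t) * tr' j 0"
      using lattice_periods(1)[OF per, of 0 t] lattice_periods(1)[OF periodic_wrt_partial_deriv[OF per], of 1 0 t]
        tr_periodic[of j 0] tr'_periodic[of j 0] by simp
  qed (use n_pos in simp)
  have "((\<lambda>s. ((freq j)\<^sup>2 - \<mu> * \<rho> t) * (f (pt s t) * tr j s) -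
      (?f11 (pt s t) * tr j s + (freq j)\<^sup>2 * (f (pt s t) * tr j s))) has_integral
      ((freq j)\<^sup>2 - \<mu> * \<rho> t) * fourier f j t - 0) ?S"
    by (intro has_integral_diff has_integral_mult_right fourier_has_integral c A)
  also have "(\<lambda>s. ((freq j)\<^sup>2 - \<mu> * \<rho> t) * (f (pt s t) * tr j s) -
      (?f11 (pt s t) * tr j s + (freq j)\<^sup>2 * (f (pt s t) * tr j s))) =
      (\<lambda>s. partial_deriv 2 (partial_deriv 2 f) (pt s t) * tr j s)"
    unfolding f22 by (rule ext) (simp add: algebra_simps)
  finally show ?thesis unfolding fourier_def[of "partial_deriv 2 (partial_deriv 2 f)"] by (simp add: integral_unique)
qed

lemma integral_periodic_shift:
  fixes h :: "real \<Rightarrow> real"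
  assumes h: "continuous_on UNIV h" and per: "\<And>s. h (s + P) = h s" and P: "0 \<le> P"
  shows "integral {0..P} (\<lambda>s. h (s - a)) = integral {0..P} h"
proof -
  obtain H where H: "\<And>x. (H has_real_derivative h x) (at x)"
    using continuous_antiderivative[OF h] by blast
  have shift: "((\<lambda>x. H (x + c)) has_real_derivative h (x + c)) (at x)" for x c
    using H[of "x + c"] by (simp add: DERIV_shift)
  have int: "integral {0..P} (\<lambda>s. h (s - a)) = H (P - a) - H (- a)" for a
  proof (rule integral_unique)
    have "((\<lambda>s. h (s - a)) has_integral (H (P - a) - H (0 - a))) {0..P}"
    proof (rule fundamental_theorem_of_calculus[OF P])
      show "((\<lambda>s. H (s - a)) has_vector_derivative h (x - a)) (at x within {0..P})" for x
        using has_field_derivative_at_within[OF shift[where c = "- a" and x = x]]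
        by (simp add: has_real_derivative_iff_has_vector_derivative)
    qed
    then show "((\<lambda>s. h (s - a)) has_integral (H (P - a) - H (- a))) {0..P}" by simp
  qed
  have "\<forall>x. ((\<lambda>x. H (x + P) - H x) has_real_derivative 0) (at x)"
  proof
    show "((\<lambda>x. H (x + P) - H x) has_real_derivative 0) (at x)" for x
      using DERIV_diff[OF shift[where c = P and x = x] H[of x]] per[of x] by simp
  qed
  then have "H (- a + P) - H (- a) = H (0 + P) - H 0"
    by (rule DERIV_isconst_all)
  then show ?thesis using int[of a] int[of 0] by (simp add: add.commute)
qed

text \<open>The t-component of the second lattice vector in units of 2 L; for odd
  \<open>m * n\<close> it is only one unit, because that vector also moves s by n pi.\<close>

definition half_periods :: nat where "half_periods = (if even (m * n) then 2 else 1)"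

abbreviation "T \<equiv> 2 * L * real half_periods"

definition sign :: "int \<Rightarrow> real" where
  "sign j = (if odd (m * n) \<and> odd j then -1 else 1)"

text \<open>For odd \<open>m * n\<close>, undoing the translation of s under the integral produces
  the sign (-1)^j, so a Fourier mode is periodic or antiperiodic over \<open>T\<close>.\<close>

lemma fourier_shift:
  assumes f: "continuous_on UNIV f" and per: "periodic_wrt \<Lambda> f"
  shows "fourier f j T = sign j * fourier f j 0"
proof (cases "even (m * n)")
  case True
  then show ?thesis
    using lattice_periods(2)[OF per True, of _ 0]
    by (simp add: fourier_def half_periods_def sign_def)
next
  case False
  define h where "h s = f (pt s 0) * tr j s" for s
  have h: "continuous_on UNIV h"
    unfolding h_def[abs_def] by (intro continuous_intros continuous_slice continuous_tr f)
  have "f (pt s T) * tr j s = sign j * h (s - real n * pi)" for s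
  proof -
    have "f (pt s T) = f (pt (s - real n * pi) 0)"
      using lattice_periods(3)[OF per False, of "s - real n * pi" 0] False by (simp add: half_periods_def)
    moreover have "tr j s = sign j * tr j (s - real n * pi)"
      using tr_shift[of j "s - real n * pi"] False by (simp add: sign_def)
    ultimately show ?thesis by (simp add: h_def)
  qed
  then have "fourier f j T = sign j * integral {0..circ} (\<lambda>s. h (s - real n * pi))"
    by (simp add: fourier_def)
  also have "integral {0..circ} (\<lambda>s. h (s - real n * pi)) = integral {0..circ} h"
    by (rule integral_periodic_shift[OF h])
      (use n_pos in \<open>simp_all add: h_def tr_periodic lattice_periods(1)[OF per]\<close>)
  finally show ?thesis by (simp add: fourier_def h_def[abs_def])
qed

lemma coercive:
  assumes G: "\<And>t. (G has_real_derivative G' t) (at t)" and G': "continuous_on UNIV G'"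
    and nodes: "\<And>i. 2 * \<bar>j\<bar> \<le> 7 * int n \<Longrightarrow> i \<le> 4 * half_periods \<Longrightarrow> G (node i) = 0"
    and le: "integral {0..T} (\<lambda>t. (G' t)\<^sup>2 + ((freq j)\<^sup>2 - 6 * \<rho> t) * (G t)\<^sup>2) \<le> 0"
    and t: "t \<in> {0..T}"
  shows "G t = 0"
proof -
  have cG: "continuous_on A G" "continuous_on A G'" for A
    using continuous_on_has_derivative[OF G] continuous_on_subset[OF G'] by auto
  let ?E = "\<lambda>t. (G' t)\<^sup>2 + ((freq j)\<^sup>2 - 6 * \<rho> t) * (G t)\<^sup>2"
  have cE: "continuous_on {0..T} ?E" by (intro continuous_intros rho_continuous cG)
  show ?thesis
  proof (cases "2 * \<bar>j\<bar> \<le> 7 * int n")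
    case True
    have "integral {0..T} (\<lambda>t. (G' t)\<^sup>2 - 6 * \<rho> t * (G t)\<^sup>2) \<le> integral {0..T} ?E"
    proof (rule integral_le)
      show "(G' t)\<^sup>2 - 6 * \<rho> t * (G t)\<^sup>2 \<le> ?E t" for t
        using zero_le_power2[of "freq j * G t"] by (simp add: left_diff_distrib power_mult_distrib)
    qed (intro integrable_continuous_real continuous_intros rho_continuous cG)+
    then show ?thesis
      using picone_nodes[OF G G' nodes[OF True]] le t by auto
  next
    case False
    then have "7 * real n \<le> 2 * \<bar>real_of_int j\<bar>" by linarith
    then have "7 / 2 \<le> \<bar>freq j\<bar>"
      using n_pos by (simp add: freq_def abs_divide field_simps)
    then have "(7 / 2)\<^sup>2 \<le> \<bar>freq j\<bar>\<^sup>2" by (intro power_mono) auto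
    then have pos: "0 < (freq j)\<^sup>2 - 6 * \<rho> s" for s
      using rho_bounds(2)[of s] q1 by (simp add: power2_eq_square)
    have "0 < T" using L_pos by (simp add: half_periods_def)
    from integral_eq_0_imp_zero[OF this cE _ le t] pos
    have "?E t = 0" by (simp add: less_imp_le)
    then have "((freq j)\<^sup>2 - 6 * \<rho> t) * (G t)\<^sup>2 = 0"
      using pos[of t] mult_nonneg_nonneg[OF less_imp_le[OF pos[of t]] zero_le_power2[of "G t"]]
        zero_le_power2[of "G' t"] by linarith
    then show ?thesis using pos[of t] by simp
  qed
qed

text \<open>With more eigenfunctions than conditions, some nontrivial combination has all its low
  Fourier modes vanishing at all nodes. \<open>eigenmodes_vanish\<close> then kills every Fourier
  mode separately for each eigenvalue, and \<open>fourier_uniqueness\<close> turns this into a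
  linear relation inside a single independent set.\<close>

lemma eigenfunctions_bound:
  assumes F: "finite F" "F \<subseteq> {0..6}"
    and B: "\<And>\<mu>. \<mu> \<in> F \<Longrightarrow> finite (B \<mu>) \<and> B \<mu> \<subseteq> eigenspace u \<Lambda> \<mu> \<and> realfun.independent (B \<mu>)"
  shows "(\<Sum>\<mu>\<in>F. card (B \<mu>)) \<le> (2 * (7 * n div 2) + 1) * (4 * half_periods)"
proof (rule ccontr)
  assume contr: "\<not> ?thesis"
  define J where "J = 7 * n div 2"
  define N where "N = 4 * half_periods"
  have N: "0 < N" by (simp add: N_def half_periods_def)
  have T: "0 < T" using L_pos by (simp add: half_periods_def)
  define X where "X = (SIGMA \<mu>:F. B \<mu>)"
  have X: "finite X" unfolding X_def using F B by (intro finite_SigmaI) auto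
  have "card X = (\<Sum>\<mu>\<in>F. card (B \<mu>))"
    unfolding X_def using F B by (intro card_SigmaI) auto
  then have "(2 * J + 1) * N < card X" using contr by (simp add: J_def N_def)
  \<comment> \<open>The number \<open>i\<close> encodes a pair of a Fourier index,
    \<open>i div N\<close> moved down by \<open>J\<close>, and a node,
    \<open>i mod N\<close>.\<close>
  then obtain c where c: "\<And>i. i < (2 * J + 1) * N \<Longrightarrow>
      (\<Sum>x\<in>X. c x * fourier (snd x) (int (i div N) - int J) (node (i mod N))) = 0"
    and nz: "\<exists>x\<in>X. c x \<noteq> 0"
    using nontrivial_kernel[OF X, of "(2 * J + 1) * N"
        "\<lambda>i x. fourier (snd x) (int (i div N) - int J) (node (i mod N))"] by blast
  \<comment> \<open>The part of the combination that belongs to one eigenvalue. The conditions at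
    the nodes concern only the sum of these parts over all eigenvalues.\<close>
  define g where "g j \<mu> t = (\<Sum>b\<in>B \<mu>. c (\<mu>, b) * fourier b j t)" for j \<mu> t
  define g' where "g' j \<mu> t = (\<Sum>b\<in>B \<mu>. c (\<mu>, b) * fourier (partial_deriv 2 b) j t)" for j \<mu> t
  have smooth: "smooth b" "periodic_wrt \<Lambda> b" "b \<in> eigenspace u \<Lambda> \<mu>" if "\<mu> \<in> F" "b \<in> B \<mu>" for \<mu> b
    using B[OF that(1)] that(2) by (auto simp: eigenspace_def)
  have dg: "(g j \<mu> has_real_derivative g' j \<mu> t) (at t)" if "\<mu> \<in> F" for j \<mu> t
    unfolding g_def[abs_def] g'_def
    by (intro DERIV_sum DERIV_cmult fourier_deriv smooth(1)[OF that])
  have dg': "(g' j \<mu> has_real_derivative ((freq j)\<^sup>2 - \<mu> * \<rho> t) * g j \<mu> t) (at t)" if "\<mu> \<in> F" for j \<mu> t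
  proof -
    have "(g' j \<mu> has_real_derivative (\<Sum>b\<in>B \<mu>. c (\<mu>, b) * fourier (partial_deriv 2 (partial_deriv 2 b)) j t)) (at t)"
      unfolding g'_def[abs_def]
      by (intro DERIV_sum DERIV_cmult fourier_deriv smooth_partial_deriv smooth(1)[OF that])
    also have "(\<Sum>b\<in>B \<mu>. c (\<mu>, b) * fourier (partial_deriv 2 (partial_deriv 2 b)) j t) =
        ((freq j)\<^sup>2 - \<mu> * \<rho> t) * g j \<mu> t"
      unfolding g_def sum_distrib_left
      by (intro sum.cong refl) (simp add: fourier_ode[OF smooth(3)[OF that]])
    finally show ?thesis .
  qed
  have shift: "fourier b j T = sign j * fourier b j 0"
    "fourier (partial_deriv 2 b) j T = sign j * fourier (partial_deriv 2 b) j 0" if "\<mu> \<in> F" "b \<in> B \<mu>" for b j \<mu>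
    using smooth[OF that] smooth_partial_deriv smooth_differentiable(2) periodic_wrt_partial_deriv
    by (blast intro: fourier_shift)+
  have per: "g j \<mu> T = sign j * g j \<mu> 0" "g' j \<mu> T = sign j * g' j \<mu> 0" if "\<mu> \<in> F" for j \<mu>
    unfolding g_def g'_def sum_distrib_left
    by (intro sum.cong refl; simp add: shift[OF that])+
  have sum0: "(\<Sum>\<mu>\<in>F. g j \<mu> (node i)) = 0" if j: "2 * \<bar>j\<bar> \<le> 7 * int n" and i: "i < N" for j i
  proof -
    define l where "l = nat (j + int J) * N + i"
    have "\<bar>j\<bar> \<le> int J" using j by (simp add: J_def zdiv_int)
    then have J: "int (nat (j + int J)) = j + int J" "nat (j + int J) < 2 * J + 1" by auto
    then have le: "Suc (nat (j + int J)) * N \<le> (2 * J + 1) * N" by (intro mult_le_mono1) simp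
    have "l < Suc (nat (j + int J)) * N" using i by (simp add: l_def)
    then have "l < (2 * J + 1) * N" using le by (rule order_less_le_trans)
    moreover have "l div N = nat (j + int J)" "l mod N = i" using i by (simp_all add: l_def)
    ultimately have "(\<Sum>x\<in>X. c x * fourier (snd x) j (node i)) = 0"
      using c[of l] J by simp
    then show ?thesis
      unfolding g_def X_def using F B by (simp add: sum.Sigma split_beta)
  qed
  have g0: "g j \<mu> t = 0" if \<mu>: "\<mu> \<in> F" for j \<mu> t
  proof (rule eigenmodes_vanish[where F = F and \<Lambda> = 6 and g = "g j" and g' = "g' j" and \<rho> = \<rho> and
        p = "freq j" and P = T and \<epsilon> = "sign j" and M = "1 + q"])
    fix t assume t: "t \<in> {0..T}" and le: "integral {0..T} (\<lambda>t. (\<Sum>\<mu>\<in>F. g' j \<mu> t)\<^sup>2 +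
        ((freq j)\<^sup>2 - 6 * \<rho> t) * (\<Sum>\<mu>\<in>F. g j \<mu> t)\<^sup>2) \<le> 0"
    show "(\<Sum>\<mu>\<in>F. g j \<mu> t) = 0"
    proof (rule coercive[OF _ _ _ le t])
      show "((\<lambda>t. \<Sum>\<mu>\<in>F. g j \<mu> t) has_real_derivative (\<Sum>\<mu>\<in>F. g' j \<mu> t)) (at t)" for t
        by (intro DERIV_sum dg)
      show "continuous_on UNIV (\<lambda>t. \<Sum>\<mu>\<in>F. g' j \<mu> t)"
        by (intro continuous_on_sum continuous_on_has_derivative[OF dg'])
      fix i assume j: "2 * \<bar>j\<bar> \<le> 7 * int n" and i: "i \<le> 4 * half_periods"
      show "(\<Sum>\<mu>\<in>F. g j \<mu> (node i)) = 0"
      proof (cases "i < N")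
        case False
        \<comment> \<open>The last node costs no condition of its own: the sum at \<open>T\<close>
          is \<open>sign j\<close> times the sum at 0.\<close>
        have nodes: "node N = T" "node 0 = 0" by (simp_all add: node_def node0_def N_def)
        have "(\<Sum>\<mu>\<in>F. g j \<mu> T) = sign j * (\<Sum>\<mu>\<in>F. g j \<mu> 0)"
          unfolding sum_distrib_left by (intro sum.cong refl per)
        then show ?thesis
          using sum0[OF j, of 0] N False i nodes by (simp add: N_def)
      qed (rule sum0[OF j])
    qed
  qed (use F T \<mu> dg dg' per rho_bounds rho_continuous in \<open>auto simp: sign_def\<close>)
  obtain \<mu> b where x: "\<mu> \<in> F" "b \<in> B \<mu>" "c (\<mu>, b) \<noteq> 0" using nz by (auto simp: X_def)
  have cont: "continuous_on UNIV b" if "b \<in> B \<mu>" for b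
    using smooth_differentiable(2)[OF smooth(1)[OF x(1) that]] .
  have "(\<Sum>b\<in>B \<mu>. c (\<mu>, b) * b (pt s t)) = 0" for s t
  proof (rule fourier_uniqueness[where h = "\<lambda>s. \<Sum>b\<in>B \<mu>. c (\<mu>, b) * b (pt s t)"])
    show "continuous_on UNIV (\<lambda>s. \<Sum>b\<in>B \<mu>. c (\<mu>, b) * b (pt s t))"
      by (intro continuous_intros continuous_slice cont)
    show "(\<Sum>b\<in>B \<mu>. c (\<mu>, b) * b (pt (s + circ) t)) = (\<Sum>b\<in>B \<mu>. c (\<mu>, b) * b (pt s t))" for s
      by (intro sum.cong refl) (simp add: lattice_periods(1)[OF smooth(2)[OF x(1)]])
    fix j
    have "((\<lambda>s. \<Sum>b\<in>B \<mu>. c (\<mu>, b) * (b (pt s t) * tr j s)) has_integral g j \<mu> t) {0..circ}"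
      unfolding g_def using B[OF x(1)]
      by (intro has_integral_sum has_integral_mult_right fourier_has_integral cont) auto
    then show "integral {0..circ} (\<lambda>s. (\<Sum>b\<in>B \<mu>. c (\<mu>, b) * b (pt s t)) * tr j s) = 0"
      using g0[OF x(1)] by (simp add: integral_unique sum_distrib_right mult.assoc)
  qed
  then have "(\<Sum>b\<in>B \<mu>. c (\<mu>, b) * b z) = 0" for z
    using pt_nths[of z] by metis
  then have "(\<Sum>b\<in>B \<mu>. (\<lambda>z. c (\<mu>, b) * b z)) = 0"
    by (simp add: fun_eq_iff sum_fun_apply)
  then have "realfun.dependent (B \<mu>)"
    using B[OF x(1)] x by (subst realfun.dependent_finite) auto
  then show False using B[OF x(1)] by simp
qed

lemma upper_bound_N2:
  "eigenvalue_count u \<Lambda> {0..6} \<le> ereal (real ((2 * (7 * n div 2) + 1) * (4 * half_periods)))"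
  by (rule eigenvalue_count_le) (rule eigenfunctions_bound)

end

theorem theoremE:
  fixes m n :: nat
  assumes "0 < m" and "m < n" and "coprime m n"
  shows
    "(even (m * n) \<longrightarrow>
        N_T m n 1 \<ge> ereal (4 * real n + 5) \<and> 4 * real n + 5 \<ge> 13 \<and>
        s_ind_T m n \<ge> ereal (8 * real n + 4 * real m - 8) \<and> 8 * real n + 4 * real m - 8 \<ge> 12 \<and>
        l_ind_T m n \<ge> ereal (8 * real n + 4 * real m - 2) \<and> 8 * real n + 4 * real m - 2 \<ge> 18 \<and>
        N_T m n 2 < ereal (36 * (pi / sqrt 3) * real n - 1)) \<and>
     (odd (m * n) \<longrightarrow>
        N_T m n 1 \<ge> ereal (2 * real n + 5) \<and> 2 * real n + 5 \<ge> 11 \<and>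
        s_ind_T m n \<ge> ereal (4 * real n + 2 * real m - 8) \<and> 4 * real n + 2 * real m - 8 \<ge> 6 \<and>
        l_ind_T m n \<ge> ereal (4 * real n + 2 * real m - 2) \<and> 4 * real n + 2 * real m - 2 \<ge> 12 \<and>
        N_T m n 2 < ereal (18 * (pi / sqrt 3) * real n - 1))"
proof -
  interpret torus m n
    by unfold_locales (use assms in auto)
  have N1: "N_T m n 1 = eigenvalue_count u \<Lambda> {0..2}" and N2: "N_T m n 2 = eigenvalue_count u \<Lambda> {0..6}"
    by (simp_all add: N_T_def spectral_N_def)
  have l: "l_ind_T m n = eigenvalue_count u \<Lambda> {0<..<6}"
    by (simp add: l_ind_T_def l_ind_def)
  have s: "ereal (x - 14) \<le> s_ind_T m n" if x: "ereal x \<le> N_T m n 2" for x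
  proof -
    \<comment> \<open>The upper bound makes the count finite, so the subtractions in the s-index
      take place among real numbers.\<close>
    obtain N where N: "N_T m n 2 = ereal N"
      using x upper_bound_N2 unfolding N2 by (cases "eigenvalue_count u \<Lambda> {0..6}") auto
    have "s_ind_T m n = N_T m n 2 - ereal 1 - ereal 6 - (ereal 8 - ereal (real (lie_dim (cone_symmetries u))))"
      by (simp only: s_ind_T_def s_ind_def N_T_def one_ereal_def numeral_eq_ereal)
    also have "\<dots> = ereal (N - 1 - 6 - (8 - real (lie_dim (cone_symmetries u))))"
      unfolding N by simp
    also have "\<dots> \<ge> ereal (x - 14)"
      using x lie_dim_pos unfolding N by simp
    finally show ?thesis .
  qed
  \<comment> \<open>As pi \<ge> 3, pi / sqrt 3 is at least sqrt 3. The value 17/10 suffices: 8 (7 n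
    + 1) < 61.2 n - 1 for n \<ge> 2, and 4 (7 n + 1) < 30.6 n - 1 for n \<ge> 3.\<close>
  have "17 / 10 \<le> sqrt (3::real)"
    by (rule real_le_rsqrt) (simp add: power2_eq_square)
  moreover have "sqrt 3 \<le> pi / sqrt 3"
    using sin_x_le_x[of "pi / 6"] by (simp add: sin_30 le_divide_eq)
  ultimately have "17 / 10 \<le> pi / sqrt 3" by (rule order_trans)
  then have pi3: "17 / 10 * real n \<le> pi / sqrt 3 * real n"
    by (rule mult_right_mono) simp
  have half: "real (2 * (7 * n div 2) + 1) \<le> 7 * real n + 1"
  proof -
    have "2 * (7 * n div 2) + 1 \<le> 7 * n + 1" by simp
    then have "real (2 * (7 * n div 2) + 1) \<le> real (7 * n + 1)" by (rule of_nat_mono)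
    then show ?thesis by simp
  qed
  have n2: "2 \<le> n" using assms by simp
  show ?thesis
  proof (intro conjI impI)
    assume ev: "even (m * n)"
    show "N_T m n 1 \<ge> ereal (4 * real n + 5)"
      unfolding N1 by (rule order_trans[OF _ lower_bound_N1]) (use ev assms(1) in simp)
    show "s_ind_T m n \<ge> ereal (8 * real n + 4 * real m - 8)"
    proof -
      have "ereal (8 * real n + 4 * real m + 6) \<le> N_T m n 2"
        unfolding N2 by (rule order_trans[OF _ lower_bound_N2]) (use ev in simp)
      from order_trans[OF _ s[OF this]] show ?thesis by simp
    qed
    show "l_ind_T m n \<ge> ereal (8 * real n + 4 * real m - 2)"
      unfolding l by (rule order_trans[OF _ lower_bound_l_ind]) (use ev in simp)
    show "N_T m n 2 < ereal (36 * (pi / sqrt 3) * real n - 1)"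
      unfolding N2
    proof (rule le_less_trans[OF upper_bound_N2])
      have "real ((2 * (7 * n div 2) + 1) * (4 * half_periods)) = 8 * real (2 * (7 * n div 2) + 1)"
        using ev by (simp add: half_periods_def)
      moreover have "36 * (pi / sqrt 3) * real n = 36 * (pi / sqrt 3 * real n)" by (rule mult.assoc)
      moreover have "2 \<le> real n" using n2 by simp
      moreover have "x < y - 1"
        if "x = 8 * k" "y = 36 * e" "2 \<le> N" "k \<le> 7 * N + 1" "17 / 10 * N \<le> e" for x y k e N :: real
        using that by linarith
      ultimately have "real ((2 * (7 * n div 2) + 1) * (4 * half_periods)) < 36 * (pi / sqrt 3) * real n - 1"
        using half pi3 by blast
      then show "ereal (real ((2 * (7 * n div 2) + 1) * (4 * half_periods))) < ereal (36 * (pi / sqrt 3) * real n - 1)"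
        by (simp only: less_ereal.simps)
    qed
    show "4 * real n + 5 \<ge> 13" "8 * real n + 4 * real m - 8 \<ge> 12" "8 * real n + 4 * real m - 2 \<ge> 18"
      using n2 assms(1) by auto
  next
    assume od: "odd (m * n)"
    \<comment> \<open>For n = 2 the product would be even. The numerical bounds 11, 6 and 12 are the
      values at n = 3, m = 1.\<close>
    then have n3: "3 \<le> n" using n2 by (cases "n = 2") auto
    show "N_T m n 1 \<ge> ereal (2 * real n + 5)"
      unfolding N1 by (rule order_trans[OF _ lower_bound_N1]) (use od assms(1) in simp)
    show "s_ind_T m n \<ge> ereal (4 * real n + 2 * real m - 8)"
    proof -
      have "ereal (4 * real n + 2 * real m + 6) \<le> N_T m n 2"
        unfolding N2 by (rule order_trans[OF _ lower_bound_N2]) (use od in simp)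
      from order_trans[OF _ s[OF this]] show ?thesis by simp
    qed
    show "l_ind_T m n \<ge> ereal (4 * real n + 2 * real m - 2)"
      unfolding l by (rule order_trans[OF _ lower_bound_l_ind]) (use od in simp)
    show "N_T m n 2 < ereal (18 * (pi / sqrt 3) * real n - 1)"
      unfolding N2
    proof (rule le_less_trans[OF upper_bound_N2])
      have "real ((2 * (7 * n div 2) + 1) * (4 * half_periods)) = 4 * real (2 * (7 * n div 2) + 1)"
        using od by (simp add: half_periods_def)
      moreover have "18 * (pi / sqrt 3) * real n = 18 * (pi / sqrt 3 * real n)" by (rule mult.assoc)
      moreover have "3 \<le> real n" using n3 by simp
      moreover have "x < y - 1"
        if "x = 4 * k" "y = 18 * e" "3 \<le> N" "k \<le> 7 * N + 1" "17 / 10 * N \<le> e" for x y k e N :: real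
        using that by linarith
      ultimately have "real ((2 * (7 * n div 2) + 1) * (4 * half_periods)) < 18 * (pi / sqrt 3) * real n - 1"
        using half pi3 by blast
      then show "ereal (real ((2 * (7 * n div 2) + 1) * (4 * half_periods))) < ereal (18 * (pi / sqrt 3) * real n - 1)"
        by (simp only: less_ereal.simps)
    qed
    show "2 * real n + 5 \<ge> 11" "4 * real n + 2 * real m - 8 \<ge> 6" "4 * real n + 2 * real m - 2 \<ge> 12"
      using n3 assms(1) by auto
  qed
qed

end
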